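(* Let $(\mathbb{D},\circ,I,\ast,J)$ be a duoidal category with $\mathbb{D}$ Cauchy complete. If the composite $\phi_JU^I:\mathbb{D}^I\to\mathbb{D}_J$ is full and faithful, then, for any bimonoid $(A,m,e,\delta,\varepsilon)$ in $\mathbb{D}$, the comparison functor $K=-\circ A:\mathbb{D}^I\to\mathbb{D}^A_A$ is an equivalence of categories if and only if $\phi_AU^I:\mathbb{D}^I\to\mathbb{D}_A$ is $\mathcal{G}^r_A$-Galois.
   Context: A duoidal category $(\mathbb{D},\circ,I,\ast,J)$ is a category with two monoidal structures $(\mathbb{D},\circ,I)$ and $(\mathbb{D},\ast,J)$, a natural transformation (interchange law) $\zeta_{W,X,Y,Z}:(W\ast X)\circ(Y\ast Z)\to(W\circ Y)\ast(X\circ Z)$ and morphisms $\Delta:I\to I\ast I$, $\mu:J\circ J\to J$, $\tau:I\to J$ such that, up to the coherence isomorphisms: (1) the two maps $(U\ast V)\circ(W\ast X)\circ(Y\ast Z)\to(U\circ W\circ Y)\ast(V\circ X\circ Z)$ given by $\zeta\cdot(\zeta\circ\mathrm{id})$ and $\zeta\cdot(\mathrm{id}\circ\zeta)$ agree; (2) the two maps $(U\ast V\ast W)\circ(X\ast Y\ast Z)\to(U\circ X)\ast(V\circ Y)\ast(W\circ Z)$ given by $(\zeta\ast\mathrm{id})\cdot\zeta$ and $(\mathrm{id}\ast\zeta)\cdot\zeta$ agree; (3) $I\circ(X\ast Y)\xrightarrow{\Delta\circ\mathrm{id}}(I\ast I)\circ(X\ast Y)\xrightarrow{\zeta}(I\circ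 X)\ast(I\circ Y)\simeq X\ast Y$ is the unit isomorphism, and symmetrically with $I$ on the right; (4) $X\circ Y\simeq(J\ast X)\circ(J\ast Y)\xrightarrow{\zeta}(J\circ J)\ast(X\circ Y)\xrightarrow{\mu\ast\mathrm{id}}J\ast(X\circ Y)\simeq X\circ Y$ is the identity, and symmetrically with $J$ on the right; (5) $(J,\mu,\tau)$ is a monoid in $(\mathbb{D},\circ,I)$ and $(I,\Delta,\tau)$ is a comonoid in $(\mathbb{D},\ast,J)$. A bimonoid in $\mathbb{D}$ is an object $A$ with a monoid structure $(A,m,e)$ in $(\mathbb{D},\circ,I)$ and a comonoid structure $(A,\delta,\varepsilon)$ in $(\mathbb{D},\ast,J)$ such that $\delta\cdot m=(m\ast m)\cdot\zeta_{A,A,A,A}\cdot(\delta\circ\delta)$, $\varepsilon\cdot m=\mu\cdot(\varepsilon\circ\varepsilon)$, $\delta\cdot e=(e\ast e)\cdot\Delta$, $\varepsilon\cdot e=\tau$. For a monoid $B$ in $(\mathbb{D},\circ,I)$ (here $B=A$ or $B=(J,\mu,\tau)$), $\mathbb{D}_B$ is the category of right $B$-modules (Eilenberg–Moore category of the monad $-\circ B$), with free–forgetful adjunction $\phi_B\dashv U_B$, $\phi_B(X)=X\circ B$. $\mathbb{D}^I$ is the category of right comodules over the comonoid $(I,\Delta,\tau)$ in $(\mathbb{D},\ast,J)$ (Eilenberg–Moore category of the comonad $-\ast I$), with forgetful–cofree adjunction $U^I\dashv\phi^I$, $\phi^I(X)=X\ast I$. The natural transformation $\lambda_X:(X\ast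 A)\circ A\xrightarrow{(X\ast A)\circ\delta}(X\ast A)\circ(A\ast A)\xrightarrow{\zeta}(X\circ A)\ast(A\circ A)\xrightarrow{(X\circ A)\ast m}(X\circ A)\ast A$ is a mixed distributive law from the monad $-\circ A$ to the comonad $\mathcal{G}^r_A=-\ast A$; $\widehat{\mathcal{G}^r_A}$ is the corresponding lifted comonad on $\mathbb{D}_A$, $(X,h)\mapsto(X\ast A,(h\ast A)\cdot\lambda_X)$, with comultiplication and counit those of $-\ast A$ on underlying objects. $\mathbb{D}^A_A=(\mathbb{D}_A)^{\widehat{\mathcal{G}^r_A}}$ is the category of $A$-Hopf modules: triples $(X,h,\vartheta)$ with $(X,h:X\circ A\to X)$ a right $A$-module in $(\mathbb{D},\circ,I)$, $(X,\vartheta:X\to X\ast A)$ a right $A$-comodule in $(\mathbb{D},\ast,J)$, and $\vartheta\cdot h=(h\ast A)\cdot\lambda_X\cdot(\vartheta\circ A)$. The comparison functor $K=-\circ A:\mathbb{D}^I\to\mathbb{D}^A_A$ sends $(X,\theta)$ to $\phi_A(X)$ with coaction $\kappa_{(X,\theta)}:X\circ A\xrightarrow{\theta\circ A}(X\ast I)\circ A\xrightarrow{(X\ast I)\circ\delta}(X\ast I)\circ(A\ast A)\xrightarrow{\zeta}(X\circ A)\ast(I\circ A)\simeq(X\circ A)\ast A$. Galois: write $F=\phi_AU^I$, $Q=\phi^IU_A$ for its right adjoint and $\epsilon:FQ\to1$ for the counit. $F$ is called $\mathcal{G}^r_A$-Galois if the comonad morphism $t_K:FQ\xrightarrow{\kappa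 Q}\widehat{\mathcal{G}^r_A}FQ\xrightarrow{\widehat{\mathcal{G}^r_A}\epsilon}\widehat{\mathcal{G}^r_A}$ is an isomorphism. A category is Cauchy complete if all idempotents split in it. *)

theory Defs
  imports Main
begin

section \<open>Categories, functors, natural transformations\<close>

text \<open>
  Arrows carry their source and target, and \<open>g \<cdot> f\<close> means ``first \<open>f\<close>, then \<open>g\<close>''.
  Operations are only meaningful on the carriers; their values elsewhere are irrelevant.
\<close>

record ('o, 'a) cat =
  obj :: "'o set"
  arr :: "'a set"
  src :: "'a \<Rightarrow> 'o"
  tgt :: "'a \<Rightarrow> 'o"
  ide :: "'o \<Rightarrow> 'a"
  cmp :: "'a \<Rightarrow> 'a \<Rightarrow> 'a"  (infixr "\<cdot>\<index>" 55)

definition hom :: "('o, 'a, 'z) cat_scheme \<Rightarrow> 'o \<Rightarrow> 'o \<Rightarrow> 'a set"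
  where "hom C X Y = {f \<in> arr C. src C f = X \<and> tgt C f = Y}"

locale category =
  fixes C :: "('o, 'a, 'z) cat_scheme" (structure)
  assumes src_obj: "f \<in> arr C \<Longrightarrow> src C f \<in> obj C"
    and tgt_obj: "f \<in> arr C \<Longrightarrow> tgt C f \<in> obj C"
    and ide_hom: "X \<in> obj C \<Longrightarrow> ide C X \<in> hom C X X"
    and cmp_hom: "\<lbrakk>f \<in> hom C X Y; g \<in> hom C Y Z\<rbrakk> \<Longrightarrow> g \<cdot> f \<in> hom C X Z"
    and cmp_ide_right: "f \<in> hom C X Y \<Longrightarrow> f \<cdot> ide C X = f"
    and cmp_ide_left: "f \<in> hom C X Y \<Longrightarrow> ide C Y \<cdot> f = f"
    and cmp_assoc: "\<lbrakk>f \<in> hom C W X; g \<in> hom C X Y; h \<in> hom C Y Z\<rbrakk>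
          \<Longrightarrow> (h \<cdot> g) \<cdot> f = h \<cdot> (g \<cdot> f)"

definition is_inverse :: "('o, 'a, 'z) cat_scheme \<Rightarrow> 'a \<Rightarrow> 'a \<Rightarrow> bool"
  where "is_inverse C f g \<longleftrightarrow>
    f \<in> arr C \<and> g \<in> hom C (tgt C f) (src C f) \<and>
    g \<cdot>\<^bsub>C\<^esub> f = ide C (src C f) \<and> f \<cdot>\<^bsub>C\<^esub> g = ide C (tgt C f)"

definition is_iso :: "('o, 'a, 'z) cat_scheme \<Rightarrow> 'a \<Rightarrow> bool"
  where "is_iso C f \<longleftrightarrow> (\<exists>g. is_inverse C f g)"

definition inv_arr :: "('o, 'a, 'z) cat_scheme \<Rightarrow> 'a \<Rightarrow> 'a"
  where "inv_arr C f = (THE g. is_inverse C f g)"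

definition cauchy_complete :: "('o, 'a, 'z) cat_scheme \<Rightarrow> bool"
  where "cauchy_complete C \<longleftrightarrow>
    (\<forall>X \<in> obj C. \<forall>p \<in> hom C X X. p \<cdot>\<^bsub>C\<^esub> p = p \<longrightarrow>
      (\<exists>Y \<in> obj C. \<exists>r \<in> hom C X Y. \<exists>s \<in> hom C Y X.
        r \<cdot>\<^bsub>C\<^esub> s = ide C Y \<and> s \<cdot>\<^bsub>C\<^esub> r = p))"

record ('o, 'a, 'p, 'b) funct =
  on_obj :: "'o \<Rightarrow> 'p"
  on_arr :: "'a \<Rightarrow> 'b"

locale is_functor = A: category A + B: category B
  for A :: "('o, 'a, 'y) cat_scheme" and B :: "('p, 'b, 'z) cat_scheme" +
  fixes F :: "('o, 'a, 'p, 'b) funct"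
  assumes on_obj: "X \<in> obj A \<Longrightarrow> on_obj F X \<in> obj B"
    and on_hom: "f \<in> hom A X Y \<Longrightarrow> on_arr F f \<in> hom B (on_obj F X) (on_obj F Y)"
    and on_ide: "X \<in> obj A \<Longrightarrow> on_arr F (ide A X) = ide B (on_obj F X)"
    and on_cmp: "\<lbrakk>f \<in> hom A X Y; g \<in> hom A Y Z\<rbrakk>
          \<Longrightarrow> on_arr F (g \<cdot>\<^bsub>A\<^esub> f) = on_arr F g \<cdot>\<^bsub>B\<^esub> on_arr F f"

definition id_funct :: "('o, 'a, 'o, 'a) funct"
  where "id_funct = \<lparr>on_obj = (\<lambda>X. X), on_arr = (\<lambda>f. f)\<rparr>"

definition comp_funct ::
    "('p, 'b, 'q, 'c) funct \<Rightarrow> ('o, 'a, 'p, 'b) funct \<Rightarrow> ('o, 'a, 'q, 'c) funct"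
  where "comp_funct G F =
    \<lparr>on_obj = (\<lambda>X. on_obj G (on_obj F X)), on_arr = (\<lambda>f. on_arr G (on_arr F f))\<rparr>"

definition full :: "('o, 'a, 'y) cat_scheme \<Rightarrow> ('p, 'b, 'z) cat_scheme
    \<Rightarrow> ('o, 'a, 'p, 'b) funct \<Rightarrow> bool"
  where "full A B F \<longleftrightarrow> (\<forall>X \<in> obj A. \<forall>Y \<in> obj A.
    \<forall>g \<in> hom B (on_obj F X) (on_obj F Y). \<exists>f \<in> hom A X Y. on_arr F f = g)"

definition faithful :: "('o, 'a, 'y) cat_scheme \<Rightarrow> ('o, 'a, 'p, 'b) funct \<Rightarrow> bool"
  where "faithful A F \<longleftrightarrow> (\<forall>X \<in> obj A. \<forall>Y \<in> obj A. inj_on (on_arr F) (hom A X Y))"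

definition nat_trans :: "('o, 'a, 'y) cat_scheme \<Rightarrow> ('p, 'b, 'z) cat_scheme
    \<Rightarrow> ('o, 'a, 'p, 'b) funct \<Rightarrow> ('o, 'a, 'p, 'b) funct \<Rightarrow> ('o \<Rightarrow> 'b) \<Rightarrow> bool"
  where "nat_trans A B F G \<alpha> \<longleftrightarrow>
    (\<forall>X \<in> obj A. \<alpha> X \<in> hom B (on_obj F X) (on_obj G X)) \<and>
    (\<forall>f \<in> arr A. \<alpha> (tgt A f) \<cdot>\<^bsub>B\<^esub> on_arr F f = on_arr G f \<cdot>\<^bsub>B\<^esub> \<alpha> (src A f))"

definition nat_iso :: "('o, 'a, 'y) cat_scheme \<Rightarrow> ('p, 'b, 'z) cat_scheme
    \<Rightarrow> ('o, 'a, 'p, 'b) funct \<Rightarrow> ('o, 'a, 'p, 'b) funct \<Rightarrow> ('o \<Rightarrow> 'b) \<Rightarrow> bool"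
  where "nat_iso A B F G \<alpha> \<longleftrightarrow>
    nat_trans A B F G \<alpha> \<and> (\<forall>X \<in> obj A. is_iso B (\<alpha> X))"

definition equivalence_of_categories :: "('o, 'a, 'y) cat_scheme \<Rightarrow> ('p, 'b, 'z) cat_scheme
    \<Rightarrow> ('o, 'a, 'p, 'b) funct \<Rightarrow> bool"
  where "equivalence_of_categories A B F \<longleftrightarrow>
    is_functor A B F \<and>
    (\<exists>G \<alpha> \<beta>. is_functor B A G \<and>
      nat_iso A A id_funct (comp_funct G F) \<alpha> \<and>
      nat_iso B B (comp_funct F G) id_funct \<beta>)"


section \<open>Eilenberg--Moore categories\<close>

record ('o, 'a) monad =
  mfun :: "('o, 'a, 'o, 'a) funct"
  munit :: "'o \<Rightarrow> 'a"
  mmult :: "'o \<Rightarrow> 'a"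

record ('o, 'a) comonad =
  wfun :: "('o, 'a, 'o, 'a) funct"
  wcounit :: "'o \<Rightarrow> 'a"
  wcomult :: "'o \<Rightarrow> 'a"

text \<open>
  An object of an Eilenberg--Moore category is a pair \<open>(X, h)\<close> of an object and a structure
  arrow.  An arrow is an underlying arrow \<open>f\<close> tagged with its source and target, i.e.\ a triple
  \<open>((X, h), f, (Y, k))\<close>, so that hom-sets are disjoint.
\<close>

type_synonym ('o, 'a) em_obj = "'o \<times> 'a"
type_synonym ('o, 'a) em_arr = "('o, 'a) em_obj \<times> 'a \<times> ('o, 'a) em_obj"

definition em_objects :: "('o, 'a, 'z) cat_scheme \<Rightarrow> ('o, 'a) monad \<Rightarrow> ('o, 'a) em_obj set"
  where "em_objects C T = {(X, h). X \<in> obj C \<and> h \<in> hom C (on_obj (mfun T) X) X \<and>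
    h \<cdot>\<^bsub>C\<^esub> on_arr (mfun T) h = h \<cdot>\<^bsub>C\<^esub> mmult T X \<and>
    h \<cdot>\<^bsub>C\<^esub> munit T X = ide C X}"

definition em_cat ::
    "('o, 'a, 'z) cat_scheme \<Rightarrow> ('o, 'a) monad \<Rightarrow> (('o, 'a) em_obj, ('o, 'a) em_arr) cat"
  where "em_cat C T =
    \<lparr>obj = em_objects C T,
     arr = {((X, h), f, (Y, k)) | X h f Y k.
        (X, h) \<in> em_objects C T \<and> (Y, k) \<in> em_objects C T \<and> f \<in> hom C X Y \<and>
        f \<cdot>\<^bsub>C\<^esub> h = k \<cdot>\<^bsub>C\<^esub> on_arr (mfun T) f},
     src = (\<lambda>(P, f, Q). P),
     tgt = (\<lambda>(P, f, Q). Q),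
     ide = (\<lambda>P. (P, ide C (fst P), P)),
     cmp = (\<lambda>(P', g, Q') (P, f, Q). (P, g \<cdot>\<^bsub>C\<^esub> f, Q'))\<rparr>"

definition coem_objects :: "('o, 'a, 'z) cat_scheme \<Rightarrow> ('o, 'a) comonad \<Rightarrow> ('o, 'a) em_obj set"
  where "coem_objects C G = {(X, \<theta>). X \<in> obj C \<and> \<theta> \<in> hom C X (on_obj (wfun G) X) \<and>
    on_arr (wfun G) \<theta> \<cdot>\<^bsub>C\<^esub> \<theta> = wcomult G X \<cdot>\<^bsub>C\<^esub> \<theta> \<and>
    wcounit G X \<cdot>\<^bsub>C\<^esub> \<theta> = ide C X}"

definition coem_cat ::
    "('o, 'a, 'z) cat_scheme \<Rightarrow> ('o, 'a) comonad \<Rightarrow> (('o, 'a) em_obj, ('o, 'a) em_arr) cat"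
  where "coem_cat C G =
    \<lparr>obj = coem_objects C G,
     arr = {((X, \<theta>), f, (Y, \<phi>)) | X \<theta> f Y \<phi>.
        (X, \<theta>) \<in> coem_objects C G \<and> (Y, \<phi>) \<in> coem_objects C G \<and> f \<in> hom C X Y \<and>
        \<phi> \<cdot>\<^bsub>C\<^esub> f = on_arr (wfun G) f \<cdot>\<^bsub>C\<^esub> \<theta>},
     src = (\<lambda>(P, f, Q). P),
     tgt = (\<lambda>(P, f, Q). Q),
     ide = (\<lambda>P. (P, ide C (fst P), P)),
     cmp = (\<lambda>(P', g, Q') (P, f, Q). (P, g \<cdot>\<^bsub>C\<^esub> f, Q'))\<rparr>"

definition forgetful :: "(('o, 'a) em_obj, ('o, 'a) em_arr, 'o, 'a) funct"
  where "forgetful = \<lparr>on_obj = (\<lambda>(X, h). X), on_arr = (\<lambda>(P, f, Q). f)\<rparr>"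

definition free_alg :: "('o, 'a) monad \<Rightarrow> 'o \<Rightarrow> ('o, 'a) em_obj"
  where "free_alg T X = (on_obj (mfun T) X, mmult T X)"

definition free_funct ::
    "('o, 'a, 'z) cat_scheme \<Rightarrow> ('o, 'a) monad
      \<Rightarrow> ('o, 'a, ('o, 'a) em_obj, ('o, 'a) em_arr) funct"
  where "free_funct C T =
    \<lparr>on_obj = free_alg T,
     on_arr = (\<lambda>f. (free_alg T (src C f), on_arr (mfun T) f, free_alg T (tgt C f)))\<rparr>"

definition cofree_coalg :: "('o, 'a) comonad \<Rightarrow> 'o \<Rightarrow> ('o, 'a) em_obj"
  where "cofree_coalg G X = (on_obj (wfun G) X, wcomult G X)"

definition cofree_funct ::
    "('o, 'a, 'z) cat_scheme \<Rightarrow> ('o, 'a) comonad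
      \<Rightarrow> ('o, 'a, ('o, 'a) em_obj, ('o, 'a) em_arr) funct"
  where "cofree_funct C G =
    \<lparr>on_obj = cofree_coalg G,
     on_arr = (\<lambda>f. (cofree_coalg G (src C f), on_arr (wfun G) f, cofree_coalg G (tgt C f)))\<rparr>"

text \<open>The counit of the free--forgetful adjunction at \<open>(X, h)\<close> is \<open>h\<close> itself; the counit of the
  forgetful--cofree adjunction is the counit of the comonad.\<close>

definition free_forgetful_counit :: "('o, 'a) monad \<Rightarrow> ('o, 'a) em_obj \<Rightarrow> ('o, 'a) em_arr"
  where "free_forgetful_counit T = (\<lambda>(X, h). (free_alg T X, h, (X, h)))"

definition forgetful_cofree_counit :: "('o, 'a) comonad \<Rightarrow> 'o \<Rightarrow> 'a"
  where "forgetful_cofree_counit G = wcounit G"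


section \<open>Monoidal categories, monoids and comonoids\<close>

text \<open>\<open>X \<otimes> Y\<close> is the tensor of objects and \<open>f \<otimes>\<^sub>a g\<close> that of arrows.\<close>

record ('o, 'a) tensor =
  tob :: "'o \<Rightarrow> 'o \<Rightarrow> 'o"  (infixr "\<otimes>\<index>" 70)
  tar :: "'a \<Rightarrow> 'a \<Rightarrow> 'a"  (infixr "\<otimes>\<^sub>a\<index>" 70)
  tunit :: 'o
  assoc :: "'o \<Rightarrow> 'o \<Rightarrow> 'o \<Rightarrow> 'a"
  lunit :: "'o \<Rightarrow> 'a"
  runit :: "'o \<Rightarrow> 'a"

locale monoidal_category = category C
  for C :: "('o, 'a, 'z) cat_scheme" (structure) +
  fixes M :: "('o, 'a) tensor"
  assumes tob_obj: "\<lbrakk>X \<in> obj C; Y \<in> obj C\<rbrakk> \<Longrightarrow> X \<otimes>\<^bsub>M\<^esub> Y \<in> obj C"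
    and tunit_obj: "tunit M \<in> obj C"
    and tar_hom: "\<lbrakk>f \<in> hom C X X'; g \<in> hom C Y Y'\<rbrakk>
          \<Longrightarrow> f \<otimes>\<^sub>a\<^bsub>M\<^esub> g \<in> hom C (X \<otimes>\<^bsub>M\<^esub> Y) (X' \<otimes>\<^bsub>M\<^esub> Y')"
    and tar_ide: "\<lbrakk>X \<in> obj C; Y \<in> obj C\<rbrakk>
          \<Longrightarrow> ide C X \<otimes>\<^sub>a\<^bsub>M\<^esub> ide C Y = ide C (X \<otimes>\<^bsub>M\<^esub> Y)"
    and tar_cmp: "\<lbrakk>f \<in> hom C X X'; f' \<in> hom C X' X''; g \<in> hom C Y Y'; g' \<in> hom C Y' Y''\<rbrakk>
          \<Longrightarrow> (f' \<cdot> f) \<otimes>\<^sub>a\<^bsub>M\<^esub> (g' \<cdot> g) = (f' \<otimes>\<^sub>a\<^bsub>M\<^esub> g') \<cdot> (f \<otimes>\<^sub>a\<^bsub>M\<^esub> g)"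
    and assoc_hom: "\<lbrakk>X \<in> obj C; Y \<in> obj C; Z \<in> obj C\<rbrakk>
          \<Longrightarrow> assoc M X Y Z \<in> hom C ((X \<otimes>\<^bsub>M\<^esub> Y) \<otimes>\<^bsub>M\<^esub> Z) (X \<otimes>\<^bsub>M\<^esub> (Y \<otimes>\<^bsub>M\<^esub> Z))"
    and assoc_iso: "\<lbrakk>X \<in> obj C; Y \<in> obj C; Z \<in> obj C\<rbrakk> \<Longrightarrow> is_iso C (assoc M X Y Z)"
    and assoc_nat: "\<lbrakk>f \<in> hom C X X'; g \<in> hom C Y Y'; h \<in> hom C Z Z'\<rbrakk>
          \<Longrightarrow> assoc M X' Y' Z' \<cdot> ((f \<otimes>\<^sub>a\<^bsub>M\<^esub> g) \<otimes>\<^sub>a\<^bsub>M\<^esub> h)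
            = (f \<otimes>\<^sub>a\<^bsub>M\<^esub> (g \<otimes>\<^sub>a\<^bsub>M\<^esub> h)) \<cdot> assoc M X Y Z"
    and lunit_hom: "X \<in> obj C \<Longrightarrow> lunit M X \<in> hom C (tunit M \<otimes>\<^bsub>M\<^esub> X) X"
    and lunit_iso: "X \<in> obj C \<Longrightarrow> is_iso C (lunit M X)"
    and lunit_nat: "f \<in> hom C X Y
          \<Longrightarrow> lunit M Y \<cdot> (ide C (tunit M) \<otimes>\<^sub>a\<^bsub>M\<^esub> f) = f \<cdot> lunit M X"
    and runit_hom: "X \<in> obj C \<Longrightarrow> runit M X \<in> hom C (X \<otimes>\<^bsub>M\<^esub> tunit M) X"
    and runit_iso: "X \<in> obj C \<Longrightarrow> is_iso C (runit M X)"
    and runit_nat: "f \<in> hom C X Y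
          \<Longrightarrow> runit M Y \<cdot> (f \<otimes>\<^sub>a\<^bsub>M\<^esub> ide C (tunit M)) = f \<cdot> runit M X"
    and pentagon: "\<lbrakk>W \<in> obj C; X \<in> obj C; Y \<in> obj C; Z \<in> obj C\<rbrakk>
          \<Longrightarrow> (ide C W \<otimes>\<^sub>a\<^bsub>M\<^esub> assoc M X Y Z) \<cdot> assoc M W (X \<otimes>\<^bsub>M\<^esub> Y) Z
              \<cdot> (assoc M W X Y \<otimes>\<^sub>a\<^bsub>M\<^esub> ide C Z)
            = assoc M W X (Y \<otimes>\<^bsub>M\<^esub> Z) \<cdot> assoc M (W \<otimes>\<^bsub>M\<^esub> X) Y Z"
    and triangle: "\<lbrakk>X \<in> obj C; Y \<in> obj C\<rbrakk>
          \<Longrightarrow> (ide C X \<otimes>\<^sub>a\<^bsub>M\<^esub> lunit M Y) \<cdot> assoc M X (tunit M) Y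
            = runit M X \<otimes>\<^sub>a\<^bsub>M\<^esub> ide C Y"

definition monoid_in :: "('o, 'a, 'z) cat_scheme \<Rightarrow> ('o, 'a) tensor \<Rightarrow> 'o \<Rightarrow> 'a \<Rightarrow> 'a \<Rightarrow> bool"
  where "monoid_in C M B m e \<longleftrightarrow>
    B \<in> obj C \<and> m \<in> hom C (B \<otimes>\<^bsub>M\<^esub> B) B \<and> e \<in> hom C (tunit M) B \<and>
    m \<cdot>\<^bsub>C\<^esub> (m \<otimes>\<^sub>a\<^bsub>M\<^esub> ide C B) = m \<cdot>\<^bsub>C\<^esub> (ide C B \<otimes>\<^sub>a\<^bsub>M\<^esub> m) \<cdot>\<^bsub>C\<^esub> assoc M B B B \<and>
    m \<cdot>\<^bsub>C\<^esub> (e \<otimes>\<^sub>a\<^bsub>M\<^esub> ide C B) = lunit M B \<and>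
    m \<cdot>\<^bsub>C\<^esub> (ide C B \<otimes>\<^sub>a\<^bsub>M\<^esub> e) = runit M B"

definition comonoid_in :: "('o, 'a, 'z) cat_scheme \<Rightarrow> ('o, 'a) tensor \<Rightarrow> 'o \<Rightarrow> 'a \<Rightarrow> 'a \<Rightarrow> bool"
  where "comonoid_in C M B d c \<longleftrightarrow>
    B \<in> obj C \<and> d \<in> hom C B (B \<otimes>\<^bsub>M\<^esub> B) \<and> c \<in> hom C B (tunit M) \<and>
    assoc M B B B \<cdot>\<^bsub>C\<^esub> (d \<otimes>\<^sub>a\<^bsub>M\<^esub> ide C B) \<cdot>\<^bsub>C\<^esub> d = (ide C B \<otimes>\<^sub>a\<^bsub>M\<^esub> d) \<cdot>\<^bsub>C\<^esub> d \<and>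
    lunit M B \<cdot>\<^bsub>C\<^esub> (c \<otimes>\<^sub>a\<^bsub>M\<^esub> ide C B) \<cdot>\<^bsub>C\<^esub> d = ide C B \<and>
    runit M B \<cdot>\<^bsub>C\<^esub> (ide C B \<otimes>\<^sub>a\<^bsub>M\<^esub> c) \<cdot>\<^bsub>C\<^esub> d = ide C B"

definition tensor_funct ::
    "('o, 'a, 'z) cat_scheme \<Rightarrow> ('o, 'a) tensor \<Rightarrow> 'o \<Rightarrow> ('o, 'a, 'o, 'a) funct"
  where "tensor_funct C M B =
    \<lparr>on_obj = (\<lambda>X. X \<otimes>\<^bsub>M\<^esub> B), on_arr = (\<lambda>f. f \<otimes>\<^sub>a\<^bsub>M\<^esub> ide C B)\<rparr>"

definition tensor_monad ::
    "('o, 'a, 'z) cat_scheme \<Rightarrow> ('o, 'a) tensor \<Rightarrow> 'o \<Rightarrow> 'a \<Rightarrow> 'a \<Rightarrow> ('o, 'a) monad"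
  where "tensor_monad C M B m e =
    \<lparr>mfun = tensor_funct C M B,
     munit = (\<lambda>X. (ide C X \<otimes>\<^sub>a\<^bsub>M\<^esub> e) \<cdot>\<^bsub>C\<^esub> inv_arr C (runit M X)),
     mmult = (\<lambda>X. (ide C X \<otimes>\<^sub>a\<^bsub>M\<^esub> m) \<cdot>\<^bsub>C\<^esub> assoc M X B B)\<rparr>"

definition tensor_comonad ::
    "('o, 'a, 'z) cat_scheme \<Rightarrow> ('o, 'a) tensor \<Rightarrow> 'o \<Rightarrow> 'a \<Rightarrow> 'a \<Rightarrow> ('o, 'a) comonad"
  where "tensor_comonad C M B d c =
    \<lparr>wfun = tensor_funct C M B,
     wcounit = (\<lambda>X. runit M X \<cdot>\<^bsub>C\<^esub> (ide C X \<otimes>\<^sub>a\<^bsub>M\<^esub> c)),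
     wcomult = (\<lambda>X. inv_arr C (assoc M X B B) \<cdot>\<^bsub>C\<^esub> (ide C X \<otimes>\<^sub>a\<^bsub>M\<^esub> d))\<rparr>"


section \<open>Duoidal categories\<close>

text \<open>
  The structure \<open>(\<circ>, I)\<close> is \<open>circ\<close>, written \<open>\<odot>\<close>; the structure \<open>(\<ast>, J)\<close> is \<open>star\<close>, written
  \<open>\<star>\<close>.  The subscript \<open>a\<close> again marks the action on arrows.
\<close>

record ('o, 'a) duoidal = "('o, 'a) cat" +
  circ :: "('o, 'a) tensor"
  star :: "('o, 'a) tensor"
  zeta :: "'o \<Rightarrow> 'o \<Rightarrow> 'o \<Rightarrow> 'o \<Rightarrow> 'a"
  Delta :: 'a
  mu :: 'a
  tau :: 'a

abbreviation circ_obj  (infixr "\<odot>\<index>" 70)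
  where "X \<odot>\<^bsub>D\<^esub> Y \<equiv> tob (circ D) X Y"

abbreviation circ_arr  (infixr "\<odot>\<^sub>a\<index>" 70)
  where "f \<odot>\<^sub>a\<^bsub>D\<^esub> g \<equiv> tar (circ D) f g"

abbreviation star_obj  (infixr "\<star>\<index>" 70)
  where "X \<star>\<^bsub>D\<^esub> Y \<equiv> tob (star D) X Y"

abbreviation star_arr  (infixr "\<star>\<^sub>a\<index>" 70)
  where "f \<star>\<^sub>a\<^bsub>D\<^esub> g \<equiv> tar (star D) f g"

abbreviation unitI  ("\<I>\<index>")
  where "\<I>\<^bsub>D\<^esub> \<equiv> tunit (circ D)"

abbreviation unitJ  ("\<J>\<index>")
  where "\<J>\<^bsub>D\<^esub> \<equiv> tunit (star D)"

locale duoidal_category =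
  circ: monoidal_category D "circ D" + star: monoidal_category D "star D"
  for D :: "('o, 'a) duoidal" (structure) +
  assumes zeta_hom: "\<lbrakk>W \<in> obj D; X \<in> obj D; Y \<in> obj D; Z \<in> obj D\<rbrakk>
      \<Longrightarrow> zeta D W X Y Z \<in> hom D ((W \<star> X) \<odot> (Y \<star> Z)) ((W \<odot> Y) \<star> (X \<odot> Z))"
    and zeta_nat: "\<lbrakk>f \<in> hom D W W'; g \<in> hom D X X'; h \<in> hom D Y Y'; k \<in> hom D Z Z'\<rbrakk>
      \<Longrightarrow> zeta D W' X' Y' Z' \<cdot> ((f \<star>\<^sub>a g) \<odot>\<^sub>a (h \<star>\<^sub>a k))
        = ((f \<odot>\<^sub>a h) \<star>\<^sub>a (g \<odot>\<^sub>a k)) \<cdot> zeta D W X Y Z"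
    and Delta_hom: "Delta D \<in> hom D \<I> (\<I> \<star> \<I>)"
    and mu_hom: "mu D \<in> hom D (\<J> \<odot> \<J>) \<J>"
    and tau_hom: "tau D \<in> hom D \<I> \<J>"
    and zeta_circ_assoc: "\<lbrakk>U \<in> obj D; V \<in> obj D; W \<in> obj D; X \<in> obj D; Y \<in> obj D; Z \<in> obj D\<rbrakk>
      \<Longrightarrow> (assoc (circ D) U W Y \<star>\<^sub>a assoc (circ D) V X Z)
            \<cdot> zeta D (U \<odot> W) (V \<odot> X) Y Z
            \<cdot> (zeta D U V W X \<odot>\<^sub>a ide D (Y \<star> Z))
        = zeta D U V (W \<odot> Y) (X \<odot> Z)
            \<cdot> (ide D (U \<star> V) \<odot>\<^sub>a zeta D W X Y Z)
            \<cdot> assoc (circ D) (U \<star> V) (W \<star> X) (Y \<star> Z)"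
    and zeta_star_assoc: "\<lbrakk>U \<in> obj D; V \<in> obj D; W \<in> obj D; X \<in> obj D; Y \<in> obj D; Z \<in> obj D\<rbrakk>
      \<Longrightarrow> assoc (star D) (U \<odot> X) (V \<odot> Y) (W \<odot> Z)
            \<cdot> (zeta D U V X Y \<star>\<^sub>a ide D (W \<odot> Z))
            \<cdot> zeta D (U \<star> V) W (X \<star> Y) Z
        = (ide D (U \<odot> X) \<star>\<^sub>a zeta D V W Y Z)
            \<cdot> zeta D U (V \<star> W) X (Y \<star> Z)
            \<cdot> (assoc (star D) U V W \<odot>\<^sub>a assoc (star D) X Y Z)"
    and Delta_left: "\<lbrakk>X \<in> obj D; Y \<in> obj D\<rbrakk>
      \<Longrightarrow> (lunit (circ D) X \<star>\<^sub>a lunit (circ D) Y) \<cdot> zeta D \<I> \<I> X Y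
            \<cdot> (Delta D \<odot>\<^sub>a ide D (X \<star> Y))
        = lunit (circ D) (X \<star> Y)"
    and Delta_right: "\<lbrakk>X \<in> obj D; Y \<in> obj D\<rbrakk>
      \<Longrightarrow> (runit (circ D) X \<star>\<^sub>a runit (circ D) Y) \<cdot> zeta D X Y \<I> \<I>
            \<cdot> (ide D (X \<star> Y) \<odot>\<^sub>a Delta D)
        = runit (circ D) (X \<star> Y)"
    and mu_left: "\<lbrakk>X \<in> obj D; Y \<in> obj D\<rbrakk>
      \<Longrightarrow> lunit (star D) (X \<odot> Y) \<cdot> (mu D \<star>\<^sub>a ide D (X \<odot> Y)) \<cdot> zeta D \<J> X \<J> Y
            \<cdot> (inv_arr D (lunit (star D) X) \<odot>\<^sub>a inv_arr D (lunit (star D) Y))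
        = ide D (X \<odot> Y)"
    and mu_right: "\<lbrakk>X \<in> obj D; Y \<in> obj D\<rbrakk>
      \<Longrightarrow> runit (star D) (X \<odot> Y) \<cdot> (ide D (X \<odot> Y) \<star>\<^sub>a mu D) \<cdot> zeta D X \<J> Y \<J>
            \<cdot> (inv_arr D (runit (star D) X) \<odot>\<^sub>a inv_arr D (runit (star D) Y))
        = ide D (X \<odot> Y)"
    and J_monoid: "monoid_in D (circ D) \<J> (mu D) (tau D)"
    and I_comonoid: "comonoid_in D (star D) \<I> (Delta D) (tau D)"

context
  fixes D :: "('o, 'a) duoidal" (structure)
begin

definition bimonoid :: "'o \<Rightarrow> 'a \<Rightarrow> 'a \<Rightarrow> 'a \<Rightarrow> 'a \<Rightarrow> bool"
  where "bimonoid A m e \<delta> \<epsilon> \<longleftrightarrow>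
    monoid_in D (circ D) A m e \<and> comonoid_in D (star D) A \<delta> \<epsilon> \<and>
    \<delta> \<cdot> m = (m \<star>\<^sub>a m) \<cdot> zeta D A A A A \<cdot> (\<delta> \<odot>\<^sub>a \<delta>) \<and>
    \<epsilon> \<cdot> m = mu D \<cdot> (\<epsilon> \<odot>\<^sub>a \<epsilon>) \<and>
    \<delta> \<cdot> e = (e \<star>\<^sub>a e) \<cdot> Delta D \<and>
    \<epsilon> \<cdot> e = tau D"

definition right_modules :: "'o \<Rightarrow> 'a \<Rightarrow> 'a \<Rightarrow> (('o, 'a) em_obj, ('o, 'a) em_arr) cat"
  where "right_modules B m e = em_cat D (tensor_monad D (circ D) B m e)"

definition free_module_funct ::
    "'o \<Rightarrow> 'a \<Rightarrow> 'a \<Rightarrow> ('o, 'a, ('o, 'a) em_obj, ('o, 'a) em_arr) funct"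
  where "free_module_funct B m e = free_funct D (tensor_monad D (circ D) B m e)"

definition I_comonad :: "('o, 'a) comonad"
  where "I_comonad = tensor_comonad D (star D) \<I> (Delta D) (tau D)"

definition I_comodules :: "(('o, 'a) em_obj, ('o, 'a) em_arr) cat"
  where "I_comodules = coem_cat D I_comonad"

text \<open>The functor \<open>F = \<phi>\<^sub>B U\<^sup>I\<close>, its right adjoint \<open>Q = \<phi>\<^sup>I U\<^sub>B\<close>, and the counit \<open>FQ \<rightarrow> 1\<close> of the
  composite adjunction, for a monoid \<open>(B, m, e)\<close>.\<close>

definition F_funct ::
    "'o \<Rightarrow> 'a \<Rightarrow> 'a \<Rightarrow> (('o, 'a) em_obj, ('o, 'a) em_arr, ('o, 'a) em_obj, ('o, 'a) em_arr) funct"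
  where "F_funct B m e = comp_funct (free_module_funct B m e) forgetful"

definition Q_funct ::
    "(('o, 'a) em_obj, ('o, 'a) em_arr, ('o, 'a) em_obj, ('o, 'a) em_arr) funct"
  where "Q_funct = comp_funct (cofree_funct D I_comonad) forgetful"

definition FQ_counit :: "'o \<Rightarrow> 'a \<Rightarrow> 'a \<Rightarrow> ('o, 'a) em_obj \<Rightarrow> ('o, 'a) em_arr"
  where "FQ_counit B m e P =
    free_forgetful_counit (tensor_monad D (circ D) B m e) P
      \<cdot>\<^bsub>right_modules B m e\<^esub>
    on_arr (free_module_funct B m e) (forgetful_cofree_counit I_comonad (on_obj forgetful P))"

definition mixed_law :: "'o \<Rightarrow> 'a \<Rightarrow> 'a \<Rightarrow> 'o \<Rightarrow> 'a"
  where "mixed_law A m \<delta> X =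
    (ide D (X \<odot> A) \<star>\<^sub>a m) \<cdot> zeta D X A A A \<cdot> (ide D (X \<star> A) \<odot>\<^sub>a \<delta>)"

text \<open>The comonad on \<open>A\<close>-modules lifted from \<open>- \<star> A\<close> along the mixed distributive law.\<close>

definition lifted_obj :: "'o \<Rightarrow> 'a \<Rightarrow> 'a \<Rightarrow> ('o, 'a) em_obj \<Rightarrow> ('o, 'a) em_obj"
  where "lifted_obj A m \<delta> = (\<lambda>(X, h). (X \<star> A, (h \<star>\<^sub>a ide D A) \<cdot> mixed_law A m \<delta> X))"

definition lifted_comonad ::
    "'o \<Rightarrow> 'a \<Rightarrow> 'a \<Rightarrow> 'a \<Rightarrow> (('o, 'a) em_obj, ('o, 'a) em_arr) comonad"
  where "lifted_comonad A m \<delta> \<epsilon> =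
    (let G = tensor_comonad D (star D) A \<delta> \<epsilon>; L = lifted_obj A m \<delta> in
     \<lparr>wfun = \<lparr>on_obj = L, on_arr = (\<lambda>(P, f, Q). (L P, on_arr (wfun G) f, L Q))\<rparr>,
      wcounit = (\<lambda>P. (L P, wcounit G (fst P), P)),
      wcomult = (\<lambda>P. (L P, wcomult G (fst P), L (L P)))\<rparr>)"

text \<open>
  An object of the following category is \<open>((X, h), t)\<close> with \<open>t\<close> an arrow of \<open>A\<close>-modules from
  \<open>(X, h)\<close> to \<open>lifted_obj A m \<delta> (X, h)\<close>.  The underlying arrow \<open>\<theta> : X \<rightarrow> X \<star> A\<close> of \<open>t\<close> is the
  coaction, and that \<open>t\<close> is an arrow of modules is the Hopf condition
  \<open>\<theta> \<cdot> h = (h \<star> A) \<cdot> \<lambda>\<^sub>X \<cdot> (\<theta> \<odot> A)\<close>.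
\<close>

definition hopf_modules ::
    "'o \<Rightarrow> 'a \<Rightarrow> 'a \<Rightarrow> 'a \<Rightarrow> 'a \<Rightarrow>
      ((('o, 'a) em_obj, ('o, 'a) em_arr) em_obj, (('o, 'a) em_obj, ('o, 'a) em_arr) em_arr) cat"
  where "hopf_modules A m e \<delta> \<epsilon> = coem_cat (right_modules A m e) (lifted_comonad A m \<delta> \<epsilon>)"

text \<open>The natural transformation \<open>\<kappa>\<close> from \<open>F\<close> to \<open>F\<close> followed by the lifted comonad.\<close>

definition kappa :: "'o \<Rightarrow> 'a \<Rightarrow> 'a \<Rightarrow> 'a \<Rightarrow> ('o, 'a) em_obj \<Rightarrow> ('o, 'a) em_arr"
  where "kappa A m e \<delta> = (\<lambda>(X, \<theta>).
    (on_obj (F_funct A m e) (X, \<theta>),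
     (ide D (X \<odot> A) \<star>\<^sub>a lunit (circ D) A) \<cdot> zeta D X \<I> A A
       \<cdot> (ide D (X \<star> \<I>) \<odot>\<^sub>a \<delta>) \<cdot> (\<theta> \<odot>\<^sub>a ide D A),
     lifted_obj A m \<delta> (on_obj (F_funct A m e) (X, \<theta>))))"

definition comparison ::
    "'o \<Rightarrow> 'a \<Rightarrow> 'a \<Rightarrow> 'a \<Rightarrow>
      (('o, 'a) em_obj, ('o, 'a) em_arr,
       (('o, 'a) em_obj, ('o, 'a) em_arr) em_obj, (('o, 'a) em_obj, ('o, 'a) em_arr) em_arr) funct"
  where "comparison A m e \<delta> =
    (let K = (\<lambda>P. (on_obj (F_funct A m e) P, kappa A m e \<delta> P)) in
     \<lparr>on_obj = K,
      on_arr = (\<lambda>f. (K (src I_comodules f), on_arr (F_funct A m e) f, K (tgt I_comodules f)))\<rparr>)"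

definition t_K :: "'o \<Rightarrow> 'a \<Rightarrow> 'a \<Rightarrow> 'a \<Rightarrow> 'a \<Rightarrow> ('o, 'a) em_obj \<Rightarrow> ('o, 'a) em_arr"
  where "t_K A m e \<delta> \<epsilon> P =
    on_arr (wfun (lifted_comonad A m \<delta> \<epsilon>)) (FQ_counit A m e P)
      \<cdot>\<^bsub>right_modules A m e\<^esub>
    kappa A m e \<delta> (on_obj Q_funct P)"

definition galois :: "'o \<Rightarrow> 'a \<Rightarrow> 'a \<Rightarrow> 'a \<Rightarrow> 'a \<Rightarrow> bool"
  where "galois A m e \<delta> \<epsilon> \<longleftrightarrow>
    nat_iso (right_modules A m e) (right_modules A m e)
      (comp_funct (F_funct A m e) Q_funct) (wfun (lifted_comonad A m \<delta> \<epsilon>))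
      (t_K A m e \<delta> \<epsilon>)"

end

end

theory Submission
  imports Defs
begin

text \<open>
  Write \<open>F = \<phi>\<^sub>A U\<^sup>I\<close> and \<open>Q\<close> for its right adjoint.  If \<open>\<phi>\<^sub>J U\<^sup>I\<close> is full and faithful, the unit of
  its adjunction has a natural retraction; as \<open>\<epsilon> \<cdot> e = \<tau>\<close>, precomposing it with \<open>(- \<odot> \<epsilon>) \<star> I\<close> gives a
  natural retraction \<open>\<nu>\<close> of the unit \<open>1 \<rightarrow> QF\<close>.  The comodule category inherits Cauchy completeness,
  so the equalizers required by Beck's comonadicity theorem are splittings of idempotents and are
  preserved by \<open>F\<close>.  Hence \<open>F\<close> is comonadic, and \<open>K\<close> is an equivalence as soon as the comonad
  morphism \<open>t\<^sub>K\<close> is invertible.  Conversely, if \<open>K\<close> is an equivalence, then \<open>t\<^sub>K\<close> at \<open>M\<close> is a morphism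
  of coalgebras from \<open>K Q M\<close> to the cofree coalgebra on \<open>M\<close>, and both represent \<open>X \<mapsto> Hom (F X, M)\<close>.
  The coaction \<open>\<kappa>\<close> comes from the mixed distributive law by pushing an \<open>I\<close>-coaction forward along
  the comonoid morphism \<open>e\<close>.
\<close>

text \<open>Nothing provides equalizers in the comodule category, nor their preservation by F; a
  natural retraction \<nu> of the unit repairs both at once. Coassociativity makes the relevant
  arrow an idempotent, and a splitting consists of two equations between composites, which every
  functor preserves. The same \<nu> recovers an arrow f from F f as
  \<open>\<nu> \<cdot> Q F f \<cdot> \<eta>\<close>; this formula gives faithfulness of K and also
  supplies the preimages needed for fullness.

  The category of coalgebras of F Q is never formed. An invertible \<open>can\<close> translates
  each condition on coalgebras of G into one about F Q at the point of use.

  The monoid J is the right test case because every bimonoid A has its counit as a map to J, and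
  this map carries the unit of the monad of A to that of the monad of J. One retraction, found for
  J, therefore serves every A.

  The criterion is proved for an arbitrary adjunction with a comonad coacting on its left adjoint.
  The duoidal axioms enter afterwards, when a bimonoid is shown to supply such data.\<close>

notation on_obj  ("_\<langle>_\<rangle>" [1000, 0] 1000)
notation on_arr  ("_\<lceil>_\<rceil>" [1000, 0] 1000)

section \<open>Categories, functors and equivalences\<close>

lemma hom_iff: "f \<in> hom C X Y \<longleftrightarrow> f \<in> arr C \<and> src C f = X \<and> tgt C f = Y"
  by (auto simp: hom_def)

context category
begin

lemma arr_ide [simp]: "X \<in> obj C \<Longrightarrow> ide C X \<in> arr C"
  and src_ide [simp]: "X \<in> obj C \<Longrightarrow> src C (ide C X) = X"
  and tgt_ide [simp]: "X \<in> obj C \<Longrightarrow> tgt C (ide C X) = X"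
  using ide_hom by (auto simp: hom_iff)

lemma
  assumes "f \<in> arr C" "g \<in> arr C" "tgt C f = src C g"
  shows arr_cmp [simp]: "g \<cdot> f \<in> arr C"
    and src_cmp [simp]: "src C (g \<cdot> f) = src C f"
    and tgt_cmp [simp]: "tgt C (g \<cdot> f) = tgt C g"
  using cmp_hom[of f "src C f" "tgt C f" g "tgt C g"] assms by (auto simp: hom_iff)

lemma cmp_ide_arr [simp]: "\<lbrakk>f \<in> arr C; src C f = X\<rbrakk> \<Longrightarrow> f \<cdot> ide C X = f"
  and ide_cmp_arr [simp]: "\<lbrakk>f \<in> arr C; tgt C f = X\<rbrakk> \<Longrightarrow> ide C X \<cdot> f = f"
  using cmp_ide_right cmp_ide_left by (auto simp: hom_iff)

lemma cmp_assoc_arr [simp]: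
  "\<lbrakk>f \<in> arr C; g \<in> arr C; h \<in> arr C; tgt C f = src C g; tgt C g = src C h\<rbrakk>
    \<Longrightarrow> (h \<cdot> g) \<cdot> f = h \<cdot> g \<cdot> f"
  using cmp_assoc[of f "src C f" "tgt C f" g "tgt C g" h "tgt C h"] by (simp add: hom_iff)

declare src_obj [simp] tgt_obj [simp]

text \<open>Composites are kept associated to the right, so a rewrite rule for \<open>g \<cdot> f\<close> also has to be
  supplied with a tail.\<close>

lemma cmp_tail:
  assumes "g \<cdot> f = h" "f \<in> arr C" "g \<in> arr C" "tgt C f = src C g" "k \<in> arr C" "tgt C k = src C f"
  shows "g \<cdot> f \<cdot> k = h \<cdot> k"
  using assms cmp_assoc_arr[of k f g] by simp

lemma is_inverse_unique:
  assumes "is_inverse C f g" "is_inverse C f g'"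
  shows "g = g'"
proof -
  have "g \<cdot> f \<cdot> g' = ide C (src C f) \<cdot> g'"
    by (rule cmp_tail) (use assms in \<open>auto simp: is_inverse_def hom_iff\<close>)
  then show ?thesis
    using assms by (simp add: is_inverse_def hom_iff)
qed

text \<open>\<open>inv_arr\<close> is a definite description, so uniqueness of inverses is what
  gives it its meaning.\<close>

lemma is_inverse_inv_arr: "is_iso C f \<Longrightarrow> is_inverse C f (inv_arr C f)"
  unfolding is_iso_def inv_arr_def by (metis is_inverse_unique the_equality)

lemma
  assumes "is_iso C f"
  shows arr_iso: "f \<in> arr C"
    and arr_inv: "inv_arr C f \<in> arr C"
    and src_inv: "src C (inv_arr C f) = tgt C f"
    and tgt_inv: "tgt C (inv_arr C f) = src C f"
    and inv_cmp: "inv_arr C f \<cdot> f = ide C (src C f)"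
    and cmp_inv: "f \<cdot> inv_arr C f = ide C (tgt C f)"
  using is_inverse_inv_arr[OF assms] by (auto simp: is_inverse_def hom_iff)

lemmas inv_simps = arr_iso arr_inv src_inv tgt_inv inv_cmp cmp_inv

lemma iso_cancel_left:
  assumes "is_iso C f" "g \<in> arr C" "h \<in> arr C" "tgt C g = src C f" "tgt C h = src C f" "f \<cdot> g = f \<cdot> h"
  shows "g = h"
proof -
  have "inv_arr C f \<cdot> f \<cdot> g = inv_arr C f \<cdot> f \<cdot> h"
    by (simp add: assms(6))
  then show ?thesis
    using assms(1-5) by (simp add: inv_simps cmp_tail[OF inv_cmp])
qed

lemma iso_cancel_right:
  assumes "is_iso C f" "g \<in> arr C" "h \<in> arr C" "src C g = tgt C f" "src C h = tgt C f" "g \<cdot> f = h \<cdot> f"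
  shows "g = h"
proof -
  have "(g \<cdot> f) \<cdot> inv_arr C f = (h \<cdot> f) \<cdot> inv_arr C f"
    by (simp only: assms(6))
  then show ?thesis
    using assms(1-5) by (simp add: inv_simps)
qed

end

context is_functor
begin

lemma
  assumes "f \<in> arr A"
  shows fun_arr [simp]: "F\<lceil>f\<rceil> \<in> arr B"
    and fun_src [simp]: "src B (F\<lceil>f\<rceil>) = F\<langle>src A f\<rangle>"
    and fun_tgt [simp]: "tgt B (F\<lceil>f\<rceil>) = F\<langle>tgt A f\<rangle>"
  using on_hom[of f "src A f" "tgt A f"] assms by (auto simp: hom_iff)

lemma fun_cmp [simp]:
  "\<lbrakk>f \<in> arr A; g \<in> arr A; tgt A f = src A g\<rbrakk> \<Longrightarrow> F\<lceil>g \<cdot>\<^bsub>A\<^esub> f\<rceil> = F\<lceil>g\<rceil> \<cdot>\<^bsub>B\<^esub> F\<lceil>f\<rceil>"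
  using on_cmp[of f "src A f" "tgt A f" g "tgt A g"] by (simp add: hom_iff)

declare on_obj [simp] on_ide [simp]

end

lemma nat_transI:
  assumes "\<And>X. X \<in> obj A \<Longrightarrow> \<alpha> X \<in> hom B (F\<langle>X\<rangle>) (G\<langle>X\<rangle>)"
    and "\<And>f. f \<in> arr A \<Longrightarrow> \<alpha> (tgt A f) \<cdot>\<^bsub>B\<^esub> F\<lceil>f\<rceil> = G\<lceil>f\<rceil> \<cdot>\<^bsub>B\<^esub> \<alpha> (src A f)"
  shows "nat_trans A B F G \<alpha>"
  using assms by (simp add: nat_trans_def)

lemma
  assumes "nat_trans A B F G \<alpha>" and "X \<in> obj A"
  shows nat_trans_arr: "\<alpha> X \<in> arr B"
    and nat_trans_src: "src B (\<alpha> X) = F\<langle>X\<rangle>"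
    and nat_trans_tgt: "tgt B (\<alpha> X) = G\<langle>X\<rangle>"
  using assms by (auto simp: nat_trans_def hom_iff)

lemma nat_trans_natural:
  "\<lbrakk>nat_trans A B F G \<alpha>; f \<in> arr A; tgt A f = Y\<rbrakk>
    \<Longrightarrow> \<alpha> Y \<cdot>\<^bsub>B\<^esub> F\<lceil>f\<rceil> = G\<lceil>f\<rceil> \<cdot>\<^bsub>B\<^esub> \<alpha> (src A f)"
  by (auto simp: nat_trans_def)

lemma id_funct_simps [simp]: "id_funct\<langle>X\<rangle> = X" "id_funct\<lceil>f\<rceil> = f"
  by (simp_all add: id_funct_def)

lemma comp_funct_simps [simp]:
  "(comp_funct G F)\<langle>X\<rangle> = G\<langle>F\<langle>X\<rangle>\<rangle>" "(comp_funct G F)\<lceil>f\<rceil> = G\<lceil>F\<lceil>f\<rceil>\<rceil>"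
  by (simp_all add: comp_funct_def)

lemma nat_trans_vcomp:
  assumes "is_functor A B F" "is_functor A B G" "is_functor A B H"
    and \<alpha>: "nat_trans A B F G \<alpha>" and \<beta>: "nat_trans A B G H \<beta>"
  shows "nat_trans A B F H (\<lambda>X. \<beta> X \<cdot>\<^bsub>B\<^esub> \<alpha> X)"
proof -
  interpret F: is_functor A B F by fact
  interpret G: is_functor A B G by fact
  interpret H: is_functor A B H by fact
  note [simp] = nat_trans_arr[OF \<alpha>] nat_trans_src[OF \<alpha>] nat_trans_tgt[OF \<alpha>]
    nat_trans_arr[OF \<beta>] nat_trans_src[OF \<beta>] nat_trans_tgt[OF \<beta>]
  show ?thesis
    by (rule nat_transI)
      (simp_all add: hom_iff nat_trans_natural[OF \<alpha>] F.B.cmp_tail[OF nat_trans_natural[OF \<beta>]])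
qed

section \<open>Equivalences and fully faithful, essentially surjective functors\<close>

definition ess_surj where
  "ess_surj A B F \<longleftrightarrow> (\<forall>Y \<in> obj B. \<exists>X \<in> obj A. \<exists>i. is_iso B i \<and> src B i = F\<langle>X\<rangle> \<and> tgt B i = Y)"

text \<open>Choice provides an object \<open>g Y\<close> and an isomorphism \<open>i Y\<close> from
  its image for each \<open>Y\<close>. Every equation in the source category is then tested after
  applying \<open>F\<close>, where it becomes a cancellation of \<open>i\<close> against its
  inverse.\<close>

lemma equivalenceI:
  assumes "is_functor A B F" "full A B F" "faithful A F" "ess_surj A B F"
  shows "equivalence_of_categories A B F"
proof -
  interpret F: is_functor A B F by fact
  obtain g i where
    gi: "\<And>Y. Y \<in> obj B \<Longrightarrow> g Y \<in> obj A \<and> is_iso B (i Y) \<and> src B (i Y) = F\<langle>g Y\<rangle> \<and> tgt B (i Y) = Y"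
    using assms(4) unfolding ess_surj_def by metis
  have [simp]: "g Y \<in> obj A" "src B (i Y) = F\<langle>g Y\<rangle>" "tgt B (i Y) = Y"
    and iso: "is_iso B (i Y)" if "Y \<in> obj B" for Y
    using gi that by auto
  note [simp] = F.B.inv_simps[OF iso]
  have F_inj: "f = f'" if "f \<in> arr A" "f' \<in> arr A" "src A f = src A f'" "tgt A f = tgt A f'"
    "F\<lceil>f\<rceil> = F\<lceil>f'\<rceil>" for f f'
    using assms(3) that unfolding faithful_def inj_on_def
    by (metis F.A.src_obj F.A.tgt_obj hom_iff)
  have "\<exists>f. f \<in> hom A X Y \<and> F\<lceil>f\<rceil> = h"
    if "X \<in> obj A" "Y \<in> obj A" "h \<in> arr B" "src B h = F\<langle>X\<rangle>" "tgt B h = F\<langle>Y\<rangle>" for X Y h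
    using assms(2) that unfolding full_def by (metis hom_iff)
  then obtain \<Phi> where \<Phi>: "\<And>X Y h. \<lbrakk>X \<in> obj A; Y \<in> obj A; h \<in> arr B; src B h = F\<langle>X\<rangle>; tgt B h = F\<langle>Y\<rangle>\<rbrakk>
      \<Longrightarrow> \<Phi> X Y h \<in> hom A X Y \<and> F\<lceil>\<Phi> X Y h\<rceil> = h"
    by metis
  have [simp]: "\<Phi> X Y h \<in> arr A" "src A (\<Phi> X Y h) = X" "tgt A (\<Phi> X Y h) = Y" "F\<lceil>\<Phi> X Y h\<rceil> = h"
    if "X \<in> obj A" "Y \<in> obj A" "h \<in> arr B" "src B h = F\<langle>X\<rangle>" "tgt B h = F\<langle>Y\<rangle>" for X Y h
    using \<Phi>[OF that] by (auto simp: hom_iff)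
  \<comment> \<open>On arrows \<open>G\<close> is conjugation by \<open>i\<close>, pulled back
    through the full functor by \<open>\<Phi>\<close>; this is the choice that makes
    \<open>i\<close> natural.\<close>
  define G where "G = \<lparr>on_obj = g, on_arr = (\<lambda>h. \<Phi> (g (src B h)) (g (tgt B h))
      (inv_arr B (i (tgt B h)) \<cdot>\<^bsub>B\<^esub> h \<cdot>\<^bsub>B\<^esub> i (src B h)))\<rparr>"
  have G_obj [simp]: "G\<langle>Y\<rangle> = g Y" for Y
    by (simp add: G_def)
  have G_arr: "G\<lceil>h\<rceil> \<in> arr A" "src A (G\<lceil>h\<rceil>) = g (src B h)" "tgt A (G\<lceil>h\<rceil>) = g (tgt B h)"
    and FG: "F\<lceil>G\<lceil>h\<rceil>\<rceil> = inv_arr B (i (tgt B h)) \<cdot>\<^bsub>B\<^esub> h \<cdot>\<^bsub>B\<^esub> i (src B h)"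
    if "h \<in> arr B" for h
    using that by (simp_all add: G_def)
  note [simp] = G_arr
  interpret G: is_functor B A G
  proof
    fix f X Y assume "f \<in> hom B X Y"
    then show "G\<lceil>f\<rceil> \<in> hom A (G\<langle>X\<rangle>) (G\<langle>Y\<rangle>)" by (auto simp: hom_iff)
  next
    fix X assume [simp]: "X \<in> obj B"
    show "G\<lceil>ide B X\<rceil> = ide A (G\<langle>X\<rangle>)"
      by (rule F_inj) (simp_all add: FG)
  next
    fix f X Y h Z assume "f \<in> hom B X Y" "h \<in> hom B Y Z"
    then have [simp]: "f \<in> arr B" "h \<in> arr B" "tgt B f = src B h" by (auto simp: hom_iff)
    show "G\<lceil>h \<cdot>\<^bsub>B\<^esub> f\<rceil> = G\<lceil>h\<rceil> \<cdot>\<^bsub>A\<^esub> G\<lceil>f\<rceil>"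
      by (rule F_inj) (auto simp: FG hom_iff F.B.cmp_tail[OF F.B.cmp_inv[OF iso]])
  qed simp
  have "nat_trans B B (comp_funct F G) id_funct i"
    by (rule nat_transI)
      (simp_all add: hom_iff FG F.B.cmp_tail[OF F.B.cmp_inv[OF iso]])
  then have beta: "nat_iso B B (comp_funct F G) id_funct i"
    by (simp add: nat_iso_def iso)
  \<comment> \<open>The counit of the equivalence is \<open>i\<close>, so the unit has to be a lift
    of the inverse of \<open>i\<close> at \<open>F X\<close>; the lift of \<open>i\<close> at
    \<open>F X\<close> itself inverts it.\<close>
  define a where "a X = \<Phi> X (g (F\<langle>X\<rangle>)) (inv_arr B (i (F\<langle>X\<rangle>)))" for X
  have [simp]: "a X \<in> arr A" "src A (a X) = X" "tgt A (a X) = g (F\<langle>X\<rangle>)"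
    "F\<lceil>a X\<rceil> = inv_arr B (i (F\<langle>X\<rangle>))" if "X \<in> obj A" for X
    using that by (simp_all add: a_def)
  have "nat_trans A A id_funct (comp_funct G F) a"
    by (rule nat_transI, simp add: hom_iff, rule F_inj)
      (simp_all add: FG F.B.cmp_tail[OF F.B.cmp_inv[OF iso]])
  moreover have "is_inverse A (a X) (\<Phi> (g (F\<langle>X\<rangle>)) X (i (F\<langle>X\<rangle>)))" if "X \<in> obj A" for X
    using that unfolding is_inverse_def
    by (auto simp: hom_iff intro!: F_inj)
  ultimately have "nat_iso A A id_funct (comp_funct G F) a"
    by (auto simp: nat_iso_def is_iso_def)
  then show ?thesis
    unfolding equivalence_of_categories_def
    using beta assms(1) G.is_functor_axioms by blast
qed

text \<open>Naturality of the invertible \<beta> determines an arrow from its image under the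
  pseudo-inverse \<open>G\<close>, so \<open>G\<close> is faithful, and fullness of \<open>F\<close>
  follows from that. Essential surjectivity is witnessed by \<beta>.\<close>

lemma equivalenceD:
  assumes "equivalence_of_categories A B F"
  shows "full A B F" "ess_surj A B F"
proof -
  obtain G \<alpha> \<beta> where "is_functor A B F" "is_functor B A G"
    and \<alpha>: "nat_iso A A id_funct (comp_funct G F) \<alpha>" and \<beta>: "nat_iso B B (comp_funct F G) id_funct \<beta>"
    using assms unfolding equivalence_of_categories_def by blast
  interpret F: is_functor A B F by fact
  interpret G: is_functor B A G by fact
  have a: "nat_trans A A id_funct (comp_funct G F) \<alpha>" and b: "nat_trans B B (comp_funct F G) id_funct \<beta>"
    and ia: "\<And>X. X \<in> obj A \<Longrightarrow> is_iso A (\<alpha> X)" and ib: "\<And>X. X \<in> obj B \<Longrightarrow> is_iso B (\<beta> X)"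
    using \<alpha> \<beta> by (auto simp: nat_iso_def)
  note [simp] = nat_trans_arr[OF a] nat_trans_src[OF a] nat_trans_tgt[OF a] F.A.inv_simps[OF ia]
    nat_trans_arr[OF b] nat_trans_src[OF b] nat_trans_tgt[OF b] F.B.inv_simps[OF ib]
  have G_inj: "h = h'" if [simp]: "h \<in> arr B" "h' \<in> arr B" "src B h = src B h'" "tgt B h = tgt B h'"
    "G\<lceil>h\<rceil> = G\<lceil>h'\<rceil>" for h h'
  proof -
    have "h \<cdot>\<^bsub>B\<^esub> \<beta> (src B h) = h' \<cdot>\<^bsub>B\<^esub> \<beta> (src B h)"
      using nat_trans_natural[OF b, of h "tgt B h"] nat_trans_natural[OF b, of h' "tgt B h"]
      by simp
    then show ?thesis
      by (rule F.B.iso_cancel_right[OF ib, rotated -1]) simp_all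
  qed
  show "full A B F"
    unfolding full_def
  proof (intro ballI)
    fix X Y h assume [simp]: "X \<in> obj A" "Y \<in> obj A" and "h \<in> hom B (F\<langle>X\<rangle>) (F\<langle>Y\<rangle>)"
    then have [simp]: "h \<in> arr B" "src B h = F\<langle>X\<rangle>" "tgt B h = F\<langle>Y\<rangle>" by (auto simp: hom_iff)
    \<comment> \<open>Naturality of \<alpha> forces this candidate: it makes \<open>G F ?f\<close>
      agree with \<open>G h\<close> once \<open>\<alpha> X\<close> is cancelled, and
      \<open>G_inj\<close> then removes \<open>G\<close>.\<close>
    let ?f = "inv_arr A (\<alpha> Y) \<cdot>\<^bsub>A\<^esub> G\<lceil>h\<rceil> \<cdot>\<^bsub>A\<^esub> \<alpha> X"
    have "G\<lceil>F\<lceil>?f\<rceil>\<rceil> \<cdot>\<^bsub>A\<^esub> \<alpha> X = \<alpha> Y \<cdot>\<^bsub>A\<^esub> ?f"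
      using nat_trans_natural[OF a, of ?f Y] by (simp del: F.fun_cmp G.fun_cmp)
    also have "\<dots> = G\<lceil>h\<rceil> \<cdot>\<^bsub>A\<^esub> \<alpha> X"
      by (simp add: F.A.cmp_tail[OF F.A.cmp_inv[OF ia]])
    finally have "G\<lceil>F\<lceil>?f\<rceil>\<rceil> = G\<lceil>h\<rceil>"
      by (rule F.A.iso_cancel_right[OF ia, rotated -1]) (simp_all del: F.fun_cmp G.fun_cmp)
    then have "F\<lceil>?f\<rceil> = h"
      by (rule G_inj[rotated -1]) (simp_all del: F.fun_cmp G.fun_cmp)
    then show "\<exists>f \<in> hom A X Y. F\<lceil>f\<rceil> = h"
      by (intro bexI[of _ ?f]) (simp_all add: hom_iff)
  qed
  show "ess_surj A B F"
    unfolding ess_surj_def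
  proof
    fix Y assume "Y \<in> obj B"
    then show "\<exists>X \<in> obj A. \<exists>i. is_iso B i \<and> src B i = F\<langle>X\<rangle> \<and> tgt B i = Y"
      by (intro bexI[of _ "G\<langle>Y\<rangle>"] exI[of _ "\<beta> Y"]) (simp_all add: ib)
  qed
qed

section \<open>Comonads and adjunctions\<close>

locale comonad_on = category C + W: is_functor C C "wfun G"
  for C :: "('o, 'a, 'z) cat_scheme" (structure) and G :: "('o, 'a) comonad" +
  assumes counit_nat: "nat_trans C C (wfun G) id_funct (wcounit G)"
    and comult_nat: "nat_trans C C (wfun G) (comp_funct (wfun G) (wfun G)) (wcomult G)"
    and coassoc: "X \<in> obj C \<Longrightarrow>
      (wfun G)\<lceil>wcomult G X\<rceil> \<cdot> wcomult G X = wcomult G ((wfun G)\<langle>X\<rangle>) \<cdot> wcomult G X"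
    and counit_comult: "X \<in> obj C \<Longrightarrow>
      wcounit G ((wfun G)\<langle>X\<rangle>) \<cdot> wcomult G X = ide C ((wfun G)\<langle>X\<rangle>)"
    and fun_counit_comult: "X \<in> obj C \<Longrightarrow>
      (wfun G)\<lceil>wcounit G X\<rceil> \<cdot> wcomult G X = ide C ((wfun G)\<langle>X\<rangle>)"

lemma coem_cat_simps [simp]:
  "obj (coem_cat C G) = coem_objects C G"
  "src (coem_cat C G) h = fst h"
  "tgt (coem_cat C G) h = snd (snd h)"
  "ide (coem_cat C G) P = (P, ide C (fst P), P)"
  "cmp (coem_cat C G) h h' = (fst h', fst (snd h) \<cdot>\<^bsub>C\<^esub> fst (snd h'), snd (snd h))"
  by (simp_all add: coem_cat_def split_beta)

lemma arr_coem_cat: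
  "(P, f, R) \<in> arr (coem_cat C G) \<longleftrightarrow> P \<in> coem_objects C G \<and> R \<in> coem_objects C G \<and>
    f \<in> hom C (fst P) (fst R) \<and> snd R \<cdot>\<^bsub>C\<^esub> f = (wfun G)\<lceil>f\<rceil> \<cdot>\<^bsub>C\<^esub> snd P"
  by (cases P; cases R) (auto simp: coem_cat_def)

lemma coem_objects_iff:
  "(X, \<theta>) \<in> coem_objects C G \<longleftrightarrow> X \<in> obj C \<and> \<theta> \<in> hom C X ((wfun G)\<langle>X\<rangle>) \<and>
    (wfun G)\<lceil>\<theta>\<rceil> \<cdot>\<^bsub>C\<^esub> \<theta> = wcomult G X \<cdot>\<^bsub>C\<^esub> \<theta> \<and> wcounit G X \<cdot>\<^bsub>C\<^esub> \<theta> = ide C X"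
  by (simp add: coem_objects_def)

lemma coem_objectsD:
  assumes "P \<in> coem_objects C G"
  shows "fst P \<in> obj C" "snd P \<in> arr C" "src C (snd P) = fst P" "tgt C (snd P) = (wfun G)\<langle>fst P\<rangle>"
    "(wfun G)\<lceil>snd P\<rceil> \<cdot>\<^bsub>C\<^esub> snd P = wcomult G (fst P) \<cdot>\<^bsub>C\<^esub> snd P"
    "wcounit G (fst P) \<cdot>\<^bsub>C\<^esub> snd P = ide C (fst P)"
  using assms by (cases P; simp add: coem_objects_iff hom_iff)+

context comonad_on
begin

lemmas counit_simps [simp] = nat_trans_arr[OF counit_nat, simplified]
  nat_trans_src[OF counit_nat, simplified] nat_trans_tgt[OF counit_nat, simplified]
lemmas comult_simps [simp] = nat_trans_arr[OF comult_nat, simplified]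
  nat_trans_src[OF comult_nat, simplified] nat_trans_tgt[OF comult_nat, simplified]
lemmas counit_natural = nat_trans_natural[OF counit_nat, simplified]
lemmas comult_natural = nat_trans_natural[OF comult_nat, simplified]

lemma category_coem_cat: "category (coem_cat C G)"
proof
  fix h assume "h \<in> arr (coem_cat C G)"
  then show "src (coem_cat C G) h \<in> obj (coem_cat C G)" "tgt (coem_cat C G) h \<in> obj (coem_cat C G)"
    by (cases h; simp add: arr_coem_cat)+
next
  fix P assume "P \<in> obj (coem_cat C G)"
  then have P: "P \<in> coem_objects C G" by simp
  show "ide (coem_cat C G) P \<in> hom (coem_cat C G) P P"
    by (simp add: hom_iff arr_coem_cat P coem_objectsD[OF P])
next
  fix f g P Q R assume "f \<in> hom (coem_cat C G) P Q" "g \<in> hom (coem_cat C G) Q R"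
  then obtain f' g' where [simp]: "f = (P, f', Q)" "g = (Q, g', R)"
    and "(P, f', Q) \<in> arr (coem_cat C G)" "(Q, g', R) \<in> arr (coem_cat C G)"
    by (cases f; cases g) (auto simp: hom_iff)
  then have [simp]: "P \<in> coem_objects C G" "R \<in> coem_objects C G" "f' \<in> arr C" "g' \<in> arr C"
    "src C f' = fst P" "tgt C f' = fst Q" "src C g' = fst Q" "tgt C g' = fst R"
    and PQ: "Q \<in> coem_objects C G" "P \<in> coem_objects C G" "R \<in> coem_objects C G"
    and f': "snd Q \<cdot> f' = (wfun G)\<lceil>f'\<rceil> \<cdot> snd P"
    and g': "snd R \<cdot> g' = (wfun G)\<lceil>g'\<rceil> \<cdot> snd Q"
    by (auto simp: arr_coem_cat hom_iff)
  note [simp] = coem_objectsD(1-4)[OF PQ(1)] coem_objectsD(1-4)[OF PQ(2)] coem_objectsD(1-4)[OF PQ(3)]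
  show "g \<cdot>\<^bsub>coem_cat C G\<^esub> f \<in> hom (coem_cat C G) P R"
    by (simp add: hom_iff arr_coem_cat f' cmp_tail[OF g'])
next
  fix f P Q assume "f \<in> hom (coem_cat C G) P Q"
  then show "f \<cdot>\<^bsub>coem_cat C G\<^esub> ide (coem_cat C G) P = f" "ide (coem_cat C G) Q \<cdot>\<^bsub>coem_cat C G\<^esub> f = f"
    by (cases f; auto simp: hom_iff arr_coem_cat)+
next
  fix f g h P Q R S
  assume "f \<in> hom (coem_cat C G) P Q" "g \<in> hom (coem_cat C G) Q R" "h \<in> hom (coem_cat C G) R S"
  then show "(h \<cdot>\<^bsub>coem_cat C G\<^esub> g) \<cdot>\<^bsub>coem_cat C G\<^esub> f = h \<cdot>\<^bsub>coem_cat C G\<^esub> g \<cdot>\<^bsub>coem_cat C G\<^esub> f"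
    by (cases f; cases g; cases h) (auto simp: hom_iff arr_coem_cat)
qed

lemma is_functor_forgetful: "is_functor (coem_cat C G) C forgetful"
proof -
  interpret E: category "coem_cat C G" by (rule category_coem_cat)
  show ?thesis
    by unfold_locales
      (auto simp: forgetful_def hom_iff arr_coem_cat dest: coem_objectsD)
qed

lemma cofree_object: "X \<in> obj C \<Longrightarrow> cofree_coalg G X \<in> coem_objects C G"
  by (simp add: cofree_coalg_def coem_objects_iff hom_iff coassoc counit_comult)

lemma is_functor_cofree: "is_functor C (coem_cat C G) (cofree_funct C G)"
proof -
  interpret E: category "coem_cat C G" by (rule category_coem_cat)
  show ?thesis
  proof
    fix f X Y assume "f \<in> hom C X Y"
    then show "(cofree_funct C G)\<lceil>f\<rceil> \<in> hom (coem_cat C G) ((cofree_funct C G)\<langle>X\<rangle>) ((cofree_funct C G)\<langle>Y\<rangle>)"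
      by (auto simp: cofree_funct_def hom_iff arr_coem_cat cofree_object)
        (auto simp: cofree_coalg_def comult_natural)
  qed (auto simp: cofree_funct_def cofree_object[unfolded cofree_coalg_def] cofree_coalg_def hom_iff)
qed

text \<open>Composing the coalgebra square with \<open>G\<close> of the inverse on the left and with
  the inverse on the right shows that the inverse again respects the coactions.\<close>

lemma coem_iso:
  assumes f: "(P, f, R) \<in> arr (coem_cat C G)" and iso: "is_iso C f"
  shows "is_iso (coem_cat C G) (P, f, R)"
proof -
  have PR: "P \<in> coem_objects C G" "R \<in> coem_objects C G"
    and [simp]: "src C f = fst P" "tgt C f = fst R" and eq: "snd R \<cdot> f = (wfun G)\<lceil>f\<rceil> \<cdot> snd P"
    using f by (auto simp: arr_coem_cat hom_iff)
  note [simp] = inv_simps[OF iso] coem_objectsD(1-4)[OF PR(1)] coem_objectsD(1-4)[OF PR(2)]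
  let ?g = "inv_arr C f"
  have gf: "(wfun G)\<lceil>?g\<rceil> \<cdot> (wfun G)\<lceil>f\<rceil> = ide C ((wfun G)\<langle>fst P\<rangle>)"
    by (simp flip: W.fun_cmp)
  have "snd P \<cdot> ?g = (wfun G)\<lceil>?g\<rceil> \<cdot> ((wfun G)\<lceil>f\<rceil> \<cdot> snd P) \<cdot> ?g"
    by (simp add: cmp_tail[OF gf])
  also have "\<dots> = (wfun G)\<lceil>?g\<rceil> \<cdot> (snd R \<cdot> f) \<cdot> ?g"
    by (simp only: eq)
  also have "\<dots> = (wfun G)\<lceil>?g\<rceil> \<cdot> snd R"
    by simp
  finally have "is_inverse (coem_cat C G) (P, f, R) (R, ?g, P)"
    using f PR by (simp add: is_inverse_def arr_coem_cat hom_iff)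
  then show ?thesis
    unfolding is_iso_def by blast
qed

text \<open>Idempotents in \<open>C\<close> split compatibly with coactions, because \<open>r \<cdot> s = 1\<close> transports the
  coaction \<open>\<theta>\<close> to \<open>G r \<cdot> \<theta> \<cdot> s\<close>.\<close>

lemma cauchy_complete_coem_cat:
  assumes "cauchy_complete C"
  shows "cauchy_complete (coem_cat C G)"
  unfolding cauchy_complete_def
proof (intro ballI impI)
  fix P h assume P: "P \<in> obj (coem_cat C G)" and h: "h \<in> hom (coem_cat C G) P P"
    and idem: "h \<cdot>\<^bsub>coem_cat C G\<^esub> h = h"
  obtain X \<theta> p where [simp]: "P = (X, \<theta>)" "h = ((X, \<theta>), p, (X, \<theta>))"
    using h by (cases h) (auto simp: hom_iff)
  have [simp]: "X \<in> obj C" "p \<in> arr C" "src C p = X" "tgt C p = X" "\<theta> \<in> arr C" "src C \<theta> = X"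
    "tgt C \<theta> = (wfun G)\<langle>X\<rangle>" "p \<cdot> p = p"
    and p: "\<theta> \<cdot> p = (wfun G)\<lceil>p\<rceil> \<cdot> \<theta>"
    and co: "(wfun G)\<lceil>\<theta>\<rceil> \<cdot> \<theta> = wcomult G X \<cdot> \<theta>" "wcounit G X \<cdot> \<theta> = ide C X"
    using P h idem by (auto simp: hom_iff arr_coem_cat coem_objects_iff)
  have "p \<in> hom C X X" by (simp add: hom_iff)
  then obtain Y r s where "Y \<in> obj C" "r \<in> hom C X Y" "s \<in> hom C Y X" "r \<cdot> s = ide C Y" "s \<cdot> r = p"
    using assms \<open>X \<in> obj C\<close> \<open>p \<cdot> p = p\<close> unfolding cauchy_complete_def by blast
  then have [simp]: "Y \<in> obj C" "r \<in> arr C" "s \<in> arr C" "src C r = X" "tgt C r = Y" "src C s = Y"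
    "tgt C s = X" "r \<cdot> s = ide C Y" and sr: "s \<cdot> r = p"
    by (auto simp: hom_iff)
  have rp: "r \<cdot> p = r" and ps: "p \<cdot> s = s"
    by (simp_all add: sr[symmetric] cmp_tail[OF \<open>r \<cdot> s = ide C Y\<close>])
  let ?\<phi> = "(wfun G)\<lceil>r\<rceil> \<cdot> \<theta> \<cdot> s"
  \<comment> \<open>\<open>s\<close> and \<open>r\<close> become morphisms because \<open>p\<close>
    is one: \<open>G (s \<cdot> r)\<close> is \<open>G p\<close>, which passes \<theta> as
    \<open>p\<close>, and the idempotent is finally absorbed by \<open>p \<cdot> s = s\<close>,
    respectively \<open>r \<cdot> p = r\<close>.\<close>
  have s: "(wfun G)\<lceil>s\<rceil> \<cdot> ?\<phi> = \<theta> \<cdot> s"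
  proof -
    have "(wfun G)\<lceil>s\<rceil> \<cdot> ?\<phi> = (wfun G)\<lceil>s \<cdot> r\<rceil> \<cdot> \<theta> \<cdot> s"
      by simp
    also have "\<dots> = \<theta> \<cdot> p \<cdot> s"
      by (simp add: sr cmp_tail[OF p] del: W.fun_cmp)
    finally show ?thesis by (simp add: ps)
  qed
  have r: "?\<phi> \<cdot> r = (wfun G)\<lceil>r\<rceil> \<cdot> \<theta>"
  proof -
    have "?\<phi> \<cdot> r = (wfun G)\<lceil>r\<rceil> \<cdot> (wfun G)\<lceil>p\<rceil> \<cdot> \<theta>"
      by (simp add: sr p)
    also have "\<dots> = (wfun G)\<lceil>r \<cdot> p\<rceil> \<cdot> \<theta>"
      by (simp del: rp)
    finally show ?thesis by (simp add: rp del: W.fun_cmp)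
  qed
  \<comment> \<open>The factor \<open>G s\<close> of the first copy is joined to the second copy of
    \<open>?\<phi>\<close>, which reduces the claim to coassociativity of \<theta>.\<close>
  have "(wfun G)\<lceil>?\<phi>\<rceil> \<cdot> ?\<phi> = (wfun G)\<lceil>(wfun G)\<lceil>r\<rceil> \<cdot> \<theta>\<rceil> \<cdot> (wfun G)\<lceil>s\<rceil> \<cdot> ?\<phi>"
    by simp
  also have "\<dots> = (wfun G)\<lceil>(wfun G)\<lceil>r\<rceil>\<rceil> \<cdot> (wfun G)\<lceil>\<theta>\<rceil> \<cdot> \<theta> \<cdot> s"
    unfolding s by simp
  also have "\<dots> = wcomult G Y \<cdot> ?\<phi>"
    by (simp add: cmp_tail[OF co(1)] cmp_tail[OF comult_natural])
  finally have "(Y, ?\<phi>) \<in> coem_objects C G"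
    by (simp add: coem_objects_iff hom_iff cmp_tail[OF counit_natural] cmp_tail[OF co(2)])
  then show "\<exists>Q \<in> obj (coem_cat C G). \<exists>u \<in> hom (coem_cat C G) P Q. \<exists>v \<in> hom (coem_cat C G) Q P.
      u \<cdot>\<^bsub>coem_cat C G\<^esub> v = ide (coem_cat C G) Q \<and> v \<cdot>\<^bsub>coem_cat C G\<^esub> u = h"
    using P r s
    by (intro bexI[of _ "(Y, ?\<phi>)"] bexI[of _ "(P, r, (Y, ?\<phi>))"] bexI[of _ "((Y, ?\<phi>), s, P)"])
      (simp_all add: sr hom_iff arr_coem_cat)
qed

end

section \<open>Adjunctions and retractions of their units\<close>

locale adjunction = B: category B + A: category A + F: is_functor B A F + Q: is_functor A B Q
  for B :: "('o, 'a, 'y) cat_scheme" and A :: "('p, 'b, 'z) cat_scheme" and F Q +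
  fixes \<eta> :: "'o \<Rightarrow> 'a" and \<epsilon> :: "'p \<Rightarrow> 'b"
  assumes unit_nat: "nat_trans B B id_funct (comp_funct Q F) \<eta>"
    and counit_nat: "nat_trans A A (comp_funct F Q) id_funct \<epsilon>"
    and triangle_F: "X \<in> obj B \<Longrightarrow> \<epsilon> (F\<langle>X\<rangle>) \<cdot>\<^bsub>A\<^esub> F\<lceil>\<eta> X\<rceil> = ide A (F\<langle>X\<rangle>)"
    and triangle_Q: "M \<in> obj A \<Longrightarrow> Q\<lceil>\<epsilon> M\<rceil> \<cdot>\<^bsub>B\<^esub> \<eta> (Q\<langle>M\<rangle>) = ide B (Q\<langle>M\<rangle>)"
begin

lemmas unit_simps [simp] = nat_trans_arr[OF unit_nat, simplified]
  nat_trans_src[OF unit_nat, simplified] nat_trans_tgt[OF unit_nat, simplified]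
lemmas counit_simps [simp] = nat_trans_arr[OF counit_nat, simplified]
  nat_trans_src[OF counit_nat, simplified] nat_trans_tgt[OF counit_nat, simplified]
lemmas unit_natural = nat_trans_natural[OF unit_nat, simplified]
lemmas counit_natural = nat_trans_natural[OF counit_nat, simplified]

text \<open>A retraction of the unit is found by lifting the counit at \<open>F X\<close> along \<open>F\<close>.\<close>

lemma full_faithful_unit_retraction:
  assumes "full B A F" "faithful B F"
  obtains \<nu> where "nat_trans B B (comp_funct Q F) id_funct \<nu>"
    and "\<And>X. X \<in> obj B \<Longrightarrow> \<nu> X \<cdot>\<^bsub>B\<^esub> \<eta> X = ide B X"
proof -
  have F_inj: "f = f'" if "f \<in> arr B" "f' \<in> arr B" "src B f = src B f'" "tgt B f = tgt B f'"
    "F\<lceil>f\<rceil> = F\<lceil>f'\<rceil>" for f f'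
    using assms(2) that unfolding faithful_def inj_on_def
    by (metis B.src_obj B.tgt_obj hom_iff)
  have "\<exists>f. f \<in> hom B (Q\<langle>F\<langle>X\<rangle>\<rangle>) X \<and> F\<lceil>f\<rceil> = \<epsilon> (F\<langle>X\<rangle>)" if "X \<in> obj B" for X
  proof -
    have "\<epsilon> (F\<langle>X\<rangle>) \<in> hom A (F\<langle>Q\<langle>F\<langle>X\<rangle>\<rangle>\<rangle>) (F\<langle>X\<rangle>)"
      using that by (simp add: hom_iff)
    then show ?thesis
      using assms(1) that unfolding full_def by (metis F.on_obj Q.on_obj)
  qed
  then obtain \<nu> where "\<And>X. X \<in> obj B \<Longrightarrow> \<nu> X \<in> hom B (Q\<langle>F\<langle>X\<rangle>\<rangle>) X \<and> F\<lceil>\<nu> X\<rceil> = \<epsilon> (F\<langle>X\<rangle>)"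
    by metis
  then have [simp]: "\<nu> X \<in> arr B" "src B (\<nu> X) = Q\<langle>F\<langle>X\<rangle>\<rangle>" "tgt B (\<nu> X) = X" "F\<lceil>\<nu> X\<rceil> = \<epsilon> (F\<langle>X\<rangle>)"
    if "X \<in> obj B" for X
    using that by (auto simp: hom_iff)
  show thesis
  proof
    \<comment> \<open>Faithfulness allows both claims to be checked after \<open>F\<close>, where
      they are naturality of \<epsilon> and a triangle identity.\<close>
    show "nat_trans B B (comp_funct Q F) id_funct \<nu>"
      by (rule nat_transI, simp add: hom_iff, rule F_inj) (simp_all add: counit_natural)
    show "\<nu> X \<cdot>\<^bsub>B\<^esub> \<eta> X = ide B X" if "X \<in> obj B" for X
      using that by (intro F_inj) (simp_all add: triangle_F)
  qed
qed

end

section \<open>The comparison functor of a coaction on a left adjoint\<close>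

text \<open>A coaction of \<open>G\<close> on \<open>F\<close> amounts to a factorization
  \<open>K\<close> of \<open>F\<close> through the coalgebras of \<open>G\<close>. The setting is a
  bare adjunction: here \<open>A\<close> is a category and not a bimonoid.\<close>

locale coaction = adjunction B A F Q \<eta> \<epsilon> + G: comonad_on A G
  for B :: "('o, 'a, 'y) cat_scheme" and A :: "('p, 'b, 'z) cat_scheme" and F Q \<eta> \<epsilon> G +
  fixes \<kappa> :: "'o \<Rightarrow> 'b"
  assumes coaction_nat: "nat_trans B A F (comp_funct (wfun G) F) \<kappa>"
    and coaction_object: "X \<in> obj B \<Longrightarrow> (F\<langle>X\<rangle>, \<kappa> X) \<in> coem_objects A G"
begin

lemmas coaction_simps [simp] = nat_trans_arr[OF coaction_nat, simplified]
  nat_trans_src[OF coaction_nat, simplified] nat_trans_tgt[OF coaction_nat, simplified]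
lemmas coaction_natural = nat_trans_natural[OF coaction_nat, simplified]

lemma
  assumes "X \<in> obj B"
  shows coaction_coassoc: "(wfun G)\<lceil>\<kappa> X\<rceil> \<cdot>\<^bsub>A\<^esub> \<kappa> X = wcomult G (F\<langle>X\<rangle>) \<cdot>\<^bsub>A\<^esub> \<kappa> X"
    and coaction_counit: "wcounit G (F\<langle>X\<rangle>) \<cdot>\<^bsub>A\<^esub> \<kappa> X = ide A (F\<langle>X\<rangle>)"
  using coaction_object[OF assms] by (simp_all add: coem_objects_iff)

definition K where
  "K = \<lparr>on_obj = (\<lambda>X. (F\<langle>X\<rangle>, \<kappa> X)),
    on_arr = (\<lambda>f. ((F\<langle>src B f\<rangle>, \<kappa> (src B f)), F\<lceil>f\<rceil>, (F\<langle>tgt B f\<rangle>, \<kappa> (tgt B f))))\<rparr>"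

text \<open>This is the comonad morphism from \<open>F Q\<close> to \<open>G\<close> that
  corresponds to \<kappa> under the adjunction; in the duoidal setting it becomes
  \<open>t_K\<close>.\<close>

definition can where
  "can M = (wfun G)\<lceil>\<epsilon> M\<rceil> \<cdot>\<^bsub>A\<^esub> \<kappa> (Q\<langle>M\<rangle>)"

lemma can_simps [simp]:
  assumes "M \<in> obj A"
  shows "can M \<in> arr A" "src A (can M) = F\<langle>Q\<langle>M\<rangle>\<rangle>" "tgt A (can M) = (wfun G)\<langle>M\<rangle>"
  using assms by (simp_all add: can_def)

lemma can_nat: "nat_trans A A (comp_funct F Q) (wfun G) can"
proof (rule nat_transI)
  fix f assume [simp]: "f \<in> arr A"
  have "can (tgt A f) \<cdot>\<^bsub>A\<^esub> F\<lceil>Q\<lceil>f\<rceil>\<rceil> = (wfun G)\<lceil>\<epsilon> (tgt A f) \<cdot>\<^bsub>A\<^esub> F\<lceil>Q\<lceil>f\<rceil>\<rceil>\<rceil> \<cdot>\<^bsub>A\<^esub> \<kappa> (Q\<langle>src A f\<rangle>)"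
    by (simp add: can_def coaction_natural)
  also have "\<dots> = (wfun G)\<lceil>f\<rceil> \<cdot>\<^bsub>A\<^esub> can (src A f)"
    by (simp add: can_def counit_natural del: G.W.fun_cmp) simp
  finally show "can (tgt A f) \<cdot>\<^bsub>A\<^esub> (comp_funct F Q)\<lceil>f\<rceil> = (wfun G)\<lceil>f\<rceil> \<cdot>\<^bsub>A\<^esub> can (src A f)"
    by simp
qed (simp add: hom_iff)

lemmas can_natural = nat_trans_natural[OF can_nat, simplified]

text \<open>Naturality moves the counit of \<open>G\<close> past \<open>G \<epsilon>\<close> and
  onto \<kappa>, where the counit law cancels it.\<close>

lemma counit_can: "M \<in> obj A \<Longrightarrow> wcounit G M \<cdot>\<^bsub>A\<^esub> can M = \<epsilon> M"
  by (simp add: can_def A.cmp_tail[OF G.counit_natural] coaction_counit)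

text \<open>That is, \<open>can M\<close> is a morphism of coalgebras from \<open>K (Q M)\<close> to the cofree coalgebra on \<open>M\<close>.\<close>

lemma comult_can:
  assumes [simp]: "M \<in> obj A"
  shows "wcomult G M \<cdot>\<^bsub>A\<^esub> can M = (wfun G)\<lceil>can M\<rceil> \<cdot>\<^bsub>A\<^esub> \<kappa> (Q\<langle>M\<rangle>)"
  by (simp add: can_def A.cmp_tail[OF G.comult_natural] coaction_coassoc)

text \<open>The triangle identity recovers \<kappa> from \<open>can\<close>. Once \<open>can\<close>
  is invertible, a condition on \<kappa> can thereby be read as one on \<open>F \<eta>\<close>, the
  coaction of the comonad \<open>F Q\<close> on \<open>F X\<close>.\<close>

lemma can_F_unit:
  assumes [simp]: "X \<in> obj B"
  shows "can (F\<langle>X\<rangle>) \<cdot>\<^bsub>A\<^esub> F\<lceil>\<eta> X\<rceil> = \<kappa> X"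
proof -
  have "can (F\<langle>X\<rangle>) \<cdot>\<^bsub>A\<^esub> F\<lceil>\<eta> X\<rceil> = (wfun G)\<lceil>\<epsilon> (F\<langle>X\<rangle>) \<cdot>\<^bsub>A\<^esub> F\<lceil>\<eta> X\<rceil>\<rceil> \<cdot>\<^bsub>A\<^esub> \<kappa> X"
    by (simp add: can_def coaction_natural)
  then show ?thesis
    by (simp add: triangle_F del: G.W.fun_cmp)
qed

sublocale Hopf: category "coem_cat A G"
  by (rule G.category_coem_cat)

lemma is_functor_K: "is_functor B (coem_cat A G) K"
  by unfold_locales (auto simp: K_def coaction_object arr_coem_cat hom_iff coaction_natural)

text \<open>An arrow into a cofree coalgebra is determined by its composite with the counit: by
  \<open>fun_counit_comult\<close> it is \<open>G\<close> of that composite, taken after the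
  coaction of the source.\<close>

lemma coalgebra_arr_cofree_eqI:
  assumes "P \<in> coem_objects A G" "M \<in> obj A"
    and "(P, f, cofree_coalg G M) \<in> arr (coem_cat A G)" "(P, g, cofree_coalg G M) \<in> arr (coem_cat A G)"
    and "wcounit G M \<cdot>\<^bsub>A\<^esub> f = wcounit G M \<cdot>\<^bsub>A\<^esub> g"
  shows "f = g"
proof -
  note P [simp] = coem_objectsD[OF assms(1)] and [simp] = assms(2)
  have "h = (wfun G)\<lceil>wcounit G M \<cdot>\<^bsub>A\<^esub> h\<rceil> \<cdot>\<^bsub>A\<^esub> snd P"
    if "(P, h, cofree_coalg G M) \<in> arr (coem_cat A G)" for h
  proof -
    have [simp]: "h \<in> arr A" "src A h = fst P" "tgt A h = (wfun G)\<langle>M\<rangle>"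
      and h: "wcomult G M \<cdot>\<^bsub>A\<^esub> h = (wfun G)\<lceil>h\<rceil> \<cdot>\<^bsub>A\<^esub> snd P"
      using that by (auto simp: arr_coem_cat hom_iff cofree_coalg_def)
    have "(wfun G)\<lceil>wcounit G M \<cdot>\<^bsub>A\<^esub> h\<rceil> \<cdot>\<^bsub>A\<^esub> snd P = (wfun G)\<lceil>wcounit G M\<rceil> \<cdot>\<^bsub>A\<^esub> wcomult G M \<cdot>\<^bsub>A\<^esub> h"
      by (simp add: h)
    also have "\<dots> = h"
      by (simp add: A.cmp_tail[OF G.fun_counit_comult])
    finally show ?thesis by simp
  qed
  then show ?thesis
    using assms(3-5) by metis
qed

lemma can_coalgebra_arr:
  "M \<in> obj A \<Longrightarrow> (K\<langle>Q\<langle>M\<rangle>\<rangle>, can M, cofree_coalg G M) \<in> arr (coem_cat A G)"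
  by (simp add: arr_coem_cat K_def coaction_object G.cofree_object hom_iff)
    (simp add: cofree_coalg_def comult_can)

text \<open>Essential surjectivity provides an isomorphism \<open>i\<close> from some
  \<open>K X\<close> to the cofree coalgebra on \<open>M\<close>. It factors through
  \<open>can M\<close>, which gives a section \<open>h\<close>. Fullness of \<open>K\<close> makes
  \<open>h\<close> two-sided, because \<open>h \<cdot> can M\<close> then comes from an endomorphism
  of \<open>Q M\<close>, and such an endomorphism is detected by the counit.\<close>

lemma can_iso_if_equivalence:
  assumes equiv: "equivalence_of_categories B (coem_cat A G) K" and M [simp]: "M \<in> obj A"
  shows "is_iso A (can M)"
proof -
  have K_obj: "K\<langle>X\<rangle> = (F\<langle>X\<rangle>, \<kappa> X)" for X
    by (simp add: K_def)
  let ?R = "cofree_coalg G M"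
  have R: "?R \<in> obj (coem_cat A G)" "fst ?R = (wfun G)\<langle>M\<rangle>" "snd ?R = wcomult G M"
    using G.cofree_object by (simp_all add: cofree_coalg_def)
  obtain X i where [simp]: "X \<in> obj B" and i: "is_iso (coem_cat A G) (K\<langle>X\<rangle>, i, ?R)"
    using equivalenceD(2)[OF equiv] R(1) unfolding ess_surj_def
    by (metis coem_cat_simps(2,3) prod.collapse)
  have i_arr: "(K\<langle>X\<rangle>, i, ?R) \<in> arr (coem_cat A G)"
    using i by (rule Hopf.arr_iso)
  obtain j where j: "inv_arr (coem_cat A G) (K\<langle>X\<rangle>, i, ?R) = (?R, j, K\<langle>X\<rangle>)"
    using Hopf.src_inv[OF i] Hopf.tgt_inv[OF i] by (metis coem_cat_simps(2,3) fst_conv prod.collapse snd_conv)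
  have j_arr: "(?R, j, K\<langle>X\<rangle>) \<in> arr (coem_cat A G)"
    using Hopf.arr_inv[OF i] j by simp
  have ij: "i \<cdot>\<^bsub>A\<^esub> j = ide A ((wfun G)\<langle>M\<rangle>)"
    using Hopf.cmp_inv[OF i] R by (simp add: j)
  have [simp]: "i \<in> arr A" "src A i = F\<langle>X\<rangle>" "tgt A i = (wfun G)\<langle>M\<rangle>"
    "j \<in> arr A" "src A j = (wfun G)\<langle>M\<rangle>" "tgt A j = F\<langle>X\<rangle>"
    using i_arr j_arr by (auto simp: arr_coem_cat hom_iff K_obj R)
  \<comment> \<open>The adjoint transpose of \<open>wcounit G M \<cdot> i\<close>. Since arrows into
    a cofree coalgebra are determined by the counit, \<open>F f\<close> is the factor of
    \<open>i\<close> through \<open>can M\<close>.\<close>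
  define f where "f = Q\<lceil>wcounit G M \<cdot>\<^bsub>A\<^esub> i\<rceil> \<cdot>\<^bsub>B\<^esub> \<eta> X"
  have [simp]: "f \<in> arr B" "src B f = X" "tgt B f = Q\<langle>M\<rangle>"
    by (simp_all add: f_def)
  have "\<epsilon> M \<cdot>\<^bsub>A\<^esub> F\<lceil>f\<rceil> = wcounit G M \<cdot>\<^bsub>A\<^esub> i"
  proof -
    have "\<epsilon> M \<cdot>\<^bsub>A\<^esub> F\<lceil>f\<rceil> = (\<epsilon> M \<cdot>\<^bsub>A\<^esub> F\<lceil>Q\<lceil>wcounit G M \<cdot>\<^bsub>A\<^esub> i\<rceil>\<rceil>) \<cdot>\<^bsub>A\<^esub> F\<lceil>\<eta> X\<rceil>"
      by (simp add: f_def)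
    also have "\<dots> = wcounit G M \<cdot>\<^bsub>A\<^esub> i \<cdot>\<^bsub>A\<^esub> \<epsilon> (F\<langle>X\<rangle>) \<cdot>\<^bsub>A\<^esub> F\<lceil>\<eta> X\<rceil>"
      by (subst counit_natural) simp_all
    finally show ?thesis by (simp add: triangle_F)
  qed
  interpret K: is_functor B "coem_cat A G" K by (rule is_functor_K)
  have Kf: "K\<lceil>f\<rceil> = (K\<langle>X\<rangle>, F\<lceil>f\<rceil>, K\<langle>Q\<langle>M\<rangle>\<rangle>)"
    by (simp add: K_def)
  have i_eq: "can M \<cdot>\<^bsub>A\<^esub> F\<lceil>f\<rceil> = i"
  proof (rule coalgebra_arr_cofree_eqI[of "K\<langle>X\<rangle>" M])
    show "(K\<langle>X\<rangle>, can M \<cdot>\<^bsub>A\<^esub> F\<lceil>f\<rceil>, ?R) \<in> arr (coem_cat A G)"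
      using Hopf.arr_cmp[of "K\<lceil>f\<rceil>", OF _ can_coalgebra_arr[OF M]] K.fun_arr[of f] by (simp add: Kf)
    show "wcounit G M \<cdot>\<^bsub>A\<^esub> can M \<cdot>\<^bsub>A\<^esub> F\<lceil>f\<rceil> = wcounit G M \<cdot>\<^bsub>A\<^esub> i"
      by (simp add: A.cmp_tail[OF counit_can] \<open>\<epsilon> M \<cdot>\<^bsub>A\<^esub> F\<lceil>f\<rceil> = wcounit G M \<cdot>\<^bsub>A\<^esub> i\<close>)
  qed (use i_arr in \<open>simp_all add: K_obj coaction_object\<close>)
  define h where "h = F\<lceil>f\<rceil> \<cdot>\<^bsub>A\<^esub> j"
  have [simp]: "h \<in> arr A" "src A h = (wfun G)\<langle>M\<rangle>" "tgt A h = F\<langle>Q\<langle>M\<rangle>\<rangle>"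
    by (simp_all add: h_def)
  have can_h: "can M \<cdot>\<^bsub>A\<^esub> h = ide A ((wfun G)\<langle>M\<rangle>)"
    by (simp add: h_def A.cmp_tail[OF i_eq] ij)
  have h_arr: "(?R, h, K\<langle>Q\<langle>M\<rangle>\<rangle>) \<in> arr (coem_cat A G)"
    using Hopf.arr_cmp[OF j_arr, of "K\<lceil>f\<rceil>"] K.fun_arr[of f] by (simp add: Kf h_def)
  have "(K\<langle>Q\<langle>M\<rangle>\<rangle>, h \<cdot>\<^bsub>A\<^esub> can M, K\<langle>Q\<langle>M\<rangle>\<rangle>) \<in> arr (coem_cat A G)"
    using Hopf.arr_cmp[OF can_coalgebra_arr[OF M] h_arr] by simp
  then have "(K\<langle>Q\<langle>M\<rangle>\<rangle>, h \<cdot>\<^bsub>A\<^esub> can M, K\<langle>Q\<langle>M\<rangle>\<rangle>) \<in> hom (coem_cat A G) (K\<langle>Q\<langle>M\<rangle>\<rangle>) (K\<langle>Q\<langle>M\<rangle>\<rangle>)"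
    by (simp add: hom_iff)
  then obtain g where "g \<in> hom B (Q\<langle>M\<rangle>) (Q\<langle>M\<rangle>)" and "K\<lceil>g\<rceil> = (K\<langle>Q\<langle>M\<rangle>\<rangle>, h \<cdot>\<^bsub>A\<^esub> can M, K\<langle>Q\<langle>M\<rangle>\<rangle>)"
    using equivalenceD(1)[OF equiv] M unfolding full_def by (metis Q.on_obj)
  then have [simp]: "g \<in> arr B" "src B g = Q\<langle>M\<rangle>" "tgt B g = Q\<langle>M\<rangle>" and Fg: "F\<lceil>g\<rceil> = h \<cdot>\<^bsub>A\<^esub> can M"
    by (auto simp: hom_iff K_def)
  \<comment> \<open>The counit factors through \<open>can M\<close>, and \<open>can M\<close> is
    unchanged by \<open>h \<cdot> can M\<close>. As \<open>g\<close> is the transpose of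
    \<open>\<epsilon> M \<cdot> F g\<close>, it must be the identity.\<close>
  have "\<epsilon> M \<cdot>\<^bsub>A\<^esub> F\<lceil>g\<rceil> = \<epsilon> M"
  proof -
    have "\<epsilon> M \<cdot>\<^bsub>A\<^esub> F\<lceil>g\<rceil> = wcounit G M \<cdot>\<^bsub>A\<^esub> can M \<cdot>\<^bsub>A\<^esub> h \<cdot>\<^bsub>A\<^esub> can M"
      by (simp add: Fg A.cmp_tail[OF counit_can])
    also have "\<dots> = \<epsilon> M"
      by (simp add: A.cmp_tail[OF can_h] counit_can)
    finally show ?thesis .
  qed
  moreover have "Q\<lceil>\<epsilon> M \<cdot>\<^bsub>A\<^esub> F\<lceil>g\<rceil>\<rceil> \<cdot>\<^bsub>B\<^esub> \<eta> (Q\<langle>M\<rangle>) = g"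
  proof -
    have "Q\<lceil>\<epsilon> M \<cdot>\<^bsub>A\<^esub> F\<lceil>g\<rceil>\<rceil> \<cdot>\<^bsub>B\<^esub> \<eta> (Q\<langle>M\<rangle>) = Q\<lceil>\<epsilon> M\<rceil> \<cdot>\<^bsub>B\<^esub> \<eta> (Q\<langle>M\<rangle>) \<cdot>\<^bsub>B\<^esub> g"
      by (simp add: unit_natural)
    also have "\<dots> = g"
      by (simp add: B.cmp_tail[OF triangle_Q])
    finally show ?thesis .
  qed
  ultimately have "g = ide B (Q\<langle>M\<rangle>)"
    using triangle_Q[OF M] by simp
  then have "h \<cdot>\<^bsub>A\<^esub> can M = ide A (F\<langle>Q\<langle>M\<rangle>\<rangle>)"
    using Fg by simp
  then have "is_inverse A (can M) h"
    by (simp add: is_inverse_def hom_iff can_h)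
  then show ?thesis
    by (auto simp: is_iso_def)
qed

text \<open>For a coalgebra \<open>\<theta>\<close> on \<open>M\<close> put \<open>\<tau> = can\<^sup>-\<^sup>1 \<cdot> \<theta>\<close>.  The section \<open>s\<close> in a splitting of the idempotent
  \<open>\<nu> \<cdot> Q \<tau>\<close> is an equalizer of \<open>Q \<tau>\<close> and \<open>\<eta>\<close>; being split, it is preserved by \<open>F\<close>, so its
  domain is sent by \<open>K\<close> to the given coalgebra.\<close>

lemma equivalence_if_can_iso:
  assumes cc: "cauchy_complete B"
    and nu: "nat_trans B B (comp_funct Q F) id_funct \<nu>"
    and nu_unit: "\<And>X. X \<in> obj B \<Longrightarrow> \<nu> X \<cdot>\<^bsub>B\<^esub> \<eta> X = ide B X"
    and iso: "\<And>M. M \<in> obj A \<Longrightarrow> is_iso A (can M)"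
  shows "equivalence_of_categories B (coem_cat A G) K"
proof (rule equivalenceI)
  note nu_simps [simp] = nat_trans_arr[OF nu, simplified] nat_trans_src[OF nu, simplified]
    nat_trans_tgt[OF nu, simplified]
  note nu_natural = nat_trans_natural[OF nu, simplified]
  interpret K: is_functor B "coem_cat A G" K by (rule is_functor_K)
  show "is_functor B (coem_cat A G) K" by (rule is_functor_K)
  show "faithful B K"
    unfolding faithful_def
  proof (intro ballI inj_onI)
    fix X Y f f' assume "X \<in> obj B" "f \<in> hom B X Y" "f' \<in> hom B X Y" "K\<lceil>f\<rceil> = K\<lceil>f'\<rceil>"
    then have [simp]: "X \<in> obj B" "f \<in> arr B" "f' \<in> arr B" "src B f = X" "src B f' = X"
      "tgt B f' = Y" "tgt B f = Y" and "F\<lceil>f\<rceil> = F\<lceil>f'\<rceil>"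
      by (auto simp: hom_iff K_def)
    \<comment> \<open>By naturality \<nu> slides past \<open>Q F g\<close> and cancels against
      \<eta>, so \<open>g\<close> is a function of \<open>F g\<close>.\<close>
    have "g = \<nu> (tgt B g) \<cdot>\<^bsub>B\<^esub> Q\<lceil>F\<lceil>g\<rceil>\<rceil> \<cdot>\<^bsub>B\<^esub> \<eta> (src B g)" if [simp]: "g \<in> arr B" for g
      by (simp add: B.cmp_tail[OF nu_natural] nu_unit)
    from this[of f] this[of f'] show "f = f'"
      by (simp add: \<open>F\<lceil>f\<rceil> = F\<lceil>f'\<rceil>\<close>)
  qed
  show "full B (coem_cat A G) K"
    unfolding full_def
  proof (intro ballI)
    fix X Y h assume [simp]: "X \<in> obj B" "Y \<in> obj B" and h: "h \<in> hom (coem_cat A G) (K\<langle>X\<rangle>) (K\<langle>Y\<rangle>)"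
    then obtain g where h_eq: "h = (K\<langle>X\<rangle>, g, K\<langle>Y\<rangle>)"
      by (cases h) (auto simp: hom_iff)
    then have [simp]: "g \<in> arr A" "src A g = F\<langle>X\<rangle>" "tgt A g = F\<langle>Y\<rangle>"
      and g: "\<kappa> Y \<cdot>\<^bsub>A\<^esub> g = (wfun G)\<lceil>g\<rceil> \<cdot>\<^bsub>A\<^esub> \<kappa> X"
      using h by (auto simp: hom_iff K_def arr_coem_cat)
    \<comment> \<open>A \<open>G\<close>-coalgebra arrow is also one for \<open>F Q\<close>: after
      composition with \<open>can\<close> at \<open>F Y\<close>, naturality and
      \<open>can_F_unit\<close> turn the claim into the assumption on \<open>g\<close>.\<close>
    have eq: "F\<lceil>\<eta> Y\<rceil> \<cdot>\<^bsub>A\<^esub> g = F\<lceil>Q\<lceil>g\<rceil>\<rceil> \<cdot>\<^bsub>A\<^esub> F\<lceil>\<eta> X\<rceil>"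
      by (rule A.iso_cancel_left[OF iso[of "F\<langle>Y\<rangle>"]])
        (simp_all add: A.cmp_tail[OF can_F_unit] A.cmp_tail[OF can_natural] can_F_unit g)
    \<comment> \<open>The recovery formula used for faithfulness, now applied to an arrow not yet
      known to be an image.\<close>
    let ?f = "\<nu> Y \<cdot>\<^bsub>B\<^esub> Q\<lceil>g\<rceil> \<cdot>\<^bsub>B\<^esub> \<eta> X"
    have "F\<lceil>?f\<rceil> = F\<lceil>\<nu> Y \<cdot>\<^bsub>B\<^esub> \<eta> Y\<rceil> \<cdot>\<^bsub>A\<^esub> g"
      by (simp add: eq)
    then have "F\<lceil>?f\<rceil> = g"
      by (simp add: nu_unit del: F.fun_cmp)
    then show "\<exists>f \<in> hom B X Y. K\<lceil>f\<rceil> = h"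
      by (intro bexI[of _ ?f]) (simp_all add: hom_iff K_def h_eq)
  qed
  show "ess_surj B (coem_cat A G) K"
    unfolding ess_surj_def
  proof
    fix P assume P: "P \<in> obj (coem_cat A G)"
    define M \<theta> where "M = fst P" and "\<theta> = snd P"
    note PD = coem_objectsD[OF P[simplified], folded M_def \<theta>_def]
    note [simp] = PD(1-4)
    define \<tau> where "\<tau> = inv_arr A (can M) \<cdot>\<^bsub>A\<^esub> \<theta>"
    note [simp] = A.inv_simps[OF iso]
    have [simp]: "\<tau> \<in> arr A" "src A \<tau> = M" "tgt A \<tau> = F\<langle>Q\<langle>M\<rangle>\<rangle>"
      by (simp_all add: \<tau>_def)
    have can_tau: "can M \<cdot>\<^bsub>A\<^esub> \<tau> = \<theta>"
      by (simp add: \<tau>_def A.cmp_tail[OF A.cmp_inv[OF iso]])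
    have counit_tau: "\<epsilon> M \<cdot>\<^bsub>A\<^esub> \<tau> = ide A M"
    proof -
      have "\<epsilon> M \<cdot>\<^bsub>A\<^esub> \<tau> = wcounit G M \<cdot>\<^bsub>A\<^esub> can M \<cdot>\<^bsub>A\<^esub> \<tau>"
        by (simp add: A.cmp_tail[OF counit_can])
      then show ?thesis by (simp add: can_tau PD)
    qed
    \<comment> \<open>Composed with \<open>can\<close> at \<open>F Q M\<close>, the two sides become
      \<open>G \<tau> \<cdot> \<theta>\<close> and \<open>\<kappa> \<cdot> \<tau>\<close>. These
      agree after \<open>G (can M)\<close> by coassociativity of \<theta> and
      \<open>comult_can\<close>, so two isomorphisms are cancelled in turn.\<close>
    have coassoc_tau: "F\<lceil>Q\<lceil>\<tau>\<rceil>\<rceil> \<cdot>\<^bsub>A\<^esub> \<tau> = F\<lceil>\<eta> (Q\<langle>M\<rangle>)\<rceil> \<cdot>\<^bsub>A\<^esub> \<tau>"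
    proof (rule A.iso_cancel_left[OF iso[of "F\<langle>Q\<langle>M\<rangle>\<rangle>"]])
      have G_can: "is_iso A ((wfun G)\<lceil>can M\<rceil>)"
      proof -
        have "(wfun G)\<lceil>can M\<rceil> \<cdot>\<^bsub>A\<^esub> (wfun G)\<lceil>inv_arr A (can M)\<rceil> = ide A ((wfun G)\<langle>(wfun G)\<langle>M\<rangle>\<rangle>)"
          "(wfun G)\<lceil>inv_arr A (can M)\<rceil> \<cdot>\<^bsub>A\<^esub> (wfun G)\<lceil>can M\<rceil> = ide A ((wfun G)\<langle>F\<langle>Q\<langle>M\<rangle>\<rangle>\<rangle>)"
          by (simp_all flip: G.W.fun_cmp)
        then show ?thesis
          unfolding is_iso_def is_inverse_def
          by (intro exI[of _ "(wfun G)\<lceil>inv_arr A (can M)\<rceil>"]) (simp add: hom_iff)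
      qed
      have "(wfun G)\<lceil>can M\<rceil> \<cdot>\<^bsub>A\<^esub> (wfun G)\<lceil>\<tau>\<rceil> \<cdot>\<^bsub>A\<^esub> \<theta> = (wfun G)\<lceil>can M \<cdot>\<^bsub>A\<^esub> \<tau>\<rceil> \<cdot>\<^bsub>A\<^esub> \<theta>"
        by simp
      also have "\<dots> = wcomult G M \<cdot>\<^bsub>A\<^esub> can M \<cdot>\<^bsub>A\<^esub> \<tau>"
        by (simp only: can_tau PD)
      also have "\<dots> = (wfun G)\<lceil>can M\<rceil> \<cdot>\<^bsub>A\<^esub> \<kappa> (Q\<langle>M\<rangle>) \<cdot>\<^bsub>A\<^esub> \<tau>"
        by (simp add: A.cmp_tail[OF comult_can])
      finally have "(wfun G)\<lceil>\<tau>\<rceil> \<cdot>\<^bsub>A\<^esub> \<theta> = \<kappa> (Q\<langle>M\<rangle>) \<cdot>\<^bsub>A\<^esub> \<tau>"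
        by (rule A.iso_cancel_left[OF G_can, rotated -1]) simp_all
      then show "can (F\<langle>Q\<langle>M\<rangle>\<rangle>) \<cdot>\<^bsub>A\<^esub> F\<lceil>Q\<lceil>\<tau>\<rceil>\<rceil> \<cdot>\<^bsub>A\<^esub> \<tau>
          = can (F\<langle>Q\<langle>M\<rangle>\<rangle>) \<cdot>\<^bsub>A\<^esub> F\<lceil>\<eta> (Q\<langle>M\<rangle>)\<rceil> \<cdot>\<^bsub>A\<^esub> \<tau>"
        by (simp add: A.cmp_tail[OF can_natural] A.cmp_tail[OF can_F_unit] can_tau)
    qed simp_all
    define p where "p = \<nu> (Q\<langle>M\<rangle>) \<cdot>\<^bsub>B\<^esub> Q\<lceil>\<tau>\<rceil>"
    have [simp]: "p \<in> arr B" "src B p = Q\<langle>M\<rangle>" "tgt B p = Q\<langle>M\<rangle>"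
      by (simp_all add: p_def)
    \<comment> \<open>Naturality pulls \<open>Q \<tau>\<close> under \<nu>, coassociativity replaces
      \<open>F Q \<tau>\<close> by \<open>F \<eta>\<close>, and naturality takes \<eta> out
      again.\<close>
    have Q_tau_p: "Q\<lceil>\<tau>\<rceil> \<cdot>\<^bsub>B\<^esub> p = \<eta> (Q\<langle>M\<rangle>) \<cdot>\<^bsub>B\<^esub> p"
    proof -
      have "Q\<lceil>\<tau>\<rceil> \<cdot>\<^bsub>B\<^esub> p = \<nu> (Q\<langle>F\<langle>Q\<langle>M\<rangle>\<rangle>\<rangle>) \<cdot>\<^bsub>B\<^esub> Q\<lceil>F\<lceil>Q\<lceil>\<tau>\<rceil>\<rceil> \<cdot>\<^bsub>A\<^esub> \<tau>\<rceil>"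
        by (simp add: p_def B.cmp_tail[OF nu_natural])
      also have "\<dots> = \<eta> (Q\<langle>M\<rangle>) \<cdot>\<^bsub>B\<^esub> p"
        by (simp add: p_def coassoc_tau B.cmp_tail[OF nu_natural] del: Q.fun_cmp) (simp add: B.cmp_tail[OF nu_natural])
      finally show ?thesis .
    qed
    have "p \<cdot>\<^bsub>B\<^esub> p = \<nu> (Q\<langle>M\<rangle>) \<cdot>\<^bsub>B\<^esub> \<eta> (Q\<langle>M\<rangle>) \<cdot>\<^bsub>B\<^esub> p"
      by (subst (1) p_def) (simp add: Q_tau_p)
    also have "\<dots> = p"
      by (simp add: B.cmp_tail[OF nu_unit])
    finally have "p \<cdot>\<^bsub>B\<^esub> p = p" .
    moreover have "p \<in> hom B (Q\<langle>M\<rangle>) (Q\<langle>M\<rangle>)" "Q\<langle>M\<rangle> \<in> obj B" by (simp_all add: hom_iff)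
    ultimately obtain X r s where "X \<in> obj B" "r \<in> hom B (Q\<langle>M\<rangle>) X" "s \<in> hom B X (Q\<langle>M\<rangle>)"
      "r \<cdot>\<^bsub>B\<^esub> s = ide B X" "s \<cdot>\<^bsub>B\<^esub> r = p"
      using cc unfolding cauchy_complete_def by blast
    then have [simp]: "X \<in> obj B" "r \<in> arr B" "s \<in> arr B" "src B r = Q\<langle>M\<rangle>" "tgt B r = X"
      "src B s = X" "tgt B s = Q\<langle>M\<rangle>" and rs: "r \<cdot>\<^bsub>B\<^esub> s = ide B X" and sr: "s \<cdot>\<^bsub>B\<^esub> r = p"
      by (auto simp: hom_iff)
    have Q_tau_s: "Q\<lceil>\<tau>\<rceil> \<cdot>\<^bsub>B\<^esub> s = \<eta> (Q\<langle>M\<rangle>) \<cdot>\<^bsub>B\<^esub> s"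
    proof -
      have ps: "p \<cdot>\<^bsub>B\<^esub> s = s"
        by (simp add: sr[symmetric] rs)
      have "Q\<lceil>\<tau>\<rceil> \<cdot>\<^bsub>B\<^esub> p \<cdot>\<^bsub>B\<^esub> s = \<eta> (Q\<langle>M\<rangle>) \<cdot>\<^bsub>B\<^esub> p \<cdot>\<^bsub>B\<^esub> s"
        by (simp add: B.cmp_tail[OF Q_tau_p])
      then show ?thesis by (simp only: ps)
    qed
    \<comment> \<open>The transpose of \<open>s\<close>. Composing with \<tau> returns
      \<open>F s\<close>, which suggests \<open>F r \<cdot> \<tau>\<close> as the inverse.\<close>
    define i where "i = \<epsilon> M \<cdot>\<^bsub>A\<^esub> F\<lceil>s\<rceil>"
    have [simp]: "i \<in> arr A" "src A i = F\<langle>X\<rangle>" "tgt A i = M"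
      by (simp_all add: i_def)
    have tau_i: "\<tau> \<cdot>\<^bsub>A\<^esub> i = F\<lceil>s\<rceil>"
    proof -
      have "\<tau> \<cdot>\<^bsub>A\<^esub> i = (\<tau> \<cdot>\<^bsub>A\<^esub> \<epsilon> M) \<cdot>\<^bsub>A\<^esub> F\<lceil>s\<rceil>"
        by (simp add: i_def)
      also have "\<tau> \<cdot>\<^bsub>A\<^esub> \<epsilon> M = \<epsilon> (F\<langle>Q\<langle>M\<rangle>\<rangle>) \<cdot>\<^bsub>A\<^esub> F\<lceil>Q\<lceil>\<tau>\<rceil>\<rceil>"
        using counit_natural[of \<tau>] by simp
      also have "(\<epsilon> (F\<langle>Q\<langle>M\<rangle>\<rangle>) \<cdot>\<^bsub>A\<^esub> F\<lceil>Q\<lceil>\<tau>\<rceil>\<rceil>) \<cdot>\<^bsub>A\<^esub> F\<lceil>s\<rceil>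
          = \<epsilon> (F\<langle>Q\<langle>M\<rangle>\<rangle>) \<cdot>\<^bsub>A\<^esub> F\<lceil>Q\<lceil>\<tau>\<rceil> \<cdot>\<^bsub>B\<^esub> s\<rceil>"
        by simp
      also have "\<dots> = F\<lceil>s\<rceil>"
        unfolding Q_tau_s by (simp add: A.cmp_tail[OF triangle_F])
      finally show ?thesis .
    qed
    have "is_inverse A i (F\<lceil>r\<rceil> \<cdot>\<^bsub>A\<^esub> \<tau>)"
    proof -
      have "(F\<lceil>r\<rceil> \<cdot>\<^bsub>A\<^esub> \<tau>) \<cdot>\<^bsub>A\<^esub> i = F\<lceil>r \<cdot>\<^bsub>B\<^esub> s\<rceil>"
        by (simp add: tau_i)
      moreover have "i \<cdot>\<^bsub>A\<^esub> F\<lceil>r\<rceil> \<cdot>\<^bsub>A\<^esub> \<tau> = \<epsilon> M \<cdot>\<^bsub>A\<^esub> F\<lceil>s \<cdot>\<^bsub>B\<^esub> r\<rceil> \<cdot>\<^bsub>A\<^esub> \<tau>"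
        by (simp add: i_def)
      \<comment> \<open>On \<tau> the idempotent \<open>F p\<close> acts as the identity, by
        coassociativity and \<open>\<nu> \<cdot> \<eta> = 1\<close>.\<close>
      moreover have "F\<lceil>p\<rceil> \<cdot>\<^bsub>A\<^esub> \<tau> = F\<lceil>\<nu> (Q\<langle>M\<rangle>) \<cdot>\<^bsub>B\<^esub> \<eta> (Q\<langle>M\<rangle>)\<rceil> \<cdot>\<^bsub>A\<^esub> \<tau>"
        by (simp add: p_def coassoc_tau)
      ultimately show ?thesis
        by (simp add: is_inverse_def hom_iff rs sr nu_unit counit_tau del: F.fun_cmp)
    qed
    then have i_iso: "is_iso A i"
      by (auto simp: is_iso_def)
    have "\<theta> \<cdot>\<^bsub>A\<^esub> i = (wfun G)\<lceil>i\<rceil> \<cdot>\<^bsub>A\<^esub> \<kappa> X"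
    proof -
      have "\<theta> \<cdot>\<^bsub>A\<^esub> i = (can M \<cdot>\<^bsub>A\<^esub> \<tau>) \<cdot>\<^bsub>A\<^esub> i"
        by (simp only: can_tau)
      also have "\<dots> = can M \<cdot>\<^bsub>A\<^esub> F\<lceil>s\<rceil>"
        by (simp add: tau_i)
      also have "\<dots> = (wfun G)\<lceil>i\<rceil> \<cdot>\<^bsub>A\<^esub> \<kappa> X"
        by (simp add: can_def i_def coaction_natural)
      finally show ?thesis .
    qed
    then have "(K\<langle>X\<rangle>, i, P) \<in> arr (coem_cat A G)"
      using P by (simp add: arr_coem_cat K_def coaction_object hom_iff flip: M_def \<theta>_def)
    then have "is_iso (coem_cat A G) (K\<langle>X\<rangle>, i, P)"
      using i_iso by (rule G.coem_iso)
    then show "\<exists>X \<in> obj B. \<exists>i. is_iso (coem_cat A G) i \<and> src (coem_cat A G) i = K\<langle>X\<rangle> \<and>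
        tgt (coem_cat A G) i = P"
      by (intro bexI[of _ X] exI[of _ "(K\<langle>X\<rangle>, i, P)"]) simp_all
  qed
qed

theorem equivalence_iff_can_iso:
  assumes "cauchy_complete B" "nat_trans B B (comp_funct Q F) id_funct \<nu>"
    and "\<And>X. X \<in> obj B \<Longrightarrow> \<nu> X \<cdot>\<^bsub>B\<^esub> \<eta> X = ide B X"
  shows "equivalence_of_categories B (coem_cat A G) K
    \<longleftrightarrow> nat_iso A A (comp_funct F Q) (wfun G) can"
  unfolding nat_iso_def
  using equivalence_if_can_iso[OF assms] can_iso_if_equivalence can_nat by blast

end

section \<open>Monads, mixed distributive laws and lifted comonads\<close>

locale monad_on = category C + T: is_functor C C "mfun T"
  for C :: "('o, 'a, 'z) cat_scheme" (structure) and T :: "('o, 'a) monad" +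
  assumes unit_nat: "nat_trans C C id_funct (mfun T) (munit T)"
    and mult_nat: "nat_trans C C (comp_funct (mfun T) (mfun T)) (mfun T) (mmult T)"
    and mult_assoc: "X \<in> obj C \<Longrightarrow>
      mmult T X \<cdot> (mfun T)\<lceil>mmult T X\<rceil> = mmult T X \<cdot> mmult T ((mfun T)\<langle>X\<rangle>)"
    and mult_unit: "X \<in> obj C \<Longrightarrow> mmult T X \<cdot> munit T ((mfun T)\<langle>X\<rangle>) = ide C ((mfun T)\<langle>X\<rangle>)"
    and mult_fun_unit: "X \<in> obj C \<Longrightarrow> mmult T X \<cdot> (mfun T)\<lceil>munit T X\<rceil> = ide C ((mfun T)\<langle>X\<rangle>)"

lemma em_cat_simps [simp]:
  "obj (em_cat C T) = em_objects C T"
  "src (em_cat C T) h = fst h"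
  "tgt (em_cat C T) h = snd (snd h)"
  "ide (em_cat C T) P = (P, ide C (fst P), P)"
  "cmp (em_cat C T) h h' = (fst h', fst (snd h) \<cdot>\<^bsub>C\<^esub> fst (snd h'), snd (snd h))"
  by (simp_all add: em_cat_def split_beta)

lemma arr_em_cat:
  "(P, f, R) \<in> arr (em_cat C T) \<longleftrightarrow> P \<in> em_objects C T \<and> R \<in> em_objects C T \<and>
    f \<in> hom C (fst P) (fst R) \<and> f \<cdot>\<^bsub>C\<^esub> snd P = snd R \<cdot>\<^bsub>C\<^esub> (mfun T)\<lceil>f\<rceil>"
  by (cases P; cases R) (auto simp: em_cat_def)

lemma em_objects_iff:
  "(X, h) \<in> em_objects C T \<longleftrightarrow> X \<in> obj C \<and> h \<in> hom C ((mfun T)\<langle>X\<rangle>) X \<and>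
    h \<cdot>\<^bsub>C\<^esub> (mfun T)\<lceil>h\<rceil> = h \<cdot>\<^bsub>C\<^esub> mmult T X \<and> h \<cdot>\<^bsub>C\<^esub> munit T X = ide C X"
  by (simp add: em_objects_def)

lemma em_objectsD:
  assumes "P \<in> em_objects C T"
  shows "fst P \<in> obj C" "snd P \<in> arr C" "src C (snd P) = (mfun T)\<langle>fst P\<rangle>" "tgt C (snd P) = fst P"
    "snd P \<cdot>\<^bsub>C\<^esub> (mfun T)\<lceil>snd P\<rceil> = snd P \<cdot>\<^bsub>C\<^esub> mmult T (fst P)"
    "snd P \<cdot>\<^bsub>C\<^esub> munit T (fst P) = ide C (fst P)"
  using assms by (cases P; simp add: em_objects_iff hom_iff)+

lemma forgetful_simps [simp]: "forgetful\<langle>P\<rangle> = fst P" "forgetful\<lceil>h\<rceil> = fst (snd h)"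
  by (simp_all add: forgetful_def split_beta)

lemma free_funct_simps [simp]:
  "(free_funct C T)\<langle>X\<rangle> = ((mfun T)\<langle>X\<rangle>, mmult T X)"
  "(free_funct C T)\<lceil>f\<rceil> = (((mfun T)\<langle>src C f\<rangle>, mmult T (src C f)), (mfun T)\<lceil>f\<rceil>,
    ((mfun T)\<langle>tgt C f\<rangle>, mmult T (tgt C f)))"
  by (simp_all add: free_funct_def free_alg_def)

lemma cofree_funct_simps [simp]:
  "(cofree_funct C G)\<langle>X\<rangle> = ((wfun G)\<langle>X\<rangle>, wcomult G X)"
  "(cofree_funct C G)\<lceil>f\<rceil> = (((wfun G)\<langle>src C f\<rangle>, wcomult G (src C f)), (wfun G)\<lceil>f\<rceil>,
    ((wfun G)\<langle>tgt C f\<rangle>, wcomult G (tgt C f)))"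
  by (simp_all add: cofree_funct_def cofree_coalg_def)

context monad_on
begin

lemmas unit_simps [simp] = nat_trans_arr[OF unit_nat, simplified]
  nat_trans_src[OF unit_nat, simplified] nat_trans_tgt[OF unit_nat, simplified]
lemmas mult_simps [simp] = nat_trans_arr[OF mult_nat, simplified]
  nat_trans_src[OF mult_nat, simplified] nat_trans_tgt[OF mult_nat, simplified]
lemmas unit_natural = nat_trans_natural[OF unit_nat, simplified]
lemmas mult_natural = nat_trans_natural[OF mult_nat, simplified]

lemma category_em_cat: "category (em_cat C T)"
proof
  fix h assume "h \<in> arr (em_cat C T)"
  then show "src (em_cat C T) h \<in> obj (em_cat C T)" "tgt (em_cat C T) h \<in> obj (em_cat C T)"
    by (cases h; simp add: arr_em_cat)+
next
  fix P assume "P \<in> obj (em_cat C T)"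
  then have P: "P \<in> em_objects C T" by simp
  show "ide (em_cat C T) P \<in> hom (em_cat C T) P P"
    by (simp add: hom_iff arr_em_cat P em_objectsD[OF P])
next
  fix f g P Q R assume "f \<in> hom (em_cat C T) P Q" "g \<in> hom (em_cat C T) Q R"
  then obtain f' g' where [simp]: "f = (P, f', Q)" "g = (Q, g', R)"
    and "(P, f', Q) \<in> arr (em_cat C T)" "(Q, g', R) \<in> arr (em_cat C T)"
    by (cases f; cases g) (auto simp: hom_iff)
  then have [simp]: "f' \<in> arr C" "g' \<in> arr C"
    "src C f' = fst P" "tgt C f' = fst Q" "src C g' = fst Q" "tgt C g' = fst R"
    and PQ [simp]: "Q \<in> em_objects C T" "P \<in> em_objects C T" "R \<in> em_objects C T"
    and f': "f' \<cdot> snd P = snd Q \<cdot> (mfun T)\<lceil>f'\<rceil>"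
    and g': "g' \<cdot> snd Q = snd R \<cdot> (mfun T)\<lceil>g'\<rceil>"
    by (auto simp: arr_em_cat hom_iff)
  note [simp] = em_objectsD(1-4)[OF PQ(1)] em_objectsD(1-4)[OF PQ(2)] em_objectsD(1-4)[OF PQ(3)]
  show "g \<cdot>\<^bsub>em_cat C T\<^esub> f \<in> hom (em_cat C T) P R"
    by (simp add: hom_iff arr_em_cat f' cmp_tail[OF g'])
next
  fix f P Q assume "f \<in> hom (em_cat C T) P Q"
  then show "f \<cdot>\<^bsub>em_cat C T\<^esub> ide (em_cat C T) P = f" "ide (em_cat C T) Q \<cdot>\<^bsub>em_cat C T\<^esub> f = f"
    by (cases f; auto simp: hom_iff arr_em_cat)+
next
  fix f g h P Q R S
  assume "f \<in> hom (em_cat C T) P Q" "g \<in> hom (em_cat C T) Q R" "h \<in> hom (em_cat C T) R S"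
  then show "(h \<cdot>\<^bsub>em_cat C T\<^esub> g) \<cdot>\<^bsub>em_cat C T\<^esub> f = h \<cdot>\<^bsub>em_cat C T\<^esub> g \<cdot>\<^bsub>em_cat C T\<^esub> f"
    by (cases f; cases g; cases h) (auto simp: hom_iff arr_em_cat)
qed

lemma is_functor_forgetful: "is_functor (em_cat C T) C forgetful"
proof -
  interpret E: category "em_cat C T" by (rule category_em_cat)
  show ?thesis
    by unfold_locales (auto simp: hom_iff arr_em_cat dest: em_objectsD)
qed

lemma free_object: "X \<in> obj C \<Longrightarrow> ((mfun T)\<langle>X\<rangle>, mmult T X) \<in> em_objects C T"
  by (simp add: em_objects_iff hom_iff mult_assoc mult_unit)

lemma is_functor_free: "is_functor C (em_cat C T) (free_funct C T)"
proof -
  interpret E: category "em_cat C T" by (rule category_em_cat)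
  show ?thesis
    by unfold_locales (auto simp: free_object hom_iff arr_em_cat mult_natural)
qed

end

lemma is_functor_comp:
  assumes "is_functor A B F" "is_functor B C G"
  shows "is_functor A C (comp_funct G F)"
proof -
  interpret F: is_functor A B F by fact
  interpret G: is_functor B C G by fact
  show ?thesis
    by unfold_locales (auto simp: hom_iff)
qed

lemma is_functor_id: "category A \<Longrightarrow> is_functor A A id_funct"
  by (simp add: is_functor_def is_functor_axioms_def)

section \<open>The composite of the forgetful-cofree and free-forgetful adjunctions\<close>

locale monad_comonad = T: monad_on C T + W: comonad_on C W
  for C :: "('o, 'a, 'z) cat_scheme" (structure) and T W
begin

abbreviation "F \<equiv> comp_funct (free_funct C T) forgetful"
abbreviation "Q \<equiv> comp_funct (cofree_funct C W) forgetful"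

text \<open>A coalgebra's own coaction is the unit of the forgetful-cofree adjunction; it is
  followed by the cofree functor applied to the monad unit.\<close>

definition unit where
  "unit P = (P, (wfun W)\<lceil>munit T (fst P)\<rceil> \<cdot> snd P, cofree_coalg W ((mfun T)\<langle>fst P\<rangle>))"

text \<open>Kept in the form of a composite counit so that it agrees literally with
  \<open>FQ_counit\<close>; \<open>counit_eq\<close> extracts the underlying arrow.\<close>

definition counit where
  "counit P = free_forgetful_counit T P \<cdot>\<^bsub>em_cat C T\<^esub>
    (free_funct C T)\<lceil>forgetful_cofree_counit W (forgetful\<langle>P\<rangle>)\<rceil>"

lemma counit_eq:
  assumes "P \<in> em_objects C T"
  shows "counit P = (F\<langle>Q\<langle>P\<rangle>\<rangle>, snd P \<cdot> (mfun T)\<lceil>wcounit W (fst P)\<rceil>, P)"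
  using em_objectsD[OF assms]
  by (cases P) (simp add: counit_def free_forgetful_counit_def forgetful_cofree_counit_def)

text \<open>Each triangle identity rests on one naturality square that exchanges the comonad counit
  with the monad unit. One of the two then cancels against the structure arrow, and the other by a
  unit law of the monad or a counit law of the comonad.\<close>

sublocale adjunction "coem_cat C W" "em_cat C T" F Q unit counit
proof -
  interpret B: category "coem_cat C W" by (rule W.category_coem_cat)
  interpret A: category "em_cat C T" by (rule T.category_em_cat)
  interpret F: is_functor "coem_cat C W" "em_cat C T" F
    by (rule is_functor_comp[OF W.is_functor_forgetful T.is_functor_free])
  interpret Q: is_functor "em_cat C T" "coem_cat C W" Q
    by (rule is_functor_comp[OF T.is_functor_forgetful W.is_functor_cofree])
  have cofree: "((wfun W)\<langle>X\<rangle>, wcomult W X) \<in> coem_objects C W" if "X \<in> obj C" for X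
    using W.cofree_object[OF that] by (simp add: cofree_coalg_def)
  show "adjunction (coem_cat C W) (em_cat C T) F Q unit counit"
  proof
    show "nat_trans (coem_cat C W) (coem_cat C W) id_funct (comp_funct Q F) unit"
    proof (rule nat_transI)
      fix P assume "P \<in> obj (coem_cat C W)"
      then have P: "P \<in> coem_objects C W" by simp
      show "unit P \<in> hom (coem_cat C W) (id_funct\<langle>P\<rangle>) ((comp_funct Q F)\<langle>P\<rangle>)"
        by (simp add: hom_iff unit_def arr_coem_cat P coem_objectsD[OF P] cofree cofree_coalg_def
          T.cmp_tail[OF W.comult_natural])
    next
      fix h assume h: "h \<in> arr (coem_cat C W)"
      obtain P f R where [simp]: "h = (P, f, R)" by (cases h)
      have P: "P \<in> coem_objects C W" and R: "R \<in> coem_objects C W"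
        and [simp]: "f \<in> arr C" "src C f = fst P" "tgt C f = fst R"
        and f: "snd R \<cdot> f = (wfun W)\<lceil>f\<rceil> \<cdot> snd P"
        using h by (auto simp: arr_coem_cat hom_iff)
      have "(wfun W)\<lceil>munit T (fst R) \<cdot> f\<rceil> \<cdot> snd P = (wfun W)\<lceil>(mfun T)\<lceil>f\<rceil> \<cdot> munit T (fst P)\<rceil> \<cdot> snd P"
        by (simp add: T.unit_natural del: W.W.fun_cmp)
      then show "unit (tgt (coem_cat C W) h) \<cdot>\<^bsub>coem_cat C W\<^esub> id_funct\<lceil>h\<rceil>
          = (comp_funct Q F)\<lceil>h\<rceil> \<cdot>\<^bsub>coem_cat C W\<^esub> unit (src (coem_cat C W) h)"
        by (simp add: unit_def cofree_coalg_def coem_objectsD[OF P] coem_objectsD[OF R] f)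
    qed
    show "nat_trans (em_cat C T) (em_cat C T) (comp_funct F Q) id_funct counit"
    proof (rule nat_transI)
      fix P assume "P \<in> obj (em_cat C T)"
      then have P: "P \<in> em_objects C T" by simp
      note [simp] = em_objectsD[OF P]
      show "counit P \<in> hom (em_cat C T) ((comp_funct F Q)\<langle>P\<rangle>) (id_funct\<langle>P\<rangle>)"
        by (simp add: hom_iff counit_eq arr_em_cat P T.free_object T.mult_natural
          T.cmp_tail[OF em_objectsD(5)[OF P]])
    next
      fix h assume h: "h \<in> arr (em_cat C T)"
      obtain P f R where [simp]: "h = (P, f, R)" by (cases h)
      have P: "P \<in> em_objects C T" and R: "R \<in> em_objects C T"
        and [simp]: "f \<in> arr C" "src C f = fst P" "tgt C f = fst R"
        and f: "f \<cdot> snd P = snd R \<cdot> (mfun T)\<lceil>f\<rceil>"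
        using h by (auto simp: arr_em_cat hom_iff)
      note [simp] = em_objectsD(1-4)[OF P] em_objectsD(1-4)[OF R]
      have "snd R \<cdot> (mfun T)\<lceil>wcounit W (fst R) \<cdot> (wfun W)\<lceil>f\<rceil>\<rceil>
          = snd R \<cdot> (mfun T)\<lceil>f \<cdot> wcounit W (fst P)\<rceil>"
        by (simp add: W.counit_natural del: T.T.fun_cmp)
      then show "counit (tgt (em_cat C T) h) \<cdot>\<^bsub>em_cat C T\<^esub> (comp_funct F Q)\<lceil>h\<rceil>
          = id_funct\<lceil>h\<rceil> \<cdot>\<^bsub>em_cat C T\<^esub> counit (src (em_cat C T) h)"
        by (simp add: counit_eq P R T.cmp_tail[OF f])
    qed
  next
    fix P assume "P \<in> obj (coem_cat C W)"
    then have P: "P \<in> coem_objects C W" by simp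
    note PD = coem_objectsD[OF P] and [simp] = coem_objectsD(1-4)[OF P]
    have "mmult T (fst P) \<cdot> (mfun T)\<lceil>wcounit W ((mfun T)\<langle>fst P\<rangle>) \<cdot> (wfun W)\<lceil>munit T (fst P)\<rceil> \<cdot> snd P\<rceil>
        = mmult T (fst P) \<cdot> (mfun T)\<lceil>munit T (fst P) \<cdot> wcounit W (fst P) \<cdot> snd P\<rceil>"
      by (simp add: T.cmp_tail[OF W.counit_natural] del: T.T.fun_cmp)
    also have "\<dots> = ide C ((mfun T)\<langle>fst P\<rangle>)"
      by (simp only: PD(6)) (simp add: T.mult_fun_unit)
    finally show "counit (F\<langle>P\<rangle>) \<cdot>\<^bsub>em_cat C T\<^esub> F\<lceil>unit P\<rceil> = ide (em_cat C T) (F\<langle>P\<rangle>)"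
      by (simp add: counit_eq T.free_object unit_def cofree_coalg_def)
  next
    fix P assume "P \<in> obj (em_cat C T)"
    then have P: "P \<in> em_objects C T" by simp
    note PD = em_objectsD[OF P] and [simp] = em_objectsD(1-4)[OF P]
    have "(wfun W)\<lceil>snd P \<cdot> (mfun T)\<lceil>wcounit W (fst P)\<rceil> \<cdot> munit T ((wfun W)\<langle>fst P\<rangle>)\<rceil> \<cdot> wcomult W (fst P)
        = (wfun W)\<lceil>(snd P \<cdot> munit T (fst P)) \<cdot> wcounit W (fst P)\<rceil> \<cdot> wcomult W (fst P)"
      using T.unit_natural[of "wcounit W (fst P)"] by simp
    also have "\<dots> = ide C ((wfun W)\<langle>fst P\<rangle>)"
      by (simp only: PD(6)) (simp add: W.fun_counit_comult)
    finally show "Q\<lceil>counit P\<rceil> \<cdot>\<^bsub>coem_cat C W\<^esub> unit (Q\<langle>P\<rangle>) = ide (coem_cat C W) (Q\<langle>P\<rangle>)"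
      by (simp add: counit_eq P unit_def cofree_coalg_def)
  qed
qed

end

text \<open>\<open>law_mult\<close> and \<open>law_unit\<close> make a lifted object an algebra;
  \<open>law_comult\<close> and \<open>law_counit\<close> make the structure maps of
  \<open>G\<close> arrows of algebras.\<close>

locale mixed_distributive_law = T: monad_on C T + G: comonad_on C G
  for C :: "('o, 'a, 'z) cat_scheme" (structure) and T G +
  fixes law :: "'o \<Rightarrow> 'a"
  assumes law_nat: "nat_trans C C (comp_funct (mfun T) (wfun G)) (comp_funct (wfun G) (mfun T)) law"
    and law_mult: "X \<in> obj C \<Longrightarrow>
      law X \<cdot> mmult T ((wfun G)\<langle>X\<rangle>) = (wfun G)\<lceil>mmult T X\<rceil> \<cdot> law ((mfun T)\<langle>X\<rangle>) \<cdot> (mfun T)\<lceil>law X\<rceil>"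
    and law_unit: "X \<in> obj C \<Longrightarrow> law X \<cdot> munit T ((wfun G)\<langle>X\<rangle>) = (wfun G)\<lceil>munit T X\<rceil>"
    and law_comult: "X \<in> obj C \<Longrightarrow> wcomult G ((mfun T)\<langle>X\<rangle>) \<cdot> law X
      = (wfun G)\<lceil>law X\<rceil> \<cdot> law ((wfun G)\<langle>X\<rangle>) \<cdot> (mfun T)\<lceil>wcomult G X\<rceil>"
    and law_counit: "X \<in> obj C \<Longrightarrow> wcounit G ((mfun T)\<langle>X\<rangle>) \<cdot> law X = (mfun T)\<lceil>wcounit G X\<rceil>"
begin

lemmas law_simps [simp] = nat_trans_arr[OF law_nat, simplified]
  nat_trans_src[OF law_nat, simplified] nat_trans_tgt[OF law_nat, simplified]
lemmas law_natural = nat_trans_natural[OF law_nat, simplified]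

definition lift_obj where
  "lift_obj P = ((wfun G)\<langle>fst P\<rangle>, (wfun G)\<lceil>snd P\<rceil> \<cdot> law (fst P))"

definition lift :: "(('o, 'a) em_obj, ('o, 'a) em_arr) comonad" where
  "lift = \<lparr>wfun = \<lparr>on_obj = lift_obj,
      on_arr = (\<lambda>h. (lift_obj (fst h), (wfun G)\<lceil>fst (snd h)\<rceil>, lift_obj (snd (snd h))))\<rparr>,
    wcounit = (\<lambda>P. (lift_obj P, wcounit G (fst P), P)),
    wcomult = (\<lambda>P. (lift_obj P, wcomult G (fst P), lift_obj (lift_obj P)))\<rparr>"

lemma lift_simps [simp]:
  "(wfun lift)\<langle>P\<rangle> = lift_obj P"
  "(wfun lift)\<lceil>h\<rceil> = (lift_obj (fst h), (wfun G)\<lceil>fst (snd h)\<rceil>, lift_obj (snd (snd h)))"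
  "wcounit lift P = (lift_obj P, wcounit G (fst P), P)"
  "wcomult lift P = (lift_obj P, wcomult G (fst P), lift_obj (lift_obj P))"
  "fst (lift_obj P) = (wfun G)\<langle>fst P\<rangle>"
  "snd (lift_obj P) = (wfun G)\<lceil>snd P\<rceil> \<cdot> law (fst P)"
  by (simp_all add: lift_def lift_obj_def)

lemma lift_object:
  assumes P: "P \<in> em_objects C T"
  shows "lift_obj P \<in> em_objects C T"
proof -
  note PD = em_objectsD[OF P] and [simp] = em_objectsD(1-4)[OF P]
  have "(wfun G)\<lceil>snd P\<rceil> \<cdot> law (fst P) \<cdot> (mfun T)\<lceil>(wfun G)\<lceil>snd P\<rceil>\<rceil> \<cdot> (mfun T)\<lceil>law (fst P)\<rceil>
      = (wfun G)\<lceil>snd P \<cdot> (mfun T)\<lceil>snd P\<rceil>\<rceil> \<cdot> law ((mfun T)\<langle>fst P\<rangle>) \<cdot> (mfun T)\<lceil>law (fst P)\<rceil>"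
    by (simp add: T.cmp_tail[OF law_natural])
  also have "\<dots> = (wfun G)\<lceil>snd P\<rceil> \<cdot> law (fst P) \<cdot> mmult T ((wfun G)\<langle>fst P\<rangle>)"
    by (simp add: PD law_mult)
  finally have 1: "(wfun G)\<lceil>snd P\<rceil> \<cdot> law (fst P) \<cdot> (mfun T)\<lceil>(wfun G)\<lceil>snd P\<rceil>\<rceil> \<cdot> (mfun T)\<lceil>law (fst P)\<rceil>
      = (wfun G)\<lceil>snd P\<rceil> \<cdot> law (fst P) \<cdot> mmult T ((wfun G)\<langle>fst P\<rangle>)" .
  have "(wfun G)\<lceil>snd P\<rceil> \<cdot> (wfun G)\<lceil>munit T (fst P)\<rceil> = ide C ((wfun G)\<langle>fst P\<rangle>)"
    by (simp add: PD flip: G.W.fun_cmp)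
  with 1 show ?thesis
    by (simp add: lift_obj_def em_objects_iff hom_iff law_unit)
qed

text \<open>The comonad laws hold because they hold for \<open>G\<close> underneath. The work lies
  in seeing that all arrows involved are arrows of algebras.\<close>

lemma comonad_lift: "comonad_on (em_cat C T) lift"
proof -
  interpret E: category "em_cat C T" by (rule T.category_em_cat)
  have arr_lift: "(lift_obj P, (wfun G)\<lceil>f\<rceil>, lift_obj R) \<in> arr (em_cat C T)"
    if h: "(P, f, R) \<in> arr (em_cat C T)" for P f R
  proof -
    have P: "P \<in> em_objects C T" and R: "R \<in> em_objects C T"
      and [simp]: "f \<in> arr C" "src C f = fst P" "tgt C f = fst R"
      and f: "f \<cdot> snd P = snd R \<cdot> (mfun T)\<lceil>f\<rceil>"
      using h by (auto simp: arr_em_cat hom_iff)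
    note [simp] = em_objectsD(1-4)[OF P] em_objectsD(1-4)[OF R]
    have "(wfun G)\<lceil>f\<rceil> \<cdot> (wfun G)\<lceil>snd P\<rceil> = (wfun G)\<lceil>snd R\<rceil> \<cdot> (wfun G)\<lceil>(mfun T)\<lceil>f\<rceil>\<rceil>"
      using arg_cong[OF f, of "on_arr (wfun G)"] by simp
    then have "(wfun G)\<lceil>f\<rceil> \<cdot> (wfun G)\<lceil>snd P\<rceil> \<cdot> law (fst P)
        = (wfun G)\<lceil>snd R\<rceil> \<cdot> law (fst R) \<cdot> (mfun T)\<lceil>(wfun G)\<lceil>f\<rceil>\<rceil>"
      by (simp add: law_natural T.cmp_tail[OF \<open>(wfun G)\<lceil>f\<rceil> \<cdot> (wfun G)\<lceil>snd P\<rceil> = _\<close>])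
    then show ?thesis
      by (simp add: arr_em_cat lift_object P R hom_iff)
  qed
  interpret L: is_functor "em_cat C T" "em_cat C T" "wfun lift"
  proof
    fix h P R assume "h \<in> hom (em_cat C T) P R"
    then show "(wfun lift)\<lceil>h\<rceil> \<in> hom (em_cat C T) ((wfun lift)\<langle>P\<rangle>) ((wfun lift)\<langle>R\<rangle>)"
      by (cases h) (auto simp: hom_iff intro: arr_lift)
  next
    fix h h' P R S assume "h \<in> hom (em_cat C T) P R" "h' \<in> hom (em_cat C T) R S"
    then show "(wfun lift)\<lceil>h' \<cdot>\<^bsub>em_cat C T\<^esub> h\<rceil> = (wfun lift)\<lceil>h'\<rceil> \<cdot>\<^bsub>em_cat C T\<^esub> (wfun lift)\<lceil>h\<rceil>"
      by (cases h; cases h') (auto simp: hom_iff arr_em_cat)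
  qed (auto simp: lift_object em_objectsD)
  show ?thesis
  proof
    show "nat_trans (em_cat C T) (em_cat C T) (wfun lift) id_funct (wcounit lift)"
    proof (rule nat_transI)
      fix P assume "P \<in> obj (em_cat C T)"
      then have P: "P \<in> em_objects C T" by simp
      note [simp] = em_objectsD(1-4)[OF P]
      show "wcounit lift P \<in> hom (em_cat C T) ((wfun lift)\<langle>P\<rangle>) (id_funct\<langle>P\<rangle>)"
        by (simp add: hom_iff arr_em_cat P lift_object T.cmp_tail[OF G.counit_natural] law_counit)
    next
      fix h assume "h \<in> arr (em_cat C T)"
      then show "wcounit lift (tgt (em_cat C T) h) \<cdot>\<^bsub>em_cat C T\<^esub> (wfun lift)\<lceil>h\<rceil>
          = id_funct\<lceil>h\<rceil> \<cdot>\<^bsub>em_cat C T\<^esub> wcounit lift (src (em_cat C T) h)"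
        by (cases h) (auto simp: arr_em_cat hom_iff G.counit_natural)
    qed
    show "nat_trans (em_cat C T) (em_cat C T) (wfun lift) (comp_funct (wfun lift) (wfun lift)) (wcomult lift)"
    proof (rule nat_transI)
      fix P assume "P \<in> obj (em_cat C T)"
      then have P: "P \<in> em_objects C T" by simp
      note [simp] = em_objectsD(1-4)[OF P]
      show "wcomult lift P \<in> hom (em_cat C T) ((wfun lift)\<langle>P\<rangle>) ((comp_funct (wfun lift) (wfun lift))\<langle>P\<rangle>)"
        by (simp add: hom_iff arr_em_cat P lift_object T.cmp_tail[OF G.comult_natural] law_comult)
    next
      fix h assume "h \<in> arr (em_cat C T)"
      then show "wcomult lift (tgt (em_cat C T) h) \<cdot>\<^bsub>em_cat C T\<^esub> (wfun lift)\<lceil>h\<rceil>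
          = (comp_funct (wfun lift) (wfun lift))\<lceil>h\<rceil> \<cdot>\<^bsub>em_cat C T\<^esub> wcomult lift (src (em_cat C T) h)"
        by (cases h) (auto simp: arr_em_cat hom_iff G.comult_natural)
    qed
  qed (auto simp: em_objectsD G.coassoc G.counit_comult G.fun_counit_comult)
qed

end

text \<open>A comonad morphism \<sigma> turns \<open>W\<close>-coalgebras into
  \<open>G\<close>-coalgebras, and the law extends the resulting coaction to the free algebra.
  \<open>kap_eq\<close> demands this as an equation on coalgebras, so that a coaction given by
  another formula can be inserted.\<close>

locale comodule_comparison = mixed_distributive_law C T G law + monad_comonad C T W
  for C :: "('o, 'a, 'z) cat_scheme" (structure) and T G law W +
  fixes \<sigma> :: "'o \<Rightarrow> 'a" and kap :: "('o, 'a) em_obj \<Rightarrow> ('o, 'a) em_arr"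
  assumes sigma_nat: "nat_trans C C (wfun W) (wfun G) \<sigma>"
    and sigma_counit: "X \<in> obj C \<Longrightarrow> wcounit G X \<cdot> \<sigma> X = wcounit W X"
    and sigma_comult: "X \<in> obj C \<Longrightarrow>
      wcomult G X \<cdot> \<sigma> X = (wfun G)\<lceil>\<sigma> X\<rceil> \<cdot> \<sigma> ((wfun W)\<langle>X\<rangle>) \<cdot> wcomult W X"
    and kap_eq: "P \<in> coem_objects C W \<Longrightarrow>
      kap P = (F\<langle>P\<rangle>, law (fst P) \<cdot> (mfun T)\<lceil>\<sigma> (fst P) \<cdot> snd P\<rceil>, lift_obj (F\<langle>P\<rangle>))"
begin

lemmas sigma_simps [simp] = nat_trans_arr[OF sigma_nat, simplified]
  nat_trans_src[OF sigma_nat, simplified] nat_trans_tgt[OF sigma_nat, simplified]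
lemmas sigma_natural = nat_trans_natural[OF sigma_nat, simplified]

text \<open>Naturality exchanges \<open>G\<close> of the coaction with \<sigma>; coassociativity of
  the original coaction and \<open>sigma_comult\<close> then finish the push-forward.\<close>

lemma sigma_coalgebra:
  assumes P: "P \<in> coem_objects C W"
  shows "(wfun G)\<lceil>\<sigma> (fst P) \<cdot> snd P\<rceil> \<cdot> \<sigma> (fst P) \<cdot> snd P = wcomult G (fst P) \<cdot> \<sigma> (fst P) \<cdot> snd P"
    and "wcounit G (fst P) \<cdot> \<sigma> (fst P) \<cdot> snd P = ide C (fst P)"
proof -
  note PD = coem_objectsD[OF P] and [simp] = coem_objectsD(1-4)[OF P]
  have "(wfun G)\<lceil>\<sigma> (fst P) \<cdot> snd P\<rceil> \<cdot> \<sigma> (fst P) \<cdot> snd P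
      = (wfun G)\<lceil>\<sigma> (fst P)\<rceil> \<cdot> ((wfun G)\<lceil>snd P\<rceil> \<cdot> \<sigma> (fst P)) \<cdot> snd P"
    by simp
  also have "(wfun G)\<lceil>snd P\<rceil> \<cdot> \<sigma> (fst P) = \<sigma> ((wfun W)\<langle>fst P\<rangle>) \<cdot> (wfun W)\<lceil>snd P\<rceil>"
    using sigma_natural[of "snd P"] by simp
  also have "(wfun G)\<lceil>\<sigma> (fst P)\<rceil> \<cdot> (\<sigma> ((wfun W)\<langle>fst P\<rangle>) \<cdot> (wfun W)\<lceil>snd P\<rceil>) \<cdot> snd P
      = wcomult G (fst P) \<cdot> \<sigma> (fst P) \<cdot> snd P"
    by (simp add: PD T.cmp_tail[OF sigma_comult])
  finally show "(wfun G)\<lceil>\<sigma> (fst P) \<cdot> snd P\<rceil> \<cdot> \<sigma> (fst P) \<cdot> snd P = wcomult G (fst P) \<cdot> \<sigma> (fst P) \<cdot> snd P" .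
  show "wcounit G (fst P) \<cdot> \<sigma> (fst P) \<cdot> snd P = ide C (fst P)"
    by (simp add: T.cmp_tail[OF sigma_counit] PD)
qed

text \<open>\<open>law_mult\<close> makes \<open>kap\<close> an arrow of algebras. Its coalgebra
  laws are those of the pushed-forward coaction, carried across the law by \<open>law_comult\<close>
  and \<open>law_counit\<close>.\<close>

sublocale coaction "coem_cat C W" "em_cat C T" F Q unit counit lift kap
proof -
  interpret L: comonad_on "em_cat C T" lift by (rule comonad_lift)
  have kap_arr: "kap P \<in> arr (em_cat C T)" if P: "P \<in> coem_objects C W" for P
  proof -
    note [simp] = coem_objectsD(1-4)[OF P]
    have "law (fst P) \<cdot> ((mfun T)\<lceil>\<sigma> (fst P) \<cdot> snd P\<rceil> \<cdot> mmult T (fst P))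
        = law (fst P) \<cdot> (mmult T ((wfun G)\<langle>fst P\<rangle>) \<cdot> (mfun T)\<lceil>(mfun T)\<lceil>\<sigma> (fst P) \<cdot> snd P\<rceil>\<rceil>)"
      using T.mult_natural[of "\<sigma> (fst P) \<cdot> snd P"] by simp
    also have "\<dots> = (wfun G)\<lceil>mmult T (fst P)\<rceil> \<cdot> law ((mfun T)\<langle>fst P\<rangle>) \<cdot>
        (mfun T)\<lceil>law (fst P) \<cdot> (mfun T)\<lceil>\<sigma> (fst P) \<cdot> snd P\<rceil>\<rceil>"
      by (simp add: T.cmp_tail[OF law_mult])
    finally show ?thesis
      by (simp add: kap_eq[OF P] arr_em_cat T.free_object lift_object hom_iff)
  qed
  show "coaction (coem_cat C W) (em_cat C T) F Q unit counit lift kap"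
  proof
    show "nat_trans (coem_cat C W) (em_cat C T) F (comp_funct (wfun lift) F) kap"
    proof (rule nat_transI)
      fix P assume "P \<in> obj (coem_cat C W)"
      then show "kap P \<in> hom (em_cat C T) (F\<langle>P\<rangle>) ((comp_funct (wfun lift) F)\<langle>P\<rangle>)"
        using kap_arr[of P] by (simp add: hom_iff) (simp add: kap_eq)
    next
      fix h assume h: "h \<in> arr (coem_cat C W)"
      obtain P f R where [simp]: "h = (P, f, R)" by (cases h)
      have P: "P \<in> coem_objects C W" and R: "R \<in> coem_objects C W"
        and [simp]: "f \<in> arr C" "src C f = fst P" "tgt C f = fst R"
        and f: "snd R \<cdot> f = (wfun W)\<lceil>f\<rceil> \<cdot> snd P"
        using h by (auto simp: arr_coem_cat hom_iff)
      note [simp] = coem_objectsD(1-4)[OF P] coem_objectsD(1-4)[OF R]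
      have "law (fst R) \<cdot> (mfun T)\<lceil>\<sigma> (fst R) \<cdot> snd R\<rceil> \<cdot> (mfun T)\<lceil>f\<rceil>
          = law (fst R) \<cdot> (mfun T)\<lceil>\<sigma> (fst R) \<cdot> snd R \<cdot> f\<rceil>"
        by simp
      also have "\<sigma> (fst R) \<cdot> snd R \<cdot> f = (wfun G)\<lceil>f\<rceil> \<cdot> \<sigma> (fst P) \<cdot> snd P"
        by (simp add: f T.cmp_tail[OF sigma_natural])
      also have "law (fst R) \<cdot> (mfun T)\<lceil>(wfun G)\<lceil>f\<rceil> \<cdot> \<sigma> (fst P) \<cdot> snd P\<rceil>
          = (wfun G)\<lceil>(mfun T)\<lceil>f\<rceil>\<rceil> \<cdot> law (fst P) \<cdot> (mfun T)\<lceil>\<sigma> (fst P) \<cdot> snd P\<rceil>"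
        by (simp add: T.cmp_tail[OF law_natural])
      finally show "kap (tgt (coem_cat C W) h) \<cdot>\<^bsub>em_cat C T\<^esub> F\<lceil>h\<rceil>
          = (comp_funct (wfun lift) F)\<lceil>h\<rceil> \<cdot>\<^bsub>em_cat C T\<^esub> kap (src (coem_cat C W) h)"
        by (simp add: kap_eq P R)
    qed
  next
    fix P assume "P \<in> obj (coem_cat C W)"
    then have P: "P \<in> coem_objects C W" by simp
    note [simp] = coem_objectsD(1-4)[OF P]
    let ?\<theta> = "\<sigma> (fst P) \<cdot> snd P"
    have "(wfun G)\<lceil>law (fst P) \<cdot> (mfun T)\<lceil>?\<theta>\<rceil>\<rceil> \<cdot> law (fst P) \<cdot> (mfun T)\<lceil>?\<theta>\<rceil>
        = (wfun G)\<lceil>law (fst P)\<rceil> \<cdot> law ((wfun G)\<langle>fst P\<rangle>) \<cdot> (mfun T)\<lceil>(wfun G)\<lceil>?\<theta>\<rceil> \<cdot> ?\<theta>\<rceil>"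
      by (simp add: T.cmp_tail[OF law_natural])
    also have "\<dots> = wcomult G ((mfun T)\<langle>fst P\<rangle>) \<cdot> law (fst P) \<cdot> (mfun T)\<lceil>?\<theta>\<rceil>"
      unfolding sigma_coalgebra[OF P] by (simp add: T.cmp_tail[OF law_comult])
    finally have coassoc: "(wfun G)\<lceil>law (fst P) \<cdot> (mfun T)\<lceil>?\<theta>\<rceil>\<rceil> \<cdot> law (fst P) \<cdot> (mfun T)\<lceil>?\<theta>\<rceil>
        = wcomult G ((mfun T)\<langle>fst P\<rangle>) \<cdot> law (fst P) \<cdot> (mfun T)\<lceil>?\<theta>\<rceil>" .
    have "wcounit G ((mfun T)\<langle>fst P\<rangle>) \<cdot> law (fst P) \<cdot> (mfun T)\<lceil>?\<theta>\<rceil>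
        = (mfun T)\<lceil>wcounit G (fst P) \<cdot> ?\<theta>\<rceil>"
      by (simp add: T.cmp_tail[OF law_counit])
    then have counit: "wcounit G ((mfun T)\<langle>fst P\<rangle>) \<cdot> law (fst P) \<cdot> (mfun T)\<lceil>?\<theta>\<rceil> = ide C ((mfun T)\<langle>fst P\<rangle>)"
      by (simp only: sigma_coalgebra[OF P]) simp
    show "(F\<langle>P\<rangle>, kap P) \<in> coem_objects (em_cat C T) lift"
      using kap_arr[OF P] by (simp add: coem_objects_iff hom_iff T.free_object)
        (use coassoc counit in \<open>simp add: kap_eq[OF P]\<close>)
  qed
qed

text \<open>A retraction of the unit for \<open>T'\<close> is turned into one for \<open>T\<close> along the comparison
  \<open>W \<rho> : W T \<rightarrow> W T'\<close>; only compatibility of \<open>\<rho>\<close> with the units is needed.\<close>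

theorem equivalence_iff_galois:
  assumes "monad_on C T'" and rho: "nat_trans C C (mfun T) (mfun T') \<rho>"
    and rho_unit: "\<And>X. X \<in> obj C \<Longrightarrow> \<rho> X \<cdot> munit T X = munit T' X"
    and cc: "cauchy_complete C"
    and full: "full (coem_cat C W) (em_cat C T') (comp_funct (free_funct C T') forgetful)"
    and faithful: "faithful (coem_cat C W) (comp_funct (free_funct C T') forgetful)"
  shows "equivalence_of_categories (coem_cat C W) (coem_cat (em_cat C T) lift) K
    \<longleftrightarrow> nat_iso (em_cat C T) (em_cat C T) (comp_funct F Q) (wfun lift) can"
proof -
  interpret T': monad_on C T' by fact
  interpret J: monad_comonad C T' W ..
  note rho_simps [simp] = nat_trans_arr[OF rho] nat_trans_src[OF rho] nat_trans_tgt[OF rho]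
  note rho_natural = nat_trans_natural[OF rho]
  obtain \<nu> where nu: "nat_trans (coem_cat C W) (coem_cat C W) (comp_funct J.Q J.F) id_funct \<nu>"
    and nu_unit: "\<And>P. P \<in> obj (coem_cat C W) \<Longrightarrow> \<nu> P \<cdot>\<^bsub>coem_cat C W\<^esub> J.unit P = ide (coem_cat C W) P"
    using J.full_faithful_unit_retraction[OF full faithful] by metis
  define r where "r P = (cofree_funct C W)\<lceil>\<rho> (fst P)\<rceil>" for P :: "('o, 'a) em_obj"
  interpret V: is_functor C "coem_cat C W" "cofree_funct C W" by (rule W.is_functor_cofree)
  have r_nat: "nat_trans (coem_cat C W) (coem_cat C W) (comp_funct Q F) (comp_funct J.Q J.F) r"
  proof (rule nat_transI)
    fix P assume "P \<in> obj (coem_cat C W)"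
    then have [simp]: "fst P \<in> obj C" by (simp add: coem_objectsD)
    show "r P \<in> hom (coem_cat C W) ((comp_funct Q F)\<langle>P\<rangle>) ((comp_funct J.Q J.F)\<langle>P\<rangle>)"
      using V.fun_arr[of "\<rho> (fst P)"] by (simp add: r_def hom_iff)
  next
    fix h assume h: "h \<in> arr (coem_cat C W)"
    obtain P f R where [simp]: "h = (P, f, R)" by (cases h)
    have [simp]: "f \<in> arr C" "src C f = fst P" "tgt C f = fst R" "fst P \<in> obj C" "fst R \<in> obj C"
      using h by (auto simp: arr_coem_cat hom_iff dest: coem_objectsD)
    have "(wfun W)\<lceil>\<rho> (fst R) \<cdot> (mfun T)\<lceil>f\<rceil>\<rceil> = (wfun W)\<lceil>(mfun T')\<lceil>f\<rceil> \<cdot> \<rho> (fst P)\<rceil>"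
      using rho_natural[of f "fst R"] by simp
    then show "r (tgt (coem_cat C W) h) \<cdot>\<^bsub>coem_cat C W\<^esub> (comp_funct Q F)\<lceil>h\<rceil>
        = (comp_funct J.Q J.F)\<lceil>h\<rceil> \<cdot>\<^bsub>coem_cat C W\<^esub> r (src (coem_cat C W) h)"
      by (simp add: r_def)
  qed
  show ?thesis
  proof (rule equivalence_iff_can_iso)
    show "cauchy_complete (coem_cat C W)"
      using cc by (rule W.cauchy_complete_coem_cat)
    show "nat_trans (coem_cat C W) (coem_cat C W) (comp_funct Q F) id_funct (\<lambda>P. \<nu> P \<cdot>\<^bsub>coem_cat C W\<^esub> r P)"
      by (rule nat_trans_vcomp[OF _ _ _ r_nat nu])
        (intro is_functor_comp[OF F.is_functor_axioms Q.is_functor_axioms]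
          is_functor_comp[OF J.F.is_functor_axioms J.Q.is_functor_axioms] is_functor_id B.category_axioms)+
  next
    fix P assume PB: "P \<in> obj (coem_cat C W)"
    then have P: "P \<in> coem_objects C W" by simp
    note [simp] = coem_objectsD(1-4)[OF P]
    \<comment> \<open>Both units are \<open>W\<close> of a monad unit after the same coaction, so
      \<open>W \<rho>\<close> takes one to the other.\<close>
    have "r P \<cdot>\<^bsub>coem_cat C W\<^esub> unit P = J.unit P"
      by (simp add: r_def unit_def J.unit_def cofree_coalg_def) (simp add: rho_unit[symmetric])
    moreover have "unit P \<in> hom (coem_cat C W) P ((comp_funct Q F)\<langle>P\<rangle>)"
      "r P \<in> hom (coem_cat C W) ((comp_funct Q F)\<langle>P\<rangle>) ((comp_funct J.Q J.F)\<langle>P\<rangle>)"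
      "\<nu> P \<in> hom (coem_cat C W) ((comp_funct J.Q J.F)\<langle>P\<rangle>) P"
      using unit_nat r_nat nu PB by (simp_all only: nat_trans_def id_funct_simps)
    ultimately show "(\<nu> P \<cdot>\<^bsub>coem_cat C W\<^esub> r P) \<cdot>\<^bsub>coem_cat C W\<^esub> unit P = ide (coem_cat C W) P"
      using nu_unit[OF PB] by (simp only: B.cmp_assoc)
  qed
qed

end

section \<open>Monads and comonads from monoids and comonoids\<close>

lemma (in category) inv_natural:
  assumes "is_iso C a" "is_iso C b" "b \<cdot> f = g \<cdot> a"
    and "f \<in> arr C" "g \<in> arr C" "src C f = src C a" "tgt C f = src C b" "src C g = tgt C a" "tgt C g = tgt C b"
  shows "inv_arr C b \<cdot> g = f \<cdot> inv_arr C a"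
proof -
  note [simp] = inv_simps[OF assms(1)] inv_simps[OF assms(2)] assms(4-9)
  have "b \<cdot> inv_arr C b \<cdot> g = b \<cdot> f \<cdot> inv_arr C a"
    by (simp add: cmp_tail[OF cmp_inv] cmp_tail[OF assms(3)] assms(1,2))
  then show ?thesis
    by (rule iso_cancel_left[OF assms(2), rotated -1]) simp_all
qed

context monoidal_category
begin

declare tob_obj [simp] tunit_obj [simp] tar_ide [simp]

lemma
  assumes "f \<in> arr C" "g \<in> arr C"
  shows arr_tar [simp]: "f \<otimes>\<^sub>a\<^bsub>M\<^esub> g \<in> arr C"
    and src_tar [simp]: "src C (f \<otimes>\<^sub>a\<^bsub>M\<^esub> g) = src C f \<otimes>\<^bsub>M\<^esub> src C g"
    and tgt_tar [simp]: "tgt C (f \<otimes>\<^sub>a\<^bsub>M\<^esub> g) = tgt C f \<otimes>\<^bsub>M\<^esub> tgt C g"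
  using tar_hom[of f "src C f" "tgt C f" g "src C g" "tgt C g"] assms by (auto simp: hom_iff)

lemma tar_merge:
  "\<lbrakk>f \<in> arr C; f' \<in> arr C; g \<in> arr C; g' \<in> arr C; tgt C f = src C f'; tgt C g = src C g'\<rbrakk>
    \<Longrightarrow> (f' \<otimes>\<^sub>a\<^bsub>M\<^esub> g') \<cdot> (f \<otimes>\<^sub>a\<^bsub>M\<^esub> g) = (f' \<cdot> f) \<otimes>\<^sub>a\<^bsub>M\<^esub> (g' \<cdot> g)"
  using tar_cmp[of f "src C f" "tgt C f" f' "tgt C f'" g "src C g" "tgt C g" g' "tgt C g'"]
  by (simp add: hom_iff)

lemmas tar_merges = tar_merge cmp_tail[OF tar_merge]

lemma
  assumes "X \<in> obj C" "Y \<in> obj C" "Z \<in> obj C"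
  shows arr_assoc [simp]: "assoc M X Y Z \<in> arr C"
    and src_assoc [simp]: "src C (assoc M X Y Z) = (X \<otimes>\<^bsub>M\<^esub> Y) \<otimes>\<^bsub>M\<^esub> Z"
    and tgt_assoc [simp]: "tgt C (assoc M X Y Z) = X \<otimes>\<^bsub>M\<^esub> Y \<otimes>\<^bsub>M\<^esub> Z"
  using assoc_hom[OF assms] by (auto simp: hom_iff)

lemma
  assumes "X \<in> obj C"
  shows arr_lunit [simp]: "lunit M X \<in> arr C"
    and src_lunit [simp]: "src C (lunit M X) = tunit M \<otimes>\<^bsub>M\<^esub> X"
    and tgt_lunit [simp]: "tgt C (lunit M X) = X"
    and arr_runit [simp]: "runit M X \<in> arr C"
    and src_runit [simp]: "src C (runit M X) = X \<otimes>\<^bsub>M\<^esub> tunit M"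
    and tgt_runit [simp]: "tgt C (runit M X) = X"
  using lunit_hom[OF assms] runit_hom[OF assms] by (auto simp: hom_iff)

lemma assoc_natural:
  "\<lbrakk>f \<in> arr C; g \<in> arr C; h \<in> arr C; tgt C f = X; tgt C g = Y; tgt C h = Z\<rbrakk>
    \<Longrightarrow> assoc M X Y Z \<cdot> ((f \<otimes>\<^sub>a\<^bsub>M\<^esub> g) \<otimes>\<^sub>a\<^bsub>M\<^esub> h)
      = (f \<otimes>\<^sub>a\<^bsub>M\<^esub> (g \<otimes>\<^sub>a\<^bsub>M\<^esub> h)) \<cdot> assoc M (src C f) (src C g) (src C h)"
  by (rule assoc_nat) (auto simp: hom_iff)

lemma runit_natural:
  "\<lbrakk>f \<in> arr C; tgt C f = Y\<rbrakk>
    \<Longrightarrow> runit M Y \<cdot> (f \<otimes>\<^sub>a\<^bsub>M\<^esub> ide C (tunit M)) = f \<cdot> runit M (src C f)"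
  by (rule runit_nat) (auto simp: hom_iff)

lemma inv_assoc_simps [simp]:
  assumes "X \<in> obj C" "Y \<in> obj C" "Z \<in> obj C"
  shows "inv_arr C (assoc M X Y Z) \<in> arr C"
    and "src C (inv_arr C (assoc M X Y Z)) = X \<otimes>\<^bsub>M\<^esub> Y \<otimes>\<^bsub>M\<^esub> Z"
    and "tgt C (inv_arr C (assoc M X Y Z)) = (X \<otimes>\<^bsub>M\<^esub> Y) \<otimes>\<^bsub>M\<^esub> Z"
    and "inv_arr C (assoc M X Y Z) \<cdot> assoc M X Y Z = ide C ((X \<otimes>\<^bsub>M\<^esub> Y) \<otimes>\<^bsub>M\<^esub> Z)"
    and "assoc M X Y Z \<cdot> inv_arr C (assoc M X Y Z) = ide C (X \<otimes>\<^bsub>M\<^esub> Y \<otimes>\<^bsub>M\<^esub> Z)"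
  using inv_simps[OF assoc_iso[OF assms]] assms by simp_all

lemma inv_runit_simps [simp]:
  assumes "X \<in> obj C"
  shows "inv_arr C (runit M X) \<in> arr C"
    and "src C (inv_arr C (runit M X)) = X"
    and "tgt C (inv_arr C (runit M X)) = X \<otimes>\<^bsub>M\<^esub> tunit M"
    and "inv_arr C (runit M X) \<cdot> runit M X = ide C (X \<otimes>\<^bsub>M\<^esub> tunit M)"
    and "runit M X \<cdot> inv_arr C (runit M X) = ide C X"
  using inv_simps[OF runit_iso[OF assms]] assms by simp_all

lemmas inv_tail = cmp_tail[OF inv_assoc_simps(4)] cmp_tail[OF inv_assoc_simps(5)]
  cmp_tail[OF inv_runit_simps(4)] cmp_tail[OF inv_runit_simps(5)]

lemma inv_assoc_natural:
  "\<lbrakk>f \<in> arr C; g \<in> arr C; h \<in> arr C; tgt C f = X; tgt C g = Y; tgt C h = Z\<rbrakk>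
    \<Longrightarrow> inv_arr C (assoc M X Y Z) \<cdot> (f \<otimes>\<^sub>a\<^bsub>M\<^esub> (g \<otimes>\<^sub>a\<^bsub>M\<^esub> h))
      = ((f \<otimes>\<^sub>a\<^bsub>M\<^esub> g) \<otimes>\<^sub>a\<^bsub>M\<^esub> h) \<cdot> inv_arr C (assoc M (src C f) (src C g) (src C h))"
  by (rule inv_natural) (auto simp: assoc_iso assoc_natural)

lemma inv_runit_natural:
  "\<lbrakk>f \<in> arr C; tgt C f = Y\<rbrakk>
    \<Longrightarrow> inv_arr C (runit M Y) \<cdot> f = (f \<otimes>\<^sub>a\<^bsub>M\<^esub> ide C (tunit M)) \<cdot> inv_arr C (runit M (src C f))"
  by (rule inv_natural) (auto simp: runit_iso runit_natural)

text \<open>Kelly's argument: the pentagon reduces the claim to one tensored with the unit, where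
  naturality of the right unit allows cancelling.\<close>

lemma runit_tensor:
  assumes [simp]: "X \<in> obj C" "Y \<in> obj C"
  shows "(ide C X \<otimes>\<^sub>a\<^bsub>M\<^esub> runit M Y) \<cdot> assoc M X Y (tunit M) = runit M (X \<otimes>\<^bsub>M\<^esub> Y)"
proof -
  let ?I = "tunit M"
  let ?f = "(ide C X \<otimes>\<^sub>a\<^bsub>M\<^esub> runit M Y) \<cdot> assoc M X Y ?I"
  have "assoc M X Y ?I \<cdot> (?f \<otimes>\<^sub>a\<^bsub>M\<^esub> ide C ?I)
      = assoc M X Y ?I \<cdot> ((ide C X \<otimes>\<^sub>a\<^bsub>M\<^esub> runit M Y) \<otimes>\<^sub>a\<^bsub>M\<^esub> ide C ?I) \<cdot> (assoc M X Y ?I \<otimes>\<^sub>a\<^bsub>M\<^esub> ide C ?I)"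
    by (simp add: tar_merges)
  also have "\<dots> = (ide C X \<otimes>\<^sub>a\<^bsub>M\<^esub> (runit M Y \<otimes>\<^sub>a\<^bsub>M\<^esub> ide C ?I)) \<cdot> assoc M X (Y \<otimes>\<^bsub>M\<^esub> ?I) ?I
      \<cdot> (assoc M X Y ?I \<otimes>\<^sub>a\<^bsub>M\<^esub> ide C ?I)"
    by (simp add: cmp_tail[OF assoc_natural])
  also have "\<dots> = (ide C X \<otimes>\<^sub>a\<^bsub>M\<^esub> (ide C Y \<otimes>\<^sub>a\<^bsub>M\<^esub> lunit M ?I)) \<cdot> (ide C X \<otimes>\<^sub>a\<^bsub>M\<^esub> assoc M Y ?I ?I)
      \<cdot> assoc M X (Y \<otimes>\<^bsub>M\<^esub> ?I) ?I \<cdot> (assoc M X Y ?I \<otimes>\<^sub>a\<^bsub>M\<^esub> ide C ?I)"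
    by (simp add: tar_merges triangle)
  also have "\<dots> = (ide C X \<otimes>\<^sub>a\<^bsub>M\<^esub> (ide C Y \<otimes>\<^sub>a\<^bsub>M\<^esub> lunit M ?I)) \<cdot> assoc M X Y (?I \<otimes>\<^bsub>M\<^esub> ?I)
      \<cdot> assoc M (X \<otimes>\<^bsub>M\<^esub> Y) ?I ?I"
    by (simp add: pentagon)
  also have "\<dots> = assoc M X Y ?I \<cdot> ((ide C X \<otimes>\<^sub>a\<^bsub>M\<^esub> ide C Y) \<otimes>\<^sub>a\<^bsub>M\<^esub> lunit M ?I) \<cdot> assoc M (X \<otimes>\<^bsub>M\<^esub> Y) ?I ?I"
    by (simp add: cmp_tail[OF assoc_natural] del: tar_ide)
  also have "\<dots> = assoc M X Y ?I \<cdot> (runit M (X \<otimes>\<^bsub>M\<^esub> Y) \<otimes>\<^sub>a\<^bsub>M\<^esub> ide C ?I)"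
    by (simp add: triangle)
  finally have eq: "?f \<otimes>\<^sub>a\<^bsub>M\<^esub> ide C ?I = runit M (X \<otimes>\<^bsub>M\<^esub> Y) \<otimes>\<^sub>a\<^bsub>M\<^esub> ide C ?I"
    by (rule iso_cancel_left[OF assoc_iso, rotated -1]) simp_all
  have "?f \<cdot> runit M ((X \<otimes>\<^bsub>M\<^esub> Y) \<otimes>\<^bsub>M\<^esub> ?I) = runit M (X \<otimes>\<^bsub>M\<^esub> Y) \<cdot> (?f \<otimes>\<^sub>a\<^bsub>M\<^esub> ide C ?I)"
    using runit_natural[of ?f "X \<otimes>\<^bsub>M\<^esub> Y"] by simp
  also have "\<dots> = runit M (X \<otimes>\<^bsub>M\<^esub> Y) \<cdot> runit M ((X \<otimes>\<^bsub>M\<^esub> Y) \<otimes>\<^bsub>M\<^esub> ?I)"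
    unfolding eq by (simp add: runit_natural)
  finally show ?thesis
    by (rule iso_cancel_right[OF runit_iso, rotated -1]) simp_all
qed

lemma is_functor_tensor: "B \<in> obj C \<Longrightarrow> is_functor C C (tensor_funct C M B)"
  by unfold_locales (auto simp: tensor_funct_def hom_iff tar_merges)

lemma tensor_funct_simps [simp]:
  "(tensor_funct C M B)\<langle>X\<rangle> = X \<otimes>\<^bsub>M\<^esub> B" "(tensor_funct C M B)\<lceil>f\<rceil> = f \<otimes>\<^sub>a\<^bsub>M\<^esub> ide C B"
  by (simp_all add: tensor_funct_def)

lemma tensor_monad_simps [simp]:
  "mfun (tensor_monad C M B m e) = tensor_funct C M B"
  "munit (tensor_monad C M B m e) X = (ide C X \<otimes>\<^sub>a\<^bsub>M\<^esub> e) \<cdot> inv_arr C (runit M X)"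
  "mmult (tensor_monad C M B m e) X = (ide C X \<otimes>\<^sub>a\<^bsub>M\<^esub> m) \<cdot> assoc M X B B"
  by (simp_all add: tensor_monad_def)

lemma tensor_comonad_simps [simp]:
  "wfun (tensor_comonad C M B d c) = tensor_funct C M B"
  "wcounit (tensor_comonad C M B d c) X = runit M X \<cdot> (ide C X \<otimes>\<^sub>a\<^bsub>M\<^esub> c)"
  "wcomult (tensor_comonad C M B d c) X = inv_arr C (assoc M X B B) \<cdot> (ide C X \<otimes>\<^sub>a\<^bsub>M\<^esub> d)"
  by (simp_all add: tensor_comonad_def)

text \<open>The pentagon reconciles the associators, so that associativity reduces to that of
  \<open>m\<close> tensored with \<open>X\<close>. Of the unit laws, the one at
  \<open>X \<otimes> B\<close> relies on \<open>runit_tensor\<close> and the other on the triangle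
  axiom.\<close>

lemma monad_tensor_monad:
  assumes "monoid_in C M B m e"
  shows "monad_on C (tensor_monad C M B m e)"
proof -
  have [simp]: "B \<in> obj C" "m \<in> arr C" "src C m = B \<otimes>\<^bsub>M\<^esub> B" "tgt C m = B"
    "e \<in> arr C" "src C e = tunit M" "tgt C e = B"
    and m_assoc: "m \<cdot> (m \<otimes>\<^sub>a\<^bsub>M\<^esub> ide C B) = m \<cdot> (ide C B \<otimes>\<^sub>a\<^bsub>M\<^esub> m) \<cdot> assoc M B B B"
    and m_left: "m \<cdot> (e \<otimes>\<^sub>a\<^bsub>M\<^esub> ide C B) = lunit M B"
    and m_right: "m \<cdot> (ide C B \<otimes>\<^sub>a\<^bsub>M\<^esub> e) = runit M B"
    using assms by (auto simp: monoid_in_def hom_iff)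
  interpret T: is_functor C C "tensor_funct C M B"
    by (rule is_functor_tensor) simp
  show ?thesis
  proof (intro monad_on.intro monad_on_axioms.intro)
    show "category C" by (rule category_axioms)
    show "is_functor C C (mfun (tensor_monad C M B m e))"
      using T.is_functor_axioms by simp
    show "nat_trans C C id_funct (mfun (tensor_monad C M B m e)) (munit (tensor_monad C M B m e))"
      by (rule nat_transI) (simp_all add: hom_iff inv_runit_natural tar_merges)
    show "nat_trans C C (comp_funct (mfun (tensor_monad C M B m e)) (mfun (tensor_monad C M B m e)))
        (mfun (tensor_monad C M B m e)) (mmult (tensor_monad C M B m e))"
    proof (rule nat_transI)
      fix f assume [simp]: "f \<in> arr C"
      show "mmult (tensor_monad C M B m e) (tgt C f) \<cdot>
            (comp_funct (mfun (tensor_monad C M B m e)) (mfun (tensor_monad C M B m e)))\<lceil>f\<rceil>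
          = (mfun (tensor_monad C M B m e))\<lceil>f\<rceil> \<cdot> mmult (tensor_monad C M B m e) (src C f)"
        by (simp add: assoc_natural tar_merges)
    qed (simp add: hom_iff)
  next
    fix X assume [simp]: "X \<in> obj C"
    have "(ide C X \<otimes>\<^sub>a\<^bsub>M\<^esub> m) \<cdot> assoc M X B B \<cdot> (((ide C X \<otimes>\<^sub>a\<^bsub>M\<^esub> m) \<cdot> assoc M X B B) \<otimes>\<^sub>a\<^bsub>M\<^esub> ide C B)
        = (ide C X \<otimes>\<^sub>a\<^bsub>M\<^esub> m) \<cdot> assoc M X B B \<cdot> ((ide C X \<otimes>\<^sub>a\<^bsub>M\<^esub> m) \<otimes>\<^sub>a\<^bsub>M\<^esub> ide C B)
          \<cdot> (assoc M X B B \<otimes>\<^sub>a\<^bsub>M\<^esub> ide C B)"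
      by (simp add: tar_merges)
    also have "\<dots> = (ide C X \<otimes>\<^sub>a\<^bsub>M\<^esub> (m \<cdot> (m \<otimes>\<^sub>a\<^bsub>M\<^esub> ide C B))) \<cdot> assoc M X (B \<otimes>\<^bsub>M\<^esub> B) B
          \<cdot> (assoc M X B B \<otimes>\<^sub>a\<^bsub>M\<^esub> ide C B)"
      by (simp add: cmp_tail[OF assoc_natural]) (simp add: tar_merges)
    also have "\<dots> = (ide C X \<otimes>\<^sub>a\<^bsub>M\<^esub> (m \<cdot> (ide C B \<otimes>\<^sub>a\<^bsub>M\<^esub> m))) \<cdot> (ide C X \<otimes>\<^sub>a\<^bsub>M\<^esub> assoc M B B B)
          \<cdot> assoc M X (B \<otimes>\<^bsub>M\<^esub> B) B \<cdot> (assoc M X B B \<otimes>\<^sub>a\<^bsub>M\<^esub> ide C B)"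
      by (simp add: tar_merges m_assoc)
    also have "\<dots> = (ide C X \<otimes>\<^sub>a\<^bsub>M\<^esub> m) \<cdot> (ide C X \<otimes>\<^sub>a\<^bsub>M\<^esub> (ide C B \<otimes>\<^sub>a\<^bsub>M\<^esub> m)) \<cdot> assoc M X B (B \<otimes>\<^bsub>M\<^esub> B)
          \<cdot> assoc M (X \<otimes>\<^bsub>M\<^esub> B) B B"
      by (simp add: pentagon tar_merges)
    also have "\<dots> = (ide C X \<otimes>\<^sub>a\<^bsub>M\<^esub> m) \<cdot> assoc M X B B \<cdot> ((ide C X \<otimes>\<^sub>a\<^bsub>M\<^esub> ide C B) \<otimes>\<^sub>a\<^bsub>M\<^esub> m)
          \<cdot> assoc M (X \<otimes>\<^bsub>M\<^esub> B) B B"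
      by (simp add: cmp_tail[OF assoc_natural] del: tar_ide)
    finally show "mmult (tensor_monad C M B m e) X \<cdot> (mfun (tensor_monad C M B m e))\<lceil>mmult (tensor_monad C M B m e) X\<rceil>
        = mmult (tensor_monad C M B m e) X \<cdot> mmult (tensor_monad C M B m e) ((mfun (tensor_monad C M B m e))\<langle>X\<rangle>)"
      by simp
    have "(ide C X \<otimes>\<^sub>a\<^bsub>M\<^esub> m) \<cdot> assoc M X B B \<cdot> ((ide C X \<otimes>\<^sub>a\<^bsub>M\<^esub> ide C B) \<otimes>\<^sub>a\<^bsub>M\<^esub> e) \<cdot> inv_arr C (runit M (X \<otimes>\<^bsub>M\<^esub> B))
        = ((ide C X \<otimes>\<^sub>a\<^bsub>M\<^esub> runit M B) \<cdot> assoc M X B (tunit M)) \<cdot> inv_arr C (runit M (X \<otimes>\<^bsub>M\<^esub> B))"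
      by (simp add: cmp_tail[OF assoc_natural] tar_merges m_right del: tar_ide)
    then show "mmult (tensor_monad C M B m e) X \<cdot> munit (tensor_monad C M B m e) ((mfun (tensor_monad C M B m e))\<langle>X\<rangle>)
        = ide C ((mfun (tensor_monad C M B m e))\<langle>X\<rangle>)"
      by (simp only: runit_tensor \<open>X \<in> obj C\<close> \<open>B \<in> obj C\<close>) simp
    have "(ide C X \<otimes>\<^sub>a\<^bsub>M\<^esub> m) \<cdot> assoc M X B B \<cdot> ((ide C X \<otimes>\<^sub>a\<^bsub>M\<^esub> e) \<cdot> inv_arr C (runit M X)) \<otimes>\<^sub>a\<^bsub>M\<^esub> ide C B
        = (ide C X \<otimes>\<^sub>a\<^bsub>M\<^esub> m) \<cdot> assoc M X B B \<cdot> ((ide C X \<otimes>\<^sub>a\<^bsub>M\<^esub> e) \<otimes>\<^sub>a\<^bsub>M\<^esub> ide C B)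
          \<cdot> (inv_arr C (runit M X) \<otimes>\<^sub>a\<^bsub>M\<^esub> ide C B)"
      by (simp add: tar_merges)
    also have "\<dots> = ((ide C X \<otimes>\<^sub>a\<^bsub>M\<^esub> lunit M B) \<cdot> assoc M X (tunit M) B) \<cdot> (inv_arr C (runit M X) \<otimes>\<^sub>a\<^bsub>M\<^esub> ide C B)"
      by (simp add: cmp_tail[OF assoc_natural]) (simp add: tar_merges m_left)
    also have "\<dots> = ide C (X \<otimes>\<^bsub>M\<^esub> B)"
      by (simp only: triangle \<open>X \<in> obj C\<close> \<open>B \<in> obj C\<close>) (simp add: tar_merges)
    finally show "mmult (tensor_monad C M B m e) X \<cdot> (mfun (tensor_monad C M B m e))\<lceil>munit (tensor_monad C M B m e) X\<rceil>
        = ide C ((mfun (tensor_monad C M B m e))\<langle>X\<rangle>)"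
      by simp
  qed
qed

lemma comonad_tensor_comonad:
  assumes "comonoid_in C M B d c"
  shows "comonad_on C (tensor_comonad C M B d c)"
proof -
  have [simp]: "B \<in> obj C" "d \<in> arr C" "src C d = B" "tgt C d = B \<otimes>\<^bsub>M\<^esub> B"
    "c \<in> arr C" "src C c = B" "tgt C c = tunit M"
    and d_coassoc: "assoc M B B B \<cdot> (d \<otimes>\<^sub>a\<^bsub>M\<^esub> ide C B) \<cdot> d = (ide C B \<otimes>\<^sub>a\<^bsub>M\<^esub> d) \<cdot> d"
    and d_left: "lunit M B \<cdot> (c \<otimes>\<^sub>a\<^bsub>M\<^esub> ide C B) \<cdot> d = ide C B"
    and d_right: "runit M B \<cdot> (ide C B \<otimes>\<^sub>a\<^bsub>M\<^esub> c) \<cdot> d = ide C B"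
    using assms by (auto simp: comonoid_in_def hom_iff)
  interpret T: is_functor C C "tensor_funct C M B"
    by (rule is_functor_tensor) simp
  let ?G = "tensor_comonad C M B d c"
  show ?thesis
  proof (intro comonad_on.intro comonad_on_axioms.intro)
    show "category C" by (rule category_axioms)
    show "is_functor C C (wfun ?G)"
      using T.is_functor_axioms by simp
    show "nat_trans C C (wfun ?G) id_funct (wcounit ?G)"
    proof (rule nat_transI)
      fix f assume [simp]: "f \<in> arr C"
      have "runit M (tgt C f) \<cdot> (f \<otimes>\<^sub>a\<^bsub>M\<^esub> ide C (tunit M)) \<cdot> (ide C (src C f) \<otimes>\<^sub>a\<^bsub>M\<^esub> c)
          = f \<cdot> runit M (src C f) \<cdot> (ide C (src C f) \<otimes>\<^sub>a\<^bsub>M\<^esub> c)"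
        by (simp add: cmp_tail[OF runit_natural])
      then show "wcounit ?G (tgt C f) \<cdot> (wfun ?G)\<lceil>f\<rceil> = id_funct\<lceil>f\<rceil> \<cdot> wcounit ?G (src C f)"
        by (simp add: tar_merges)
    qed (simp add: hom_iff)
    show "nat_trans C C (wfun ?G) (comp_funct (wfun ?G) (wfun ?G)) (wcomult ?G)"
    proof (rule nat_transI)
      fix f assume [simp]: "f \<in> arr C"
      have "inv_arr C (assoc M (tgt C f) B B) \<cdot> (f \<otimes>\<^sub>a\<^bsub>M\<^esub> (ide C B \<otimes>\<^sub>a\<^bsub>M\<^esub> ide C B)) \<cdot> (ide C (src C f) \<otimes>\<^sub>a\<^bsub>M\<^esub> d)
          = ((f \<otimes>\<^sub>a\<^bsub>M\<^esub> ide C B) \<otimes>\<^sub>a\<^bsub>M\<^esub> ide C B) \<cdot> inv_arr C (assoc M (src C f) B B) \<cdot> (ide C (src C f) \<otimes>\<^sub>a\<^bsub>M\<^esub> d)"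
        by (simp add: cmp_tail[OF inv_assoc_natural] del: tar_ide)
      then show "wcomult ?G (tgt C f) \<cdot> (wfun ?G)\<lceil>f\<rceil> = (comp_funct (wfun ?G) (wfun ?G))\<lceil>f\<rceil> \<cdot> wcomult ?G (src C f)"
        by (simp add: tar_merges)
    qed (simp add: hom_iff)
  next
    fix X assume [simp]: "X \<in> obj C"
    let ?a = "inv_arr C (assoc M X B B)"
    \<comment> \<open>Both sides of coassociativity contain inverse associators. Composing with
      these two associators makes the pentagon applicable; they are cancelled at the end.\<close>
    have "assoc M X B (B \<otimes>\<^bsub>M\<^esub> B) \<cdot> assoc M (X \<otimes>\<^bsub>M\<^esub> B) B B \<cdot> ((?a \<cdot> (ide C X \<otimes>\<^sub>a\<^bsub>M\<^esub> d)) \<otimes>\<^sub>a\<^bsub>M\<^esub> ide C B)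
          \<cdot> ?a \<cdot> (ide C X \<otimes>\<^sub>a\<^bsub>M\<^esub> d)
        = (assoc M X B (B \<otimes>\<^bsub>M\<^esub> B) \<cdot> assoc M (X \<otimes>\<^bsub>M\<^esub> B) B B) \<cdot> (?a \<otimes>\<^sub>a\<^bsub>M\<^esub> ide C B)
          \<cdot> ((ide C X \<otimes>\<^sub>a\<^bsub>M\<^esub> d) \<otimes>\<^sub>a\<^bsub>M\<^esub> ide C B) \<cdot> ?a \<cdot> (ide C X \<otimes>\<^sub>a\<^bsub>M\<^esub> d)"
      by (simp add: tar_merges)
    also have "\<dots> = (ide C X \<otimes>\<^sub>a\<^bsub>M\<^esub> assoc M B B B) \<cdot> assoc M X (B \<otimes>\<^bsub>M\<^esub> B) B
          \<cdot> ((ide C X \<otimes>\<^sub>a\<^bsub>M\<^esub> d) \<otimes>\<^sub>a\<^bsub>M\<^esub> ide C B) \<cdot> ?a \<cdot> (ide C X \<otimes>\<^sub>a\<^bsub>M\<^esub> d)"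
      unfolding pentagon[OF \<open>X \<in> obj C\<close> \<open>B \<in> obj C\<close> \<open>B \<in> obj C\<close> \<open>B \<in> obj C\<close>, symmetric]
      by (simp add: tar_merges inv_tail)
    also have "\<dots> = ide C X \<otimes>\<^sub>a\<^bsub>M\<^esub> (assoc M B B B \<cdot> (d \<otimes>\<^sub>a\<^bsub>M\<^esub> ide C B) \<cdot> d)"
      by (simp add: cmp_tail[OF assoc_natural] inv_tail tar_merges)
    also have "\<dots> = (ide C X \<otimes>\<^sub>a\<^bsub>M\<^esub> (ide C B \<otimes>\<^sub>a\<^bsub>M\<^esub> d)) \<cdot> assoc M X B B \<cdot> ?a \<cdot> (ide C X \<otimes>\<^sub>a\<^bsub>M\<^esub> d)"
      by (simp add: tar_merges inv_tail d_coassoc)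
    also have "\<dots> = assoc M X B (B \<otimes>\<^bsub>M\<^esub> B) \<cdot> ((ide C X \<otimes>\<^sub>a\<^bsub>M\<^esub> ide C B) \<otimes>\<^sub>a\<^bsub>M\<^esub> d) \<cdot> ?a \<cdot> (ide C X \<otimes>\<^sub>a\<^bsub>M\<^esub> d)"
      by (simp add: cmp_tail[OF assoc_natural] del: tar_ide)
    also have "\<dots> = assoc M X B (B \<otimes>\<^bsub>M\<^esub> B) \<cdot> assoc M (X \<otimes>\<^bsub>M\<^esub> B) B B \<cdot>
        wcomult ?G ((wfun ?G)\<langle>X\<rangle>) \<cdot> wcomult ?G X"
      by (simp add: inv_tail)
    finally have "assoc M X B (B \<otimes>\<^bsub>M\<^esub> B) \<cdot> assoc M (X \<otimes>\<^bsub>M\<^esub> B) B B \<cdot> (wfun ?G)\<lceil>wcomult ?G X\<rceil> \<cdot> wcomult ?G X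
        = assoc M X B (B \<otimes>\<^bsub>M\<^esub> B) \<cdot> assoc M (X \<otimes>\<^bsub>M\<^esub> B) B B \<cdot> wcomult ?G ((wfun ?G)\<langle>X\<rangle>) \<cdot> wcomult ?G X"
      by simp
    then have "assoc M (X \<otimes>\<^bsub>M\<^esub> B) B B \<cdot> (wfun ?G)\<lceil>wcomult ?G X\<rceil> \<cdot> wcomult ?G X
        = assoc M (X \<otimes>\<^bsub>M\<^esub> B) B B \<cdot> wcomult ?G ((wfun ?G)\<langle>X\<rangle>) \<cdot> wcomult ?G X"
      by (rule iso_cancel_left[OF assoc_iso, rotated -1]) simp_all
    then show "(wfun ?G)\<lceil>wcomult ?G X\<rceil> \<cdot> wcomult ?G X = wcomult ?G ((wfun ?G)\<langle>X\<rangle>) \<cdot> wcomult ?G X"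
      by (rule iso_cancel_left[OF assoc_iso, rotated -1]) simp_all
    have "((ide C X \<otimes>\<^sub>a\<^bsub>M\<^esub> runit M B) \<cdot> assoc M X B (tunit M)) \<cdot> ((ide C X \<otimes>\<^sub>a\<^bsub>M\<^esub> ide C B) \<otimes>\<^sub>a\<^bsub>M\<^esub> c) \<cdot> ?a \<cdot> (ide C X \<otimes>\<^sub>a\<^bsub>M\<^esub> d)
        = ide C X \<otimes>\<^sub>a\<^bsub>M\<^esub> (runit M B \<cdot> (ide C B \<otimes>\<^sub>a\<^bsub>M\<^esub> c) \<cdot> d)"
      by (simp add: cmp_tail[OF assoc_natural] inv_tail tar_merges del: tar_ide)
    then show "wcounit ?G ((wfun ?G)\<langle>X\<rangle>) \<cdot> wcomult ?G X = ide C ((wfun ?G)\<langle>X\<rangle>)"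
      by (simp only: runit_tensor d_right \<open>X \<in> obj C\<close> \<open>B \<in> obj C\<close>) simp
    have "((runit M X \<cdot> (ide C X \<otimes>\<^sub>a\<^bsub>M\<^esub> c)) \<otimes>\<^sub>a\<^bsub>M\<^esub> ide C B) \<cdot> ?a \<cdot> (ide C X \<otimes>\<^sub>a\<^bsub>M\<^esub> d)
        = (runit M X \<otimes>\<^sub>a\<^bsub>M\<^esub> ide C B) \<cdot> ((ide C X \<otimes>\<^sub>a\<^bsub>M\<^esub> c) \<otimes>\<^sub>a\<^bsub>M\<^esub> ide C B) \<cdot> ?a \<cdot> (ide C X \<otimes>\<^sub>a\<^bsub>M\<^esub> d)"
      by (simp add: tar_merges)
    also have "\<dots> = (ide C X \<otimes>\<^sub>a\<^bsub>M\<^esub> lunit M B) \<cdot> assoc M X (tunit M) B \<cdot> ((ide C X \<otimes>\<^sub>a\<^bsub>M\<^esub> c) \<otimes>\<^sub>a\<^bsub>M\<^esub> ide C B) \<cdot> ?a \<cdot> (ide C X \<otimes>\<^sub>a\<^bsub>M\<^esub> d)"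
      by (simp add: cmp_tail[OF triangle])
    also have "\<dots> = ide C X \<otimes>\<^sub>a\<^bsub>M\<^esub> (lunit M B \<cdot> (c \<otimes>\<^sub>a\<^bsub>M\<^esub> ide C B) \<cdot> d)"
      by (simp add: cmp_tail[OF assoc_natural] inv_tail tar_merges)
    finally show "(wfun ?G)\<lceil>wcounit ?G X\<rceil> \<cdot> wcomult ?G X = ide C ((wfun ?G)\<langle>X\<rangle>)"
      by (simp add: d_left)
  qed
qed

end

section \<open>The mixed distributive law of a bimonoid\<close>

context duoidal_category
begin

lemma
  assumes "W \<in> obj D" "X \<in> obj D" "Y \<in> obj D" "Z \<in> obj D"
  shows arr_zeta [simp]: "zeta D W X Y Z \<in> arr D"
    and src_zeta [simp]: "src D (zeta D W X Y Z) = (W \<star> X) \<odot> (Y \<star> Z)"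
    and tgt_zeta [simp]: "tgt D (zeta D W X Y Z) = (W \<odot> Y) \<star> (X \<odot> Z)"
  using zeta_hom[OF assms] by (auto simp: hom_iff)

lemma zeta_natural:
  "\<lbrakk>f \<in> arr D; g \<in> arr D; h \<in> arr D; k \<in> arr D;
    tgt D f = W; tgt D g = X; tgt D h = Y; tgt D k = Z\<rbrakk>
    \<Longrightarrow> zeta D W X Y Z \<cdot> ((f \<star>\<^sub>a g) \<odot>\<^sub>a (h \<star>\<^sub>a k))
      = ((f \<odot>\<^sub>a h) \<star>\<^sub>a (g \<odot>\<^sub>a k)) \<cdot> zeta D (src D f) (src D g) (src D h) (src D k)"
  by (rule zeta_nat) (auto simp: hom_iff)

text \<open>Simplification merges a product of identities into the identity of the product, and the
  general square then no longer matches. This form and its mirror image are stated after the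
  merging.\<close>

lemma zeta_natural_left:
  assumes "f \<in> arr D" "g \<in> arr D" "Y \<in> obj D" "Z \<in> obj D" "tgt D f = W" "tgt D g = X"
  shows "zeta D W X Y Z \<cdot> ((f \<star>\<^sub>a g) \<odot>\<^sub>a ide D (Y \<star> Z))
    = ((f \<odot>\<^sub>a ide D Y) \<star>\<^sub>a (g \<odot>\<^sub>a ide D Z)) \<cdot> zeta D (src D f) (src D g) Y Z"
  using zeta_natural[of f g "ide D Y" "ide D Z" W X Y Z] assms by simp

lemma zeta_natural_right:
  assumes "W \<in> obj D" "X \<in> obj D" "h \<in> arr D" "k \<in> arr D" "tgt D h = Y" "tgt D k = Z"
  shows "zeta D W X Y Z \<cdot> (ide D (W \<star> X) \<odot>\<^sub>a (h \<star>\<^sub>a k))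
    = ((ide D W \<odot>\<^sub>a h) \<star>\<^sub>a (ide D X \<odot>\<^sub>a k)) \<cdot> zeta D W X (src D h) (src D k)"
  using zeta_natural[of "ide D W" "ide D X" h k W X Y Z] assms by simp

lemma duoidal_simps [simp]:
  "Delta D \<in> arr D" "src D (Delta D) = \<I>" "tgt D (Delta D) = \<I> \<star> \<I>"
  "mu D \<in> arr D" "src D (mu D) = \<J> \<odot> \<J>" "tgt D (mu D) = \<J>"
  "tau D \<in> arr D" "src D (tau D) = \<I>" "tgt D (tau D) = \<J>"
  using Delta_hom mu_hom tau_hom by (auto simp: hom_iff)

text \<open>Composing \<open>mu_right\<close> with the right unitors clears the inverses from its
  source; this is the form in which \<open>law_counit\<close> meets it.\<close>

lemma runit_star_zeta:
  assumes [simp]: "X \<in> obj D" "Y \<in> obj D"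
  shows "runit (star D) (X \<odot> Y) \<cdot> (ide D (X \<odot> Y) \<star>\<^sub>a mu D) \<cdot> zeta D X \<J> Y \<J>
    = runit (star D) X \<odot>\<^sub>a runit (star D) Y"
proof -
  let ?r = "inv_arr D (runit (star D) X) \<odot>\<^sub>a inv_arr D (runit (star D) Y)"
  have "(runit (star D) (X \<odot> Y) \<cdot> (ide D (X \<odot> Y) \<star>\<^sub>a mu D) \<cdot> zeta D X \<J> Y \<J> \<cdot> ?r)
      \<cdot> (runit (star D) X \<odot>\<^sub>a runit (star D) Y)
    = runit (star D) (X \<odot> Y) \<cdot> (ide D (X \<odot> Y) \<star>\<^sub>a mu D) \<cdot> zeta D X \<J> Y \<J>"
    by (simp add: circ.tar_merges)
  then show ?thesis
    by (simp only: mu_right assms) simp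
qed

end

section \<open>From the bimonoid axioms to the axioms of a distributive law\<close>

locale duoidal_bimonoid = duoidal_category D for D :: "('o, 'a) duoidal" (structure) +
  fixes A and m e \<delta> \<epsilon> :: 'a
  assumes bimonoid: "bimonoid D A m e \<delta> \<epsilon>"
begin

lemma monoid: "monoid_in D (circ D) A m e"
  and comonoid: "comonoid_in D (star D) A \<delta> \<epsilon>"
  and comult_mult: "\<delta> \<cdot> m = (m \<star>\<^sub>a m) \<cdot> zeta D A A A A \<cdot> (\<delta> \<odot>\<^sub>a \<delta>)"
  and counit_mult: "\<epsilon> \<cdot> m = mu D \<cdot> (\<epsilon> \<odot>\<^sub>a \<epsilon>)"
  and comult_unit: "\<delta> \<cdot> e = (e \<star>\<^sub>a e) \<cdot> Delta D"
  and counit_unit: "\<epsilon> \<cdot> e = tau D"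
  using bimonoid by (auto simp: bimonoid_def)

lemma bimonoid_simps [simp]:
  "A \<in> obj D" "m \<in> arr D" "src D m = A \<odot> A" "tgt D m = A" "e \<in> arr D" "src D e = \<I>" "tgt D e = A"
  "\<delta> \<in> arr D" "src D \<delta> = A" "tgt D \<delta> = A \<star> A" "\<epsilon> \<in> arr D" "src D \<epsilon> = A" "tgt D \<epsilon> = \<J>"
  using monoid comonoid by (auto simp: monoid_in_def comonoid_in_def hom_iff)

lemma mult_laws:
  "m \<cdot> (m \<odot>\<^sub>a ide D A) = m \<cdot> (ide D A \<odot>\<^sub>a m) \<cdot> assoc (circ D) A A A"
  "m \<cdot> (e \<odot>\<^sub>a ide D A) = lunit (circ D) A"
  "m \<cdot> (ide D A \<odot>\<^sub>a e) = runit (circ D) A"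
  using monoid by (auto simp: monoid_in_def)

lemma comult_laws:
  "assoc (star D) A A A \<cdot> (\<delta> \<star>\<^sub>a ide D A) \<cdot> \<delta> = (ide D A \<star>\<^sub>a \<delta>) \<cdot> \<delta>"
  "lunit (star D) A \<cdot> (\<epsilon> \<star>\<^sub>a ide D A) \<cdot> \<delta> = ide D A"
  "runit (star D) A \<cdot> (ide D A \<star>\<^sub>a \<epsilon>) \<cdot> \<delta> = ide D A"
  using comonoid by (auto simp: comonoid_in_def)

abbreviation "T \<equiv> tensor_monad D (circ D) A m e"
abbreviation "G \<equiv> tensor_comonad D (star D) A \<delta> \<epsilon>"
abbreviation "law \<equiv> mixed_law D A m \<delta>"

lemma law_simps [simp]:
  assumes "X \<in> obj D"
  shows "law X \<in> arr D" "src D (law X) = (X \<star> A) \<odot> A" "tgt D (law X) = (X \<odot> A) \<star> A"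
  using assms by (simp_all add: mixed_law_def)

lemma law_natural:
  assumes [simp]: "f \<in> arr D"
  shows "law (tgt D f) \<cdot> ((f \<star>\<^sub>a ide D A) \<odot>\<^sub>a ide D A) = ((f \<odot>\<^sub>a ide D A) \<star>\<^sub>a ide D A) \<cdot> law (src D f)"
proof -
  let ?X = "src D f" and ?Y = "tgt D f"
  have "law ?Y \<cdot> ((f \<star>\<^sub>a ide D A) \<odot>\<^sub>a ide D A)
      = (ide D (?Y \<odot> A) \<star>\<^sub>a m) \<cdot> zeta D ?Y A A A \<cdot> ((f \<star>\<^sub>a ide D A) \<odot>\<^sub>a ide D (A \<star> A))
        \<cdot> (ide D (?X \<star> A) \<odot>\<^sub>a \<delta>)"
    by (simp add: mixed_law_def circ.tar_merges)
  also have "\<dots> = (ide D (?Y \<odot> A) \<star>\<^sub>a m) \<cdot> ((f \<odot>\<^sub>a ide D A) \<star>\<^sub>a (ide D A \<odot>\<^sub>a ide D A)) \<cdot> zeta D ?X A A A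
        \<cdot> (ide D (?X \<star> A) \<odot>\<^sub>a \<delta>)"
    by (simp add: circ.cmp_tail[OF zeta_natural_left])
  also have "\<dots> = ((f \<odot>\<^sub>a ide D A) \<star>\<^sub>a ide D A) \<cdot> law ?X"
    by (simp add: mixed_law_def star.tar_merges)
  finally show ?thesis .
qed

text \<open>\<open>comult_unit\<close> turns \<delta> into \<open>Delta\<close> with two copies of
  \<open>e\<close>. Naturality moves both past the interchange, \<open>m\<close> absorbs one of
  them, and \<open>Delta_right\<close> removes the interchange.\<close>

lemma law_unit:
  assumes [simp]: "X \<in> obj D"
  shows "law X \<cdot> (ide D (X \<star> A) \<odot>\<^sub>a e)
    = (((ide D X \<odot>\<^sub>a e) \<cdot> inv_arr D (runit (circ D) X)) \<star>\<^sub>a ide D A) \<cdot> runit (circ D) (X \<star> A)"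
proof -
  have "law X \<cdot> (ide D (X \<star> A) \<odot>\<^sub>a e)
      = (ide D (X \<odot> A) \<star>\<^sub>a m) \<cdot> zeta D X A A A \<cdot> (ide D (X \<star> A) \<odot>\<^sub>a (e \<star>\<^sub>a e)) \<cdot> (ide D (X \<star> A) \<odot>\<^sub>a Delta D)"
    by (simp add: mixed_law_def circ.tar_merges comult_unit)
  also have "\<dots> = (ide D (X \<odot> A) \<star>\<^sub>a m) \<cdot> ((ide D X \<odot>\<^sub>a e) \<star>\<^sub>a (ide D A \<odot>\<^sub>a e)) \<cdot> zeta D X A \<I> \<I>
      \<cdot> (ide D (X \<star> A) \<odot>\<^sub>a Delta D)"
    by (simp add: circ.cmp_tail[OF zeta_natural_right])
  also have "\<dots> = (((ide D X \<odot>\<^sub>a e) \<cdot> inv_arr D (runit (circ D) X)) \<star>\<^sub>a ide D A)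
      \<cdot> (runit (circ D) X \<star>\<^sub>a runit (circ D) A) \<cdot> zeta D X A \<I> \<I> \<cdot> (ide D (X \<star> A) \<odot>\<^sub>a Delta D)"
    by (simp add: star.tar_merges mult_laws circ.inv_tail)
  finally show ?thesis
    by (simp add: Delta_right)
qed

text \<open>\<open>counit_mult\<close> replaces \<open>m\<close> by \<open>mu\<close>; naturality
  moves the counits in front of the interchange, where \<open>runit_star_zeta\<close> and the counit
  law of \<open>A\<close> apply.\<close>

lemma law_counit:
  assumes [simp]: "X \<in> obj D"
  shows "runit (star D) (X \<odot> A) \<cdot> (ide D (X \<odot> A) \<star>\<^sub>a \<epsilon>) \<cdot> law X
    = (runit (star D) X \<cdot> (ide D X \<star>\<^sub>a \<epsilon>)) \<odot>\<^sub>a ide D A"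
proof -
  have "(ide D (X \<odot> A) \<star>\<^sub>a \<epsilon>) \<cdot> law X
      = (ide D (X \<odot> A) \<star>\<^sub>a mu D) \<cdot> ((ide D X \<odot>\<^sub>a ide D A) \<star>\<^sub>a (\<epsilon> \<odot>\<^sub>a \<epsilon>)) \<cdot> zeta D X A A A \<cdot> (ide D (X \<star> A) \<odot>\<^sub>a \<delta>)"
    by (simp add: mixed_law_def star.tar_merges counit_mult)
  also have "\<dots> = (ide D (X \<odot> A) \<star>\<^sub>a mu D) \<cdot> zeta D X \<J> A \<J>
      \<cdot> ((ide D X \<star>\<^sub>a \<epsilon>) \<odot>\<^sub>a (ide D A \<star>\<^sub>a \<epsilon>)) \<cdot> (ide D (X \<star> A) \<odot>\<^sub>a \<delta>)"
    by (simp add: circ.cmp_tail[OF zeta_natural])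
  finally have "runit (star D) (X \<odot> A) \<cdot> (ide D (X \<odot> A) \<star>\<^sub>a \<epsilon>) \<cdot> law X
      = (runit (star D) (X \<odot> A) \<cdot> (ide D (X \<odot> A) \<star>\<^sub>a mu D) \<cdot> zeta D X \<J> A \<J>)
        \<cdot> ((ide D X \<star>\<^sub>a \<epsilon>) \<odot>\<^sub>a (ide D A \<star>\<^sub>a \<epsilon>)) \<cdot> (ide D (X \<star> A) \<odot>\<^sub>a \<delta>)"
    by simp
  also have "\<dots> = (runit (star D) X \<cdot> (ide D X \<star>\<^sub>a \<epsilon>)) \<odot>\<^sub>a ide D A"
    by (simp add: runit_star_zeta circ.tar_merges comult_laws)
  finally show ?thesis .
qed

text \<open>\<open>comult_mult\<close> produces a second interchange, \<open>zeta_circ_assoc\<close>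
  reassociates the two, and associativity of \<open>m\<close> in the second factor splits the result
  into two copies of the law.\<close>

lemma law_mult:
  assumes [simp]: "X \<in> obj D"
  shows "law X \<cdot> (ide D (X \<star> A) \<odot>\<^sub>a m) \<cdot> assoc (circ D) (X \<star> A) A A
    = (((ide D X \<odot>\<^sub>a m) \<cdot> assoc (circ D) X A A) \<star>\<^sub>a ide D A) \<cdot> law (X \<odot> A) \<cdot> (law X \<odot>\<^sub>a ide D A)"
proof -
  let ?\<alpha> = "assoc (circ D)"
  let ?Z = "zeta D (X \<odot> A) (A \<odot> A) A A \<cdot> (zeta D X A A A \<odot>\<^sub>a ide D (A \<star> A)) \<cdot> ((ide D (X \<star> A) \<odot>\<^sub>a \<delta>) \<odot>\<^sub>a \<delta>)"
  have "law X \<cdot> (ide D (X \<star> A) \<odot>\<^sub>a m) \<cdot> ?\<alpha> (X \<star> A) A A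
      = (ide D (X \<odot> A) \<star>\<^sub>a m) \<cdot> zeta D X A A A \<cdot> (ide D (X \<star> A) \<odot>\<^sub>a (m \<star>\<^sub>a m))
        \<cdot> (ide D (X \<star> A) \<odot>\<^sub>a zeta D A A A A) \<cdot> (ide D (X \<star> A) \<odot>\<^sub>a (\<delta> \<odot>\<^sub>a \<delta>)) \<cdot> ?\<alpha> (X \<star> A) A A"
    by (simp add: mixed_law_def circ.tar_merges comult_mult)
  also have "\<dots> = (ide D (X \<odot> A) \<star>\<^sub>a m) \<cdot> ((ide D X \<odot>\<^sub>a m) \<star>\<^sub>a (ide D A \<odot>\<^sub>a m)) \<cdot> zeta D X A (A \<odot> A) (A \<odot> A)
        \<cdot> (ide D (X \<star> A) \<odot>\<^sub>a zeta D A A A A) \<cdot> ?\<alpha> (X \<star> A) (A \<star> A) (A \<star> A) \<cdot> ((ide D (X \<star> A) \<odot>\<^sub>a \<delta>) \<odot>\<^sub>a \<delta>)"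
    by (simp add: circ.cmp_tail[OF zeta_natural_right] circ.assoc_natural)
  also have "\<dots> = (ide D (X \<odot> A) \<star>\<^sub>a m) \<cdot> ((ide D X \<odot>\<^sub>a m) \<star>\<^sub>a (ide D A \<odot>\<^sub>a m)) \<cdot>
        (zeta D X A (A \<odot> A) (A \<odot> A) \<cdot> (ide D (X \<star> A) \<odot>\<^sub>a zeta D A A A A) \<cdot> ?\<alpha> (X \<star> A) (A \<star> A) (A \<star> A))
        \<cdot> ((ide D (X \<star> A) \<odot>\<^sub>a \<delta>) \<odot>\<^sub>a \<delta>)"
    by simp
  also have "\<dots> = (ide D (X \<odot> A) \<star>\<^sub>a m) \<cdot> ((ide D X \<odot>\<^sub>a m) \<star>\<^sub>a (ide D A \<odot>\<^sub>a m)) \<cdot> (?\<alpha> X A A \<star>\<^sub>a ?\<alpha> A A A) \<cdot> ?Z"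
    by (subst zeta_circ_assoc[symmetric]) simp_all
  also have "\<dots> = (((ide D X \<odot>\<^sub>a m) \<cdot> ?\<alpha> X A A) \<star>\<^sub>a (m \<cdot> (m \<odot>\<^sub>a ide D A))) \<cdot> ?Z"
    by (simp add: star.tar_merges mult_laws)
  also have "\<dots> = (((ide D X \<odot>\<^sub>a m) \<cdot> ?\<alpha> X A A) \<star>\<^sub>a m) \<cdot> ((ide D (X \<odot> A) \<odot>\<^sub>a ide D A) \<star>\<^sub>a (m \<odot>\<^sub>a ide D A)) \<cdot> ?Z"
    by (simp add: star.tar_merges)
  also have "\<dots> = (((ide D X \<odot>\<^sub>a m) \<cdot> ?\<alpha> X A A) \<star>\<^sub>a m) \<cdot> zeta D (X \<odot> A) A A A
      \<cdot> ((ide D (X \<odot> A) \<star>\<^sub>a m) \<odot>\<^sub>a ide D (A \<star> A)) \<cdot> (zeta D X A A A \<odot>\<^sub>a ide D (A \<star> A)) \<cdot> ((ide D (X \<star> A) \<odot>\<^sub>a \<delta>) \<odot>\<^sub>a \<delta>)"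
    by (simp add: circ.cmp_tail[OF zeta_natural_left])
  also have "\<dots> = (((ide D X \<odot>\<^sub>a m) \<cdot> ?\<alpha> X A A) \<star>\<^sub>a ide D A) \<cdot> law (X \<odot> A) \<cdot> (law X \<odot>\<^sub>a ide D A)"
    by (simp add: mixed_law_def circ.tar_merges star.tar_merges)
  finally show ?thesis .
qed

text \<open>The dual use of \<open>comult_mult\<close>: \<open>zeta_star_assoc\<close> regroups the
  interchanges, and coassociativity distributes the copies of \<delta> over two copies of the
  law.\<close>

lemma law_comult:
  assumes [simp]: "X \<in> obj D"
  shows "inv_arr D (assoc (star D) (X \<odot> A) A A) \<cdot> (ide D (X \<odot> A) \<star>\<^sub>a \<delta>) \<cdot> law X
    = (law X \<star>\<^sub>a ide D A) \<cdot> law (X \<star> A)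
      \<cdot> ((inv_arr D (assoc (star D) X A A) \<cdot> (ide D X \<star>\<^sub>a \<delta>)) \<odot>\<^sub>a ide D A)"
proof -
  let ?\<alpha> = "assoc (star D)"
  let ?\<theta> = "inv_arr D (?\<alpha> X A A) \<cdot> (ide D X \<star>\<^sub>a \<delta>)"
  let ?Z = "zeta D (X \<star> A) A (A \<star> A) A \<cdot> (?\<theta> \<odot>\<^sub>a ((\<delta> \<star>\<^sub>a ide D A) \<cdot> \<delta>))"
  have "(ide D (X \<odot> A) \<star>\<^sub>a \<delta>) \<cdot> law X
      = (ide D (X \<odot> A) \<star>\<^sub>a (m \<star>\<^sub>a m)) \<cdot> (ide D (X \<odot> A) \<star>\<^sub>a zeta D A A A A)
        \<cdot> ((ide D X \<odot>\<^sub>a ide D A) \<star>\<^sub>a (\<delta> \<odot>\<^sub>a \<delta>)) \<cdot> zeta D X A A A \<cdot> (ide D (X \<star> A) \<odot>\<^sub>a \<delta>)"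
    by (simp add: mixed_law_def star.tar_merges comult_mult)
  also have "\<dots> = (ide D (X \<odot> A) \<star>\<^sub>a (m \<star>\<^sub>a m)) \<cdot> (ide D (X \<odot> A) \<star>\<^sub>a zeta D A A A A)
        \<cdot> zeta D X (A \<star> A) A (A \<star> A) \<cdot> ((ide D X \<star>\<^sub>a \<delta>) \<odot>\<^sub>a (ide D A \<star>\<^sub>a \<delta>)) \<cdot> (ide D (X \<star> A) \<odot>\<^sub>a \<delta>)"
    by (simp add: circ.cmp_tail[OF zeta_natural])
  also have "\<dots> = (ide D (X \<odot> A) \<star>\<^sub>a (m \<star>\<^sub>a m)) \<cdot> ((ide D (X \<odot> A) \<star>\<^sub>a zeta D A A A A)
        \<cdot> zeta D X (A \<star> A) A (A \<star> A) \<cdot> (?\<alpha> X A A \<odot>\<^sub>a ?\<alpha> A A A)) \<cdot> (?\<theta> \<odot>\<^sub>a ((\<delta> \<star>\<^sub>a ide D A) \<cdot> \<delta>))"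
    by (simp add: circ.tar_merges star.inv_tail comult_laws)
  also have "\<dots> = (ide D (X \<odot> A) \<star>\<^sub>a (m \<star>\<^sub>a m)) \<cdot> ?\<alpha> (X \<odot> A) (A \<odot> A) (A \<odot> A) \<cdot>
        (zeta D X A A A \<star>\<^sub>a ide D (A \<odot> A)) \<cdot> ?Z"
    by (subst zeta_star_assoc[symmetric]) simp_all
  also have "\<dots> = ?\<alpha> (X \<odot> A) A A \<cdot> ((ide D (X \<odot> A) \<star>\<^sub>a m) \<star>\<^sub>a m) \<cdot> (zeta D X A A A \<star>\<^sub>a ide D (A \<odot> A)) \<cdot> ?Z"
    by (simp add: circ.cmp_tail[OF star.assoc_natural])
  finally have "inv_arr D (?\<alpha> (X \<odot> A) A A) \<cdot> (ide D (X \<odot> A) \<star>\<^sub>a \<delta>) \<cdot> law X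
      = ((ide D (X \<odot> A) \<star>\<^sub>a m) \<star>\<^sub>a m) \<cdot> (zeta D X A A A \<star>\<^sub>a ide D (A \<odot> A)) \<cdot> ?Z"
    by (simp add: star.inv_tail)
  also have "\<dots> = (((ide D (X \<odot> A) \<star>\<^sub>a m) \<cdot> zeta D X A A A) \<star>\<^sub>a m) \<cdot> zeta D (X \<star> A) A (A \<star> A) A
        \<cdot> (ide D ((X \<star> A) \<star> A) \<odot>\<^sub>a (\<delta> \<star>\<^sub>a ide D A)) \<cdot> (?\<theta> \<odot>\<^sub>a \<delta>)"
    by (simp add: star.tar_merges circ.tar_merges)
  also have "\<dots> = (((ide D (X \<odot> A) \<star>\<^sub>a m) \<cdot> zeta D X A A A) \<star>\<^sub>a m)
        \<cdot> ((ide D (X \<star> A) \<odot>\<^sub>a \<delta>) \<star>\<^sub>a (ide D A \<odot>\<^sub>a ide D A)) \<cdot> zeta D (X \<star> A) A A A \<cdot> (?\<theta> \<odot>\<^sub>a \<delta>)"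
    by (simp add: circ.cmp_tail[OF zeta_natural_right])
  also have "\<dots> = (law X \<star>\<^sub>a ide D A) \<cdot> law (X \<star> A) \<cdot> (?\<theta> \<odot>\<^sub>a ide D A)"
    by (simp add: mixed_law_def circ.tar_merges star.tar_merges)
  finally show ?thesis .
qed

sublocale mixed_distributive_law D T G law
proof (intro mixed_distributive_law.intro mixed_distributive_law_axioms.intro)
  show "monad_on D T" by (rule circ.monad_tensor_monad[OF monoid])
  show "comonad_on D G" by (rule star.comonad_tensor_comonad[OF comonoid])
  show "nat_trans D D (comp_funct (mfun T) (wfun G)) (comp_funct (wfun G) (mfun T)) law"
    by (rule nat_transI) (simp_all add: hom_iff law_natural)
next
  fix X assume [simp]: "X \<in> obj D"
  show "law X \<cdot> mmult T ((wfun G)\<langle>X\<rangle>) = (wfun G)\<lceil>mmult T X\<rceil> \<cdot> law ((mfun T)\<langle>X\<rangle>) \<cdot> (mfun T)\<lceil>law X\<rceil>"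
    using law_mult by simp
  show "law X \<cdot> munit T ((wfun G)\<langle>X\<rangle>) = (wfun G)\<lceil>munit T X\<rceil>"
    by (simp add: circ.cmp_tail[OF law_unit])
  show "wcomult G ((mfun T)\<langle>X\<rangle>) \<cdot> law X = (wfun G)\<lceil>law X\<rceil> \<cdot> law ((wfun G)\<langle>X\<rangle>) \<cdot> (mfun T)\<lceil>wcomult G X\<rceil>"
    using law_comult by simp
  show "wcounit G ((mfun T)\<langle>X\<rangle>) \<cdot> law X = (mfun T)\<lceil>wcounit G X\<rceil>"
    using law_counit by simp
qed

abbreviation "W \<equiv> tensor_comonad D (star D) \<I> (Delta D) (tau D)"

text \<open>Since \<open>m \<cdot> (e \<odot> A)\<close> is the left unit, \<open>\<kappa>\<close> is the canonical coaction on a free module induced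
  by pushing an \<open>I\<close>-coaction forward along the comonoid morphism \<open>e : I \<rightarrow> A\<close>.\<close>

lemma kappa_eq:
  assumes P: "P \<in> coem_objects D W"
  shows "kappa D A m e \<delta> P = ((comp_funct (free_funct D T) forgetful)\<langle>P\<rangle>,
    law (fst P) \<cdot> (mfun T)\<lceil>(ide D (fst P) \<star>\<^sub>a e) \<cdot> snd P\<rceil>,
    lift_obj ((comp_funct (free_funct D T) forgetful)\<langle>P\<rangle>))"
proof -
  obtain X \<theta> where PX: "P = (X, \<theta>)" by (cases P)
  have [simp]: "X \<in> obj D" "\<theta> \<in> arr D" "src D \<theta> = X" "tgt D \<theta> = X \<star> \<I>"
    using coem_objectsD[OF P] by (simp_all add: PX)
  have "law X \<cdot> (((ide D X \<star>\<^sub>a e) \<cdot> \<theta>) \<odot>\<^sub>a ide D A)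
      = (ide D (X \<odot> A) \<star>\<^sub>a m) \<cdot> zeta D X A A A \<cdot> ((ide D X \<star>\<^sub>a e) \<odot>\<^sub>a ide D (A \<star> A)) \<cdot> (\<theta> \<odot>\<^sub>a \<delta>)"
    by (simp add: mixed_law_def circ.tar_merges)
  also have "\<dots> = (ide D (X \<odot> A) \<star>\<^sub>a m) \<cdot> ((ide D X \<odot>\<^sub>a ide D A) \<star>\<^sub>a (e \<odot>\<^sub>a ide D A)) \<cdot> zeta D X \<I> A A \<cdot> (\<theta> \<odot>\<^sub>a \<delta>)"
    by (simp add: circ.cmp_tail[OF zeta_natural_left])
  also have "\<dots> = (ide D (X \<odot> A) \<star>\<^sub>a lunit (circ D) A) \<cdot> zeta D X \<I> A A \<cdot> (ide D (X \<star> \<I>) \<odot>\<^sub>a \<delta>) \<cdot> (\<theta> \<odot>\<^sub>a ide D A)"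
    by (simp add: star.tar_merges circ.tar_merges mult_laws)
  finally show ?thesis
    by (simp add: PX kappa_def F_funct_def free_module_funct_def lifted_obj_def lift_obj_def)
qed

text \<open>\<open>counit_unit\<close> and \<open>comult_unit\<close> express that \<open>e\<close>
  is a morphism of comonoids, so tensoring with it yields the comonad morphism wanted as
  \<sigma>.\<close>

sublocale comodule_comparison D T G law W "\<lambda>X. ide D X \<star>\<^sub>a e" "kappa D A m e \<delta>"
proof (intro comodule_comparison.intro comodule_comparison_axioms.intro monad_comonad.intro)
  show "mixed_distributive_law D T G law" ..
  show "monad_on D T" ..
  show "comonad_on D W" by (rule star.comonad_tensor_comonad[OF I_comonoid])
  show "nat_trans D D (wfun W) (wfun G) (\<lambda>X. ide D X \<star>\<^sub>a e)"
    by (rule nat_transI) (simp_all add: hom_iff star.tar_merges)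
next
  fix X assume [simp]: "X \<in> obj D"
  show "wcounit G X \<cdot> (ide D X \<star>\<^sub>a e) = wcounit W X"
    by (simp add: star.tar_merges counit_unit)
  have "wcomult G X \<cdot> (ide D X \<star>\<^sub>a e) = inv_arr D (assoc (star D) X A A) \<cdot> (ide D X \<star>\<^sub>a (e \<star>\<^sub>a e)) \<cdot> (ide D X \<star>\<^sub>a Delta D)"
    by (simp add: star.tar_merges comult_unit)
  also have "\<dots> = ((ide D X \<star>\<^sub>a e) \<star>\<^sub>a e) \<cdot> wcomult W X"
    by (simp add: circ.cmp_tail[OF star.inv_assoc_natural])
  finally show "wcomult G X \<cdot> (ide D X \<star>\<^sub>a e)
      = (wfun G)\<lceil>ide D X \<star>\<^sub>a e\<rceil> \<cdot> (ide D ((wfun W)\<langle>X\<rangle>) \<star>\<^sub>a e) \<cdot> wcomult W X"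
    by (simp add: star.tar_merges)
qed (rule kappa_eq)

end

section \<open>Identification of the duoidal notions with the abstract ones\<close>

theorem corollary3p9:
  fixes D :: "('o, 'a) duoidal"
  assumes "duoidal_category D"
    and "cauchy_complete D"
    and "full (I_comodules D) (right_modules D \<J>\<^bsub>D\<^esub> (mu D) (tau D))
           (F_funct D \<J>\<^bsub>D\<^esub> (mu D) (tau D))"
    and "faithful (I_comodules D) (F_funct D \<J>\<^bsub>D\<^esub> (mu D) (tau D))"
  shows "\<forall>A m e \<delta> \<epsilon>. bimonoid D A m e \<delta> \<epsilon> \<longrightarrow>
    (equivalence_of_categories (I_comodules D) (hopf_modules D A m e \<delta> \<epsilon>)
       (comparison D A m e \<delta>)
     \<longleftrightarrow> galois D A m e \<delta> \<epsilon>)"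
proof (intro allI impI)
  fix A m e \<delta> \<epsilon> assume "bimonoid D A m e \<delta> \<epsilon>"
  then interpret duoidal_bimonoid D A m e \<delta> \<epsilon>
    by (intro duoidal_bimonoid.intro duoidal_bimonoid_axioms.intro assms)
  let ?T' = "tensor_monad D (circ D) \<J>\<^bsub>D\<^esub> (mu D) (tau D)"
  have F: "F_funct D B n u = comp_funct (free_funct D (tensor_monad D (circ D) B n u)) forgetful" for B n u
    by (simp add: F_funct_def free_module_funct_def)
  have I: "I_comonad D = W" and IC: "I_comodules D = coem_cat D W"
    by (simp_all add: I_comonad_def I_comodules_def)
  have M: "right_modules D B n u = em_cat D (tensor_monad D (circ D) B n u)" for B n u
    by (simp add: right_modules_def)
  have Q: "Q_funct D = comp_funct (cofree_funct D W) forgetful"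
    by (simp add: Q_funct_def I)
  have L: "lifted_comonad D A m \<delta> \<epsilon> = lift"
    by (simp add: lifted_comonad_def lift_def lifted_obj_def lift_obj_def split_beta fun_eq_iff)
  have counit: "FQ_counit D A m e P = counit P" for P
    by (simp add: FQ_counit_def counit_def M free_module_funct_def I)
  have K: "comparison D A m e \<delta> = K"
    by (simp add: comparison_def K_def IC F)
  \<comment> \<open>The two families agree at every argument, so the Galois condition is literally
    invertibility of \<open>can\<close>.\<close>
  have can: "t_K D A m e \<delta> \<epsilon> = can"
    by (simp add: t_K_def can_def fun_eq_iff L M Q counit)
  have "equivalence_of_categories (coem_cat D W) (coem_cat (em_cat D T) lift) K
      \<longleftrightarrow> nat_iso (em_cat D T) (em_cat D T)
        (comp_funct (comp_funct (free_funct D T) forgetful) (comp_funct (cofree_funct D W) forgetful)) (wfun lift) can"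
  proof (rule equivalence_iff_galois)
    show "monad_on D ?T'"
      by (rule circ.monad_tensor_monad[OF J_monoid])
    \<comment> \<open>The comparison of monads is \<open>X \<odot> \<epsilon>\<close>. Up to the
      inverse unitor, its compatibility with the units is
      \<open>\<epsilon> \<cdot> e = tau D\<close>.\<close>
    show "nat_trans D D (mfun T) (mfun ?T') (\<lambda>X. ide D X \<odot>\<^sub>a\<^bsub>D\<^esub> \<epsilon>)"
      by (rule nat_transI) (simp_all add: hom_iff circ.tar_merges)
    show "(ide D X \<odot>\<^sub>a\<^bsub>D\<^esub> \<epsilon>) \<cdot>\<^bsub>D\<^esub> munit T X = munit ?T' X" if "X \<in> obj D" for X
      using that by (simp add: circ.tar_merges counit_unit)
  qed (use assms in \<open>simp_all add: F IC M\<close>)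
  then show "equivalence_of_categories (I_comodules D) (hopf_modules D A m e \<delta> \<epsilon>) (comparison D A m e \<delta>)
      \<longleftrightarrow> galois D A m e \<delta> \<epsilon>"
    by (simp add: IC hopf_modules_def galois_def M L K F Q can)
qed

end
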